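(* Let $0<p\le\infty$, $k,r\in\mathbb{N}$, $0<\alpha\le r$, and $p_1=\min(p,1)$. Then there is a constant $C$, independent of $f$ and $n$, such that for every $f\in H_p^{r,\alpha}$ and $n\in\mathbb{N}$ $$E_n(f)_{H_p^{r,\alpha}}\le C\,\psi_{k,r,\alpha}\left(f,\tfrac1n\right)_p\quad\text{if }1\le p\le\infty,$$ $$E_n(f)_{H_p^{r,\alpha}}\le C\left(\int_0^{1/n}\left(\frac{\omega_{r+k}(f,t)_p}{t^\alpha}\right)^p\frac{dt}{t}\right)^{1/p}\quad\text{if }0<p<1.$$ In particular, for all $0<p\le\infty$, $$E_n(f)_{H_p^{r,\alpha}}\le C\left(\int_0^{1/n}\left(\frac{\omega_{r+k}(f,t)_p}{t^\alpha}\right)^{p_1}\frac{dt}{t}\right)^{1/p_1},$$ where $C$ is independent of $f$ and $n$.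
   Context: $\mathbb{T}\cong[0,2\pi)$ is the torus; functions are complex-valued and $2\pi$-periodic. For $0<p<\infty$, $L_p=L_p(\mathbb{T})$ is the space of measurable functions with $\|f\|_p=\left(\frac1{2\pi}\int_{\mathbb{T}}|f(x)|^p\,dx\right)^{1/p}<\infty$; $L_\infty$ denotes the space of $2\pi$-periodic continuous functions with $\|f\|_\infty=\max|f|$. For $k\in\mathbb{N}=\{1,2,\dots\}$: $\Delta_\delta^k f(x)=\sum_{\nu=0}^k(-1)^\nu\binom k\nu f(x+\nu\delta)$ and $\omega_k(f,t)_p=\sup_{0<\delta<t}\|\Delta_\delta^kf\|_p$. For $0<p\le\infty$, $r\in\mathbb{N}$, $0<\alpha\le r$: $f\in H_p^{r,\alpha}$ if $f\in L_p$ and $\|f\|_{H_p^{r,\alpha}}=\|f\|_p+|f|_{H_p^{r,\alpha}}<\infty$, where $|f|_{H_p^{r,\alpha}}=\sup_{h>0}h^{-\alpha}\|\Delta_h^rf\|_p$. $\mathcal{T}_n$ is the set of trigonometric polynomials $\sum_{\nu=-n}^nc_\nu e^{i\nu x}$, $c_\nu\in\mathbb{C}$, and $E_n(f)_{H_p^{r,\alpha}}=\inf_{T\in\mathcal{T}_n}\|f-T\|_{H_p^{r,\alpha}}$. Further, $\psi_{k,r,\alpha}(f,\delta)_p=\sup_{0<h\le\delta}h^{-\alpha}\omega_k(\Delta_h^rf,\delta)_p$. *)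

theory Defs
  imports "HOL-Analysis.Analysis" "HOL-Library.Periodic_Fun"
begin

text \<open>All (quasi-)norms, moduli of smoothness and best approximations take values in
  \<^typ>\<open>ennreal\<close>, so that suprema and integrals that may be infinite need no side conditions.
  The exponent \<open>p\<close> also has type \<^typ>\<open>ennreal\<close> and covers \<open>0 < p \<le> \<infinity>\<close>.\<close>

text \<open>Only used with exponents \<open>a > 0\<close>; hence \<open>\<infinity>\<close> is sent to \<open>\<infinity>\<close> and \<open>0\<close> to \<open>0\<close>.\<close>

definition ennpowr :: "ennreal \<Rightarrow> real \<Rightarrow> ennreal" where
  "ennpowr x a = (if x = \<infinity> then \<infinity> else ennreal (enn2real x powr a))"

text \<open>For \<open>p = \<infinity>\<close> the norm is applied to continuous periodic functions only, for which the
  supremum is the maximum.\<close>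

definition Lp_norm :: "ennreal \<Rightarrow> (real \<Rightarrow> complex) \<Rightarrow> ennreal" where
  "Lp_norm p f =
     (if p = \<infinity> then (SUP x. ennreal (norm (f x)))
      else ennpowr
        (ennreal (1 / (2 * pi)) *
           (\<integral>\<^sup>+x\<in>{0..<2*pi}. ennreal (norm (f x) powr enn2real p) \<partial>lebesgue))
        (1 / enn2real p))"

definition Lp :: "ennreal \<Rightarrow> (real \<Rightarrow> complex) set" where
  "Lp p = {f. periodic_fun_simple f (2 * pi) \<and>
     (if p = \<infinity> then continuous_on UNIV f
      else f \<in> borel_measurable lebesgue \<and> Lp_norm p f < \<infinity>)}"

definition fdiff :: "nat \<Rightarrow> real \<Rightarrow> (real \<Rightarrow> complex) \<Rightarrow> real \<Rightarrow> complex" where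
  "fdiff k \<delta> f x = (\<Sum>\<nu>\<le>k. (-1) ^ \<nu> * of_nat (k choose \<nu>) * f (x + real \<nu> * \<delta>))"

definition modulus :: "nat \<Rightarrow> (real \<Rightarrow> complex) \<Rightarrow> real \<Rightarrow> ennreal \<Rightarrow> ennreal" where
  "modulus k f t p = (SUP \<delta>\<in>{0<..<t}. Lp_norm p (fdiff k \<delta> f))"

definition H_seminorm :: "ennreal \<Rightarrow> nat \<Rightarrow> real \<Rightarrow> (real \<Rightarrow> complex) \<Rightarrow> ennreal" where
  "H_seminorm p r \<alpha> f = (SUP h\<in>{0<..}. ennreal (h powr - \<alpha>) * Lp_norm p (fdiff r h f))"

definition H_norm :: "ennreal \<Rightarrow> nat \<Rightarrow> real \<Rightarrow> (real \<Rightarrow> complex) \<Rightarrow> ennreal" where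
  "H_norm p r \<alpha> f = Lp_norm p f + H_seminorm p r \<alpha> f"

definition H_space :: "ennreal \<Rightarrow> nat \<Rightarrow> real \<Rightarrow> (real \<Rightarrow> complex) set" where
  "H_space p r \<alpha> = {f \<in> Lp p. H_norm p r \<alpha> f < \<infinity>}"

definition trig_polys :: "nat \<Rightarrow> (real \<Rightarrow> complex) set" where
  "trig_polys n =
     {T. \<exists>c :: int \<Rightarrow> complex.
        T = (\<lambda>x. \<Sum>\<nu>\<in>{- int n..int n}. c \<nu> * exp (\<i> * of_int \<nu> * of_real x))}"

definition best_approx_H ::
    "nat \<Rightarrow> ennreal \<Rightarrow> nat \<Rightarrow> real \<Rightarrow> (real \<Rightarrow> complex) \<Rightarrow> ennreal" where
  "best_approx_H n p r \<alpha> f = (INF T\<in>trig_polys n. H_norm p r \<alpha> (\<lambda>x. f x - T x))"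

definition psi_modulus ::
    "nat \<Rightarrow> nat \<Rightarrow> real \<Rightarrow> (real \<Rightarrow> complex) \<Rightarrow> real \<Rightarrow> ennreal \<Rightarrow> ennreal" where
  "psi_modulus k r \<alpha> f \<delta> p =
     (SUP h\<in>{0<..\<delta>}. ennreal (h powr - \<alpha>) * modulus k (fdiff r h f) \<delta> p)"

definition modulus_integral ::
    "nat \<Rightarrow> real \<Rightarrow> (real \<Rightarrow> complex) \<Rightarrow> real \<Rightarrow> ennreal \<Rightarrow> real \<Rightarrow> ennreal" where
  "modulus_integral m \<alpha> f b p q =
     ennpowr
       (\<integral>\<^sup>+t\<in>{0<..<b}. ennpowr (modulus m f t p / ennreal (t powr \<alpha>)) q * ennreal (1 / t)
          \<partial>lborel)
       (1 / q)"

end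

theory Submission
  imports Defs
begin

text \<open>Put \<open>m = r + k\<close>. An approximating polynomial always has the form \<open>T = f - U\<^sup>m f\<close>
  with \<open>U = I - J\<close>, where \<open>J\<close> is a linear averaging operator whose values are trigonometric
  polynomials of degree at most \<open>n\<close>. Its kernel, a Dirichlet kernel times a high power of a
  normalized Dirichlet kernel, has mean \<open>1\<close> and is of order \<open>n (1 + n\<bar>x\<bar>)\<^sup>-\<^sup>L\<close>, so \<open>U g\<close>
  is bounded by first differences of \<open>g\<close> with steps up to \<open>1/n\<close>. Since \<open>U\<close> commutes with these
  differences, \<open>U\<^sup>m f\<close> is bounded by mixed \<open>m\<close>-th differences.

  For \<open>1 \<le> p \<le> \<infinity>\<close>, \<open>J\<close> is convolution (\<open>conv\<close>). It commutes with all translations, and mixed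
  differences are dominated by ordinary ones (\<open>mdiff_osc\<close>), so \<open>\<Delta>\<^sub>h\<^sup>r (f - T)\<close> is bounded by the
  \<open>m\<close>-th modulus of \<open>\<Delta>\<^sub>h\<^sup>r f\<close> (\<open>jackson\<close>); this gives the bound by \<open>\<psi>\<close>
  (\<open>best_approx_le_psi\<close>). In turn \<open>\<psi>\<close> is at most a constant times the integral of \<open>\<omega>\<^sub>m\<close>: doubling
  the step \<open>h\<close> repeatedly trades \<open>\<Delta>\<^sub>h\<^sup>R\<close> for \<open>\<Delta>\<close> with step \<open>2h\<close> at the price of \<open>\<Delta>\<^sub>h\<close> to the
  power \<open>R + 1\<close>, as in Marchaud's inequality (\<open>fdiff_halving\<close>, \<open>ladder_sum\<close>,
  \<open>psi_le_modulus_integral\<close>).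

  For \<open>0 < p < 1\<close> functions in \<open>L\<^sub>p\<close> need not be integrable, so \<open>J\<close> averages the values of
  \<open>f\<close> on a lattice \<open>y + (2\<pi>/8n)\<int>\<close>; on the lattice all differences are multiples of one step, and
  subadditivity of \<open>t \<mapsto> t\<^sup>p\<close> suffices (\<open>node_sum_sdefect_pow_le\<close>). Take the operators of the levels
  \<open>n\<^sub>i = 2\<^sup>i n\<close> with one offset \<open>y\<close> and telescope, \<open>f - T\<^sub>0 = \<Sum>\<^sub>i (T\<^sub>i\<^sub>+\<^sub>1 - T\<^sub>i)\<close>. Each summand is a
  polynomial of degree \<open>2 n\<^sub>i\<close> that is controlled on the lattice by \<open>m\<close>-th differences of
  \<open>f\<close>, and a Bernstein inequality (\<open>bernstein_holder\<close>) controls its Hoelder seminorm. The average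
  over \<open>y\<close> of the sum of all these lattice quantities is bounded by the dyadic sum of
  \<open>n\<^sub>i\<close> to the power \<open>\<alpha>p\<close> times \<open>\<omega>\<^sub>m(f, 1/n\<^sub>i)\<^sup>p\<close>, hence by the integral, and the remainders
  tend to \<open>0\<close> in the mean; so some \<open>y\<close> is good for all levels at once
  (\<open>exists_good_node\<close>, \<open>multilevel_approximation\<close>).\<close>


section \<open>Differences and translation-invariant quasi-norms\<close>

text \<open>The first difference, with the sign convention of \<open>fdiff\<close>.\<close>

definition diff1 :: "real \<Rightarrow> (real \<Rightarrow> complex) \<Rightarrow> real \<Rightarrow> complex" where
  "diff1 u f = (\<lambda>x. f x - f (x + u))"

text \<open>The common domain of all functionals below. Borel measurability (rather than Lebesgue
  measurability) is needed for joint measurability of \<open>f (x + y)\<close>.\<close>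

definition periodic_borel :: "(real \<Rightarrow> complex) set" where
  "periodic_borel = {f. f \<in> borel_measurable borel \<and> (\<forall>x. f (x + 2 * pi) = f x)}"

text \<open>The mixed difference with steps \<open>u 1, \<dots>, u m\<close>.\<close>

fun mdiff :: "nat \<Rightarrow> (nat \<Rightarrow> real) \<Rightarrow> (real \<Rightarrow> complex) \<Rightarrow> real \<Rightarrow> complex" where
  "mdiff 0 u f = f"
| "mdiff (Suc m) u f = diff1 (u (Suc m)) (mdiff m u f)"

lemma fdiff_0 [simp]: "fdiff 0 d f = f"
  by (simp add: fdiff_def fun_eq_iff)

lemma fdiff_Suc: "fdiff (Suc k) d f = diff1 d (fdiff k d f)"
proof
  fix x
  have "fdiff (Suc k) d f x = (\<Sum>\<nu>\<le>Suc k. (-1)^\<nu> * of_nat (Suc k choose \<nu>) * f (x + real \<nu> * d))"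
    by (simp add: fdiff_def)
  also have "\<dots> = f x + (\<Sum>\<nu>\<le>k. (-1)^Suc \<nu> * of_nat (Suc k choose Suc \<nu>) * f (x + real (Suc \<nu>) * d))"
    by (subst sum.atMost_Suc_shift) simp
  also have "(\<Sum>\<nu>\<le>k. (-1)^Suc \<nu> * of_nat (Suc k choose Suc \<nu>) * f (x + real (Suc \<nu>) * d))
     = (\<Sum>\<nu>\<le>k. (-1)^Suc \<nu> * of_nat (k choose Suc \<nu>) * f (x + real (Suc \<nu>) * d))
       - (\<Sum>\<nu>\<le>k. (-1)^\<nu> * of_nat (k choose \<nu>) * f (x + d + real \<nu> * d))"
    unfolding sum_subtractf[symmetric] by (rule sum.cong) (simp_all add: algebra_simps)
  also have "f x + (\<dots>) = (\<Sum>\<nu>\<le>Suc k. (-1)^\<nu> * of_nat (k choose \<nu>) * f (x + real \<nu> * d))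
       - fdiff k d f (x + d)"
    by (subst sum.atMost_Suc_shift) (simp add: fdiff_def)
  also have "(\<Sum>\<nu>\<le>Suc k. (-1)^\<nu> * of_nat (k choose \<nu>) * f (x + real \<nu> * d)) = fdiff k d f x"
    by (simp add: fdiff_def)
  finally show "fdiff (Suc k) d f x = diff1 d (fdiff k d f) x"
    by (simp add: diff1_def)
qed

lemma fdiff_1: "fdiff 1 d f = diff1 d f"
  using fdiff_Suc[of 0 d f] by simp

lemma diff1_commute: "diff1 u (diff1 v f) = diff1 v (diff1 u f)"
  by (simp add: diff1_def fun_eq_iff algebra_simps)

lemma diff1_fdiff_commute: "diff1 u (fdiff k d f) = fdiff k d (diff1 u f)"
  by (induction k) (auto simp: fdiff_Suc diff1_commute[of u d])

lemma fdiff_Suc': "fdiff (Suc k) d f = fdiff k d (diff1 d f)"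
  by (simp add: fdiff_Suc diff1_fdiff_commute)

lemma fdiff_commute: "fdiff j u (fdiff k d f) = fdiff k d (fdiff j u f)"
  by (induction j) (auto simp: fdiff_Suc diff1_fdiff_commute)

lemma fdiff_add: "fdiff (j + k) d f = fdiff j d (fdiff k d f)"
  by (induction j) (auto simp: fdiff_Suc)

lemma diff1_diff: "diff1 u (\<lambda>x. f x - g x) = (\<lambda>x. diff1 u f x - diff1 u g x)"
  by (simp add: diff1_def fun_eq_iff)

lemma fdiff_diff: "fdiff k u (\<lambda>x. f x - g x) = (\<lambda>x. fdiff k u f x - fdiff k u g x)"
  by (induction k) (auto simp: fdiff_Suc diff1_diff)

lemma fdiff_zero_step: "k \<ge> 1 \<Longrightarrow> fdiff k 0 f = (\<lambda>x. 0)"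
  by (cases k) (auto simp: fdiff_Suc diff1_def)

lemma fdiff_minus: "fdiff m (- v) f = (\<lambda>x. (-1)^m * fdiff m v f (x + (- real m * v)))"
proof (induction m)
  case (Suc m)
  show ?case
    by (simp add: fdiff_Suc Suc fun_eq_iff diff1_def algebra_simps)
qed simp

lemma mdiff_const: "mdiff m (\<lambda>_. v) f = fdiff m v f"
  by (induction m) (auto simp: fdiff_Suc)

lemma mdiff_cong: "(\<And>i. i \<in> {1..m} \<Longrightarrow> u i = v i) \<Longrightarrow> mdiff m u f = mdiff m v f"
  by (induction m) auto

lemma mdiff_append:
  "mdiff (a + b) (\<lambda>i. if i \<le> b then v else u) f = fdiff a u (fdiff b v f)"
proof (induction a)
  case 0
  then show ?case using mdiff_cong[of b "\<lambda>i. if i \<le> b then v else u" "\<lambda>_. v" f]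
    by (simp add: mdiff_const)
qed (auto simp: fdiff_Suc)

lemma diff1_mdiff_commute: "diff1 v (mdiff m u f) = mdiff m u (diff1 v f)"
  by (induction m) (auto simp: diff1_commute[of v])

lemma sum_Pow_insert:
  fixes g :: "nat set \<Rightarrow> 'b::comm_monoid_add"
  assumes "finite A" "a \<notin> A"
  shows "(\<Sum>S\<in>Pow (insert a A). g S) = (\<Sum>S\<in>Pow A. g S + g (insert a S))"
proof -
  have "(\<Sum>S\<in>Pow (insert a A). g S) = (\<Sum>S\<in>Pow A. g S) + (\<Sum>S\<in>insert a ` Pow A. g S)"
    unfolding Pow_insert using assms by (intro sum.union_disjoint) auto
  also have "(\<Sum>S\<in>insert a ` Pow A. g S) = (\<Sum>S\<in>Pow A. g (insert a S))"
    using assms by (subst sum.reindex) (auto simp: inj_on_def)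
  finally show ?thesis by (simp add: sum.distrib)
qed

lemma mdiff_expand:
  "mdiff m u f x = (\<Sum>S\<in>Pow {1..m}. (-1)^card S * f (x + (\<Sum>j\<in>S. u j)))"
proof (induction m arbitrary: x)
  case (Suc m)
  have eq: "{1..Suc m} = insert (Suc m) {1..m}" by auto
  have "(\<Sum>S\<in>Pow {1..Suc m}. (-1)^card S * f (x + (\<Sum>j\<in>S. u j)))
     = (\<Sum>S\<in>Pow {1..m}. (-1)^card S * f (x + (\<Sum>j\<in>S. u j)) - (-1)^card S * f (x + u (Suc m) + (\<Sum>j\<in>S. u j)))"
    unfolding eq
  proof (subst sum_Pow_insert, simp, simp, rule sum.cong[OF refl])
    fix S assume "S \<in> Pow {1..m}"
    then have "finite S" "Suc m \<notin> S" by (auto intro: finite_subset)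
    then show "(-1)^card S * f (x + sum u S) + (-1)^card (insert (Suc m) S) * f (x + sum u (insert (Suc m) S)) =
       (-1)^card S * f (x + sum u S) - (-1)^card S * f (x + u (Suc m) + sum u S)"
      by (simp add: algebra_simps)
  qed
  also have "\<dots> = mdiff (Suc m) u f x"
    by (simp add: Suc diff1_def sum_subtractf)
  finally show ?case ..
qed simp

text \<open>A mixed difference is a signed sum of translated differences with equal steps. Expand the
  differences on the right: in the terms with binomial index \<open>\<nu> \<ge> 1\<close> the sets \<open>S\<close> and
  \<open>S \<union> {\<nu>}\<close> give the same argument of \<open>f\<close> and cancel, and \<open>\<nu> = 0\<close> gives the left side.\<close>

lemma mdiff_eq_sum_fdiff:
  "mdiff m u f x =
     (\<Sum>S\<in>Pow {1..m}. (-1)^card S * fdiff m (- (\<Sum>j\<in>S. u j / real j)) f (x + (\<Sum>j\<in>S. u j)))"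
proof -
  define G where "G \<nu> S = f (x + (\<Sum>j\<in>S. u j) - real \<nu> * (\<Sum>j\<in>S. u j / real j))" for \<nu> S
  have zero: "(\<Sum>S\<in>Pow {1..m}. (-1)^card S * G \<nu> S) = 0" if "\<nu> \<in> {1..m}" for \<nu>
  proof -
    have eq: "{1..m} = insert \<nu> ({1..m} - {\<nu>})" using that by auto
    show ?thesis
    proof (subst eq, subst sum_Pow_insert, simp, simp, rule sum.neutral, rule ballI)
      fix S assume "S \<in> Pow ({1..m} - {\<nu>})"
      then have S: "finite S" "\<nu> \<notin> S"
        using finite_subset[of S "{1..m}"] by auto
      have "G \<nu> (insert \<nu> S) = G \<nu> S"
        using that S by (simp add: G_def algebra_simps)
      then show "(-1)^card S * G \<nu> S + (-1)^card (insert \<nu> S) * G \<nu> (insert \<nu> S) = 0"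
        using S by simp
    qed
  qed
  have "(\<Sum>S\<in>Pow {1..m}. (-1)^card S * fdiff m (- (\<Sum>j\<in>S. u j / real j)) f (x + (\<Sum>j\<in>S. u j)))
     = (\<Sum>S\<in>Pow {1..m}. \<Sum>\<nu>\<le>m. (-1)^\<nu> * of_nat (m choose \<nu>) * ((-1)^card S * G \<nu> S))"
    by (simp add: fdiff_def G_def sum_distrib_left algebra_simps)
  also have "\<dots> = (\<Sum>\<nu>\<le>m. (-1)^\<nu> * of_nat (m choose \<nu>) * (\<Sum>S\<in>Pow {1..m}. (-1)^card S * G \<nu> S))"
    by (subst sum.swap) (simp add: sum_distrib_left)
  also have "\<dots> = (\<Sum>\<nu>\<in>{0}. (-1)^\<nu> * of_nat (m choose \<nu>) * (\<Sum>S\<in>Pow {1..m}. (-1)^card S * G \<nu> S))"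
    using zero by (intro sum.mono_neutral_right) (auto simp: Suc_le_eq)
  also have "\<dots> = mdiff m u f x"
    by (simp add: mdiff_expand G_def)
  finally show ?thesis ..
qed

lemma periodic_borelI:
  "f \<in> borel_measurable borel \<Longrightarrow> (\<And>x. f (x + 2 * pi) = f x) \<Longrightarrow> f \<in> periodic_borel"
  by (simp add: periodic_borel_def)

lemma periodic_borel_measurable [measurable_dest]:
  "f \<in> periodic_borel \<Longrightarrow> f \<in> borel_measurable borel"
  by (simp add: periodic_borel_def)

lemma periodic_borel_periodic: "f \<in> periodic_borel \<Longrightarrow> f (x + 2 * pi) = f x"
  by (simp add: periodic_borel_def)

lemma periodic_borel_reflect:
  assumes "f \<in> periodic_borel" shows "f (c - (y + 2 * pi)) = f (c - y)"
  using periodic_borel_periodic[OF assms, of "c - (y + 2 * pi)"] by simp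

lemma periodic_borel_shift [simp]: "f \<in> periodic_borel \<Longrightarrow> (\<lambda>x. f (x + u)) \<in> periodic_borel"
proof -
  assume "f \<in> periodic_borel"
  then have m: "f \<in> borel_measurable borel" and p: "f ((x + u) + 2 * pi) = f (x + u)" for x
    by (auto simp: periodic_borel_def)
  show ?thesis
  proof (rule periodic_borelI)
    show "(\<lambda>x. f (x + u)) \<in> borel_measurable borel" using m by measurable
    show "f (x + 2 * pi + u) = f (x + u)" for x
      using p[of x] by (simp only: add.assoc add.commute[of u])
  qed
qed

lemma periodic_borel_scale [simp]: "f \<in> periodic_borel \<Longrightarrow> (\<lambda>x. c * f x) \<in> periodic_borel"
  by (auto simp: periodic_borel_def)

lemma periodic_borel_add [simp]:
  "f \<in> periodic_borel \<Longrightarrow> g \<in> periodic_borel \<Longrightarrow> (\<lambda>x. f x + g x) \<in> periodic_borel"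
  by (auto simp: periodic_borel_def)

lemma periodic_borel_uminus [simp]: "f \<in> periodic_borel \<Longrightarrow> (\<lambda>x. - f x) \<in> periodic_borel"
  by (auto simp: periodic_borel_def)

lemma periodic_borel_shift' [simp]: "f \<in> periodic_borel \<Longrightarrow> (\<lambda>x. f (x - u)) \<in> periodic_borel"
  using periodic_borel_shift[of f "- u"] by simp

lemma periodic_borel_diff [simp]:
  "f \<in> periodic_borel \<Longrightarrow> g \<in> periodic_borel \<Longrightarrow> (\<lambda>x. f x - g x) \<in> periodic_borel"
  by (auto simp: periodic_borel_def)

lemma periodic_borel_const [simp]: "(\<lambda>x. c) \<in> periodic_borel"
  by (auto simp: periodic_borel_def)

lemma periodic_borel_sum [simp]:
  "(\<And>i. i \<in> I \<Longrightarrow> f i \<in> periodic_borel) \<Longrightarrow> (\<lambda>x. \<Sum>i\<in>I. f i x) \<in> periodic_borel"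
  by (induction I rule: infinite_finite_induct) auto

lemma periodic_borel_diff1 [simp]: "f \<in> periodic_borel \<Longrightarrow> diff1 u f \<in> periodic_borel"
  by (simp add: diff1_def)

lemma periodic_borel_fdiff [simp]: "f \<in> periodic_borel \<Longrightarrow> fdiff k u f \<in> periodic_borel"
  by (induction k) (simp_all add: fdiff_Suc)

lemma periodic_borel_mdiff [simp]: "f \<in> periodic_borel \<Longrightarrow> mdiff k u f \<in> periodic_borel"
  by (induction k) simp_all

text \<open>A subadditive, translation-invariant functional, homogeneous of degree \<open>q\<close>. For
  \<open>p \<ge> 1\<close> it is the \<open>L\<^sub>p\<close> norm with \<open>q = 1\<close>, for \<open>p < 1\<close> the \<open>p\<close>-th power of the quasi-norm
  with \<open>q = p\<close>.\<close>

locale shift_quasinorm =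
  fixes \<rho> :: "(real \<Rightarrow> complex) \<Rightarrow> ennreal" and q :: real
  assumes q_pos: "0 < q" and q_le_1: "q \<le> 1"
    and add_le: "\<And>f g. f \<in> periodic_borel \<Longrightarrow> g \<in> periodic_borel \<Longrightarrow>
                   \<rho> (\<lambda>x. f x + g x) \<le> \<rho> f + \<rho> g"
    and scale_le: "\<And>f c. f \<in> periodic_borel \<Longrightarrow> \<rho> (\<lambda>x. c * f x) \<le> ennreal (norm c powr q) * \<rho> f"
    and shift_le: "\<And>f u. f \<in> periodic_borel \<Longrightarrow> \<rho> (\<lambda>x. f (x + u)) \<le> \<rho> f"
begin

text \<open>The modulus of smoothness measured by \<open>\<rho>\<close>.\<close>

definition osc :: "nat \<Rightarrow> (real \<Rightarrow> complex) \<Rightarrow> real \<Rightarrow> ennreal" where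
  "osc m f t = (SUP v\<in>{0<..<t}. \<rho> (fdiff m v f))"

lemma zero [simp]: "\<rho> (\<lambda>x. 0) = 0"
  using scale_le[of "\<lambda>x. 0" 0] q_pos by simp

lemma sign_le:
  assumes "f \<in> periodic_borel" shows "\<rho> (\<lambda>x. (-1)^j * f x) \<le> \<rho> f"
  using scale_le[OF assms, of "(-1)^j"] by (simp add: norm_power)

lemma diff_le:
  assumes "f \<in> periodic_borel" "g \<in> periodic_borel"
  shows "\<rho> (\<lambda>x. f x - g x) \<le> \<rho> f + \<rho> g"
proof -
  have "\<rho> (\<lambda>x. f x + (-1)^1 * g x) \<le> \<rho> f + \<rho> (\<lambda>x. (-1)^1 * g x)"
    using assms by (intro add_le) auto
  also have "\<dots> \<le> \<rho> f + \<rho> g"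
    using assms by (intro add_left_mono sign_le)
  finally show ?thesis by simp
qed

lemma sum_le:
  assumes "finite I" "\<And>i. i \<in> I \<Longrightarrow> f i \<in> periodic_borel"
  shows "\<rho> (\<lambda>x. \<Sum>i\<in>I. f i x) \<le> (\<Sum>i\<in>I. \<rho> (f i))"
  using assms
proof (induction I)
  case (insert a I)
  then have "\<rho> (\<lambda>x. f a x + (\<Sum>i\<in>I. f i x)) \<le> \<rho> (f a) + \<rho> (\<lambda>x. \<Sum>i\<in>I. f i x)"
    by (intro add_le) auto
  also have "\<dots> \<le> \<rho> (f a) + (\<Sum>i\<in>I. \<rho> (f i))"
    using insert by (intro add_left_mono) auto
  finally show ?case using insert by simp
qed simp

lemma diff1_le:
  assumes "f \<in> periodic_borel" shows "\<rho> (diff1 u f) \<le> 2 * \<rho> f"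
proof -
  have "\<rho> (diff1 u f) \<le> \<rho> f + \<rho> (\<lambda>x. f (x + u))"
    unfolding diff1_def using assms by (intro diff_le) auto
  also have "\<dots> \<le> \<rho> f + \<rho> f"
    using assms by (intro add_left_mono shift_le)
  finally show ?thesis by (simp add: mult_2)
qed

lemma fdiff_le:
  assumes "f \<in> periodic_borel" shows "\<rho> (fdiff k u f) \<le> 2^k * \<rho> f"
proof (induction k)
  case (Suc k)
  have "\<rho> (fdiff (Suc k) u f) \<le> 2 * \<rho> (fdiff k u f)"
    unfolding fdiff_Suc using assms by (intro diff1_le) auto
  also have "\<dots> \<le> 2 * (2^k * \<rho> f)"
    using Suc by (intro mult_left_mono) auto
  finally show ?case by (simp add: mult.assoc)
qed simp

lemma fdiff_minus_le:
  assumes "f \<in> periodic_borel" shows "\<rho> (fdiff k (- u) f) \<le> \<rho> (fdiff k u f)"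
proof -
  have "\<rho> (fdiff k (- u) f) \<le> \<rho> (\<lambda>x. fdiff k u f (x + (- real k * u)))"
    unfolding fdiff_minus by (rule sign_le) (use assms in auto)
  also have "\<dots> \<le> \<rho> (fdiff k u f)"
    by (rule shift_le) (use assms in auto)
  finally show ?thesis .
qed

lemma fdiff_osc:
  assumes f: "f \<in> periodic_borel" and m: "m \<ge> 1" and v: "\<bar>v\<bar> < t"
  shows "\<rho> (fdiff m v f) \<le> osc m f t"
proof -
  consider "v = 0" | "v > 0" | "v < 0" by linarith
  then show ?thesis
  proof cases
    case 1
    then show ?thesis using fdiff_zero_step[OF m] by simp
  next
    case 2
    then show ?thesis unfolding osc_def by (intro SUP_upper) (use v in auto)
  next
    case 3
    have "\<rho> (fdiff m v f) \<le> \<rho> (fdiff m (- v) f)"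
      using fdiff_minus_le[OF f, of m "- v"] by simp
    also have "\<dots> \<le> osc m f t"
      unfolding osc_def by (intro SUP_upper) (use 3 v in auto)
    finally show ?thesis .
  qed
qed

lemma osc_mono: "s \<le> t \<Longrightarrow> osc m f s \<le> osc m f t"
  unfolding osc_def by (intro SUP_subset_mono) auto

lemma diff1_multiple:
  assumes "f \<in> periodic_borel"
  shows "\<rho> (diff1 (real j * v) f) \<le> of_nat j * \<rho> (diff1 v f)"
proof (induction j)
  case 0
  have "diff1 0 f = (\<lambda>x. 0)" by (simp add: diff1_def)
  then show ?case by simp
next
  case (Suc j)
  have eq: "diff1 (real (Suc j) * v) f = (\<lambda>x. diff1 v f x + diff1 (real j * v) f (x + v))"
    by (simp add: diff1_def fun_eq_iff algebra_simps)
  have "\<rho> (diff1 (real (Suc j) * v) f) \<le> \<rho> (diff1 v f) + \<rho> (\<lambda>x. diff1 (real j * v) f (x + v))"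
    unfolding eq by (rule add_le) (use assms in auto)
  also have "\<dots> \<le> \<rho> (diff1 v f) + of_nat j * \<rho> (diff1 v f)"
    using assms by (intro add_left_mono order_trans[OF shift_le Suc]) auto
  finally show ?case by (simp add: algebra_simps)
qed

lemma diff1_osc:
  assumes f: "f \<in> periodic_borel" and t: "t > 0"
  shows "\<rho> (diff1 u f) \<le> ennreal (1 + \<bar>u\<bar> / t) * osc 1 f t"
proof -
  define j where "j = nat (\<lfloor>\<bar>u\<bar> / t\<rfloor>) + 1"
  have j: "real j \<le> 1 + \<bar>u\<bar> / t" "\<bar>u\<bar> / t < real j"
    using t by (simp_all add: j_def of_nat_nat) linarith+
  have "real j > 0" by (simp add: j_def)
  then have "\<bar>u / real j\<bar> < t"
    using t j(2) by (simp add: field_simps)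
  then have *: "\<rho> (diff1 (u / real j) f) \<le> osc 1 f t"
    using fdiff_osc[OF f, of 1 "u / real j" t] fdiff_1 by simp
  have "real j * (u / real j) = u" by (simp add: j_def)
  then have "\<rho> (diff1 u f) \<le> of_nat j * \<rho> (diff1 (u / real j) f)"
    using diff1_multiple[OF f, of j "u / real j"] by simp
  also have "\<dots> \<le> ennreal (1 + \<bar>u\<bar> / t) * osc 1 f t"
    using j * by (intro mult_mono) (auto simp: ennreal_of_nat_eq_real_of_nat ennreal_leI)
  finally show ?thesis .
qed

text \<open>The mean of \<open>f\<close> and its translate, which links the steps \<open>h\<close> and \<open>2h\<close>:
  \<open>diff1 h (avg h f) = (1/2) diff1 (2h) f\<close> and \<open>f - avg h f = (1/2) diff1 h f\<close>.\<close>

definition avg :: "real \<Rightarrow> (real \<Rightarrow> complex) \<Rightarrow> real \<Rightarrow> complex" where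
  "avg h f = (\<lambda>x. (1/2) * (f x + f (x + h)))"

lemma avg_periodic_borel [simp]: "f \<in> periodic_borel \<Longrightarrow> avg h f \<in> periodic_borel"
  unfolding avg_def by (intro periodic_borel_scale periodic_borel_add) auto

lemma avg_pow_periodic_borel [simp]: "f \<in> periodic_borel \<Longrightarrow> (avg h ^^ i) f \<in> periodic_borel"
  by (induction i) auto

lemma half_le:
  assumes "f \<in> periodic_borel" shows "\<rho> (\<lambda>x. (1/2) * f x) \<le> \<rho> f"
proof -
  have "\<rho> (\<lambda>x. (1/2) * f x) \<le> ennreal (norm (1/2::complex) powr q) * \<rho> f"
    by (rule scale_le[OF assms])
  also have "norm (1/2::complex) powr q \<le> 1"
    using q_pos by (simp add: powr_le1)
  then have "ennreal (norm (1/2::complex) powr q) * \<rho> f \<le> 1 * \<rho> f"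
    by (intro mult_right_mono) auto
  finally show ?thesis by simp
qed

lemma avg_le:
  assumes "f \<in> periodic_borel" shows "\<rho> (avg h f) \<le> 2 * \<rho> f"
proof -
  have "\<rho> (avg h f) \<le> \<rho> (\<lambda>x. f x + f (x + h))"
    unfolding avg_def using assms by (intro half_le) auto
  also have "\<dots> \<le> \<rho> f + \<rho> (\<lambda>x. f (x + h))"
    using assms by (intro add_le) auto
  also have "\<dots> \<le> \<rho> f + \<rho> f"
    using assms by (intro add_left_mono shift_le)
  finally show ?thesis by (simp add: mult_2)
qed

lemma avg_pow_le:
  assumes "f \<in> periodic_borel" shows "\<rho> ((avg h ^^ i) f) \<le> 2^i * \<rho> f"
proof (induction i)
  case (Suc i)
  have "\<rho> (avg h ((avg h ^^ i) f)) \<le> 2 * \<rho> ((avg h ^^ i) f)"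
    using assms by (intro avg_le) auto
  also have "\<dots> \<le> 2 * (2^i * \<rho> f)"
    using Suc by (intro mult_left_mono) auto
  finally show ?case by (simp add: mult.assoc)
qed simp

lemma avg_pow_diff: "(avg h ^^ i) (\<lambda>x. f x - g x) = (\<lambda>x. (avg h ^^ i) f x - (avg h ^^ i) g x)"
  by (induction i) (auto simp: avg_def field_simps)

lemma avg_pow_close:
  assumes "f \<in> periodic_borel"
  shows "\<rho> (\<lambda>x. f x - (avg h ^^ i) f x) \<le> 2^i * \<rho> (diff1 h f)"
proof (induction i)
  case (Suc i)
  have eq: "(\<lambda>x. f x - (avg h ^^ Suc i) f x)
     = (\<lambda>x. (f x - (avg h ^^ i) f x) + (avg h ^^ i) (\<lambda>x. (1/2) * diff1 h f x) x)"
  proof -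
    have "(\<lambda>x. (1/2) * diff1 h f x) = (\<lambda>x. f x - avg h f x)"
      by (simp add: diff1_def avg_def fun_eq_iff field_simps)
    moreover have "(avg h ^^ Suc i) f = (avg h ^^ i) (avg h f)"
      by (simp add: funpow_swap1)
    ultimately show ?thesis
      by (simp only: avg_pow_diff) (simp add: fun_eq_iff)
  qed
  have "\<rho> (\<lambda>x. f x - (avg h ^^ Suc i) f x)
     \<le> \<rho> (\<lambda>x. f x - (avg h ^^ i) f x) + \<rho> ((avg h ^^ i) (\<lambda>x. (1/2) * diff1 h f x))"
    unfolding eq using assms
    by (intro add_le avg_pow_periodic_borel periodic_borel_scale periodic_borel_diff) auto
  also have "\<dots> \<le> 2^i * \<rho> (diff1 h f) + 2^i * \<rho> (\<lambda>x. (1/2) * diff1 h f x)"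
    using assms Suc by (intro add_mono avg_pow_le periodic_borel_scale) auto
  also have "\<dots> \<le> 2^i * \<rho> (diff1 h f) + 2^i * \<rho> (diff1 h f)"
    using assms by (intro add_left_mono mult_left_mono half_le) auto
  finally show ?case by (simp add: mult_2 distrib_right)
qed simp

lemma diff1_avg: "diff1 h (avg h f) = (\<lambda>x. (1/2) * diff1 (2*h) f x)"
  by (simp add: diff1_def avg_def fun_eq_iff algebra_simps)

lemma diff1_avg_commute: "diff1 u (avg h f) = avg h (diff1 u f)"
  by (simp add: diff1_def avg_def fun_eq_iff algebra_simps)

lemma fdiff_avg_commute: "fdiff R u ((avg h ^^ i) f) = (avg h ^^ i) (fdiff R u f)"
proof (induction i)
  case (Suc i)
  have "fdiff R u (avg h g) = avg h (fdiff R u g)" for g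
    by (induction R) (auto simp: fdiff_Suc diff1_avg_commute)
  then show ?case using Suc by simp
qed simp

lemma avg_scale: "(avg h ^^ i) (\<lambda>x. c * f x) = (\<lambda>x. c * (avg h ^^ i) f x)"
  by (induction i) (auto simp: avg_def algebra_simps)

lemma fdiff_avg: "(avg h ^^ R) (fdiff R h f) = (\<lambda>x. (1/2)^R * fdiff R (2*h) f x)"
proof (induction R)
  case (Suc R)
  have "(avg h ^^ Suc R) (fdiff (Suc R) h f) = avg h ((avg h ^^ R) (diff1 h (fdiff R h f)))"
    by (simp add: fdiff_Suc)
  also have "(avg h ^^ R) (diff1 h (fdiff R h f)) = diff1 h ((avg h ^^ R) (fdiff R h f))"
    using fdiff_avg_commute[where R = 1 and u = h and h = h and i = R and f = "fdiff R h f"] by (simp add: fdiff_Suc)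
  also have "\<dots> = (\<lambda>x. (1/2)^R * diff1 h (fdiff R (2*h) f) x)"
    unfolding Suc by (simp add: diff1_def algebra_simps)
  also have "avg h \<dots> = (\<lambda>x. (1/2)^R * diff1 h (avg h (fdiff R (2*h) f)) x)"
    using avg_scale[where i = 1 and h = h] by (simp add: diff1_avg_commute)
  also have "\<dots> = (\<lambda>x. (1/2)^Suc R * fdiff (Suc R) (2*h) f x)"
    by (simp add: diff1_avg fdiff_Suc)
  finally show ?case .
qed simp

text \<open>The step of the Marchaud ladder. The sharp factor of the first summand matters for the
  limiting exponent \<open>\<alpha> = r\<close>.\<close>

lemma fdiff_halving:
  assumes "f \<in> periodic_borel"
  shows "\<rho> (fdiff R h f) \<le> ennreal (2 powr (- real R * q)) * \<rho> (fdiff R (2*h) f)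
            + 2^R * \<rho> (fdiff (Suc R) h f)"
proof -
  let ?g = "fdiff R h f"
  have "\<rho> ?g = \<rho> (\<lambda>x. (avg h ^^ R) ?g x + (?g x - (avg h ^^ R) ?g x))" by simp
  also have "\<dots> \<le> \<rho> ((avg h ^^ R) ?g) + \<rho> (\<lambda>x. ?g x - (avg h ^^ R) ?g x)"
    using assms by (intro add_le) auto
  also have "\<dots> \<le> ennreal (norm ((1/2)^R :: complex) powr q) * \<rho> (fdiff R (2*h) f) + 2^R * \<rho> (diff1 h ?g)"
    unfolding fdiff_avg using assms avg_pow_close[where f = ?g and i = R and h = h, unfolded fdiff_avg]
    by (intro add_mono scale_le) auto
  also have "norm ((1/2)^R :: complex) powr q = 2 powr (- real R * q)"
    by (simp add: norm_power norm_divide powr_powr powr_minus power_divide powr_divide flip: powr_realpow)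
       (simp add: divide_inverse powr_minus)
  finally show ?thesis by (simp add: fdiff_Suc)
qed

lemma fdiff_double:
  assumes "f \<in> periodic_borel"
  shows "\<rho> (fdiff m (2 * v) f) \<le> 2^m * \<rho> (fdiff m v f)"
  using assms
proof (induction m arbitrary: f)
  case (Suc m)
  have eq: "diff1 (2 * v) (fdiff m v f) = (\<lambda>x. diff1 v (fdiff m v f) x + diff1 v (fdiff m v f) (x + v))"
    by (simp add: diff1_def fun_eq_iff algebra_simps)
  have "\<rho> (fdiff (Suc m) (2 * v) f) \<le> 2^m * \<rho> (fdiff m v (diff1 (2 * v) f))"
    unfolding fdiff_Suc' by (rule Suc.IH) (use Suc.prems in auto)
  also have "fdiff m v (diff1 (2 * v) f) = diff1 (2 * v) (fdiff m v f)"
    by (simp add: diff1_fdiff_commute)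
  also have "\<rho> \<dots> \<le> \<rho> (diff1 v (fdiff m v f)) + \<rho> (\<lambda>x. diff1 v (fdiff m v f) (x + v))"
    unfolding eq using Suc.prems by (intro add_le) auto
  also have "\<dots> \<le> \<rho> (diff1 v (fdiff m v f)) + \<rho> (diff1 v (fdiff m v f))"
    using Suc.prems by (intro add_left_mono shift_le) auto
  finally show ?case
    by (simp add: fdiff_Suc mult_2[symmetric] mult_left_mono mult.assoc power_Suc2 del: power_Suc)
qed simp

lemma osc_double:
  assumes "f \<in> periodic_borel"
  shows "osc m f (2^j * t) \<le> 2^(m*j) * osc m f t"
proof (induction j)
  case (Suc j)
  have "osc m f (2^Suc j * t) \<le> 2^m * osc m f (2^j * t)"
    unfolding osc_def[of m f "2^Suc j * t"]
  proof (rule SUP_least)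
    fix v assume v: "v \<in> {0<..<2^Suc j * t}"
    have "\<rho> (fdiff m v f) \<le> 2^m * \<rho> (fdiff m (v/2) f)"
      using fdiff_double[OF assms, of m "v/2"] by simp
    also have "\<rho> (fdiff m (v/2) f) \<le> osc m f (2^j * t)"
      unfolding osc_def by (rule SUP_upper) (use v in auto)
    finally show "\<rho> (fdiff m v f) \<le> 2^m * osc m f (2^j * t)"
      by (simp add: mult_left_mono)
  qed
  also have "\<dots> \<le> 2^m * (2^(m*j) * osc m f t)"
    using Suc by (intro mult_left_mono) auto
  finally show ?case by (simp add: power_add mult.assoc)
qed simp

text \<open>The steps in \<open>mdiff_eq_sum_fdiff\<close> have size at most \<open>m t < 2\<^sup>m t\<close>; \<open>m\<close> doublings lead back to
  \<open>t\<close>.\<close>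

lemma mdiff_osc:
  assumes f: "f \<in> periodic_borel" and m: "m \<ge> 1" and t: "t > 0"
    and u: "\<And>i. i \<in> {1..m} \<Longrightarrow> \<bar>u i\<bar> \<le> t"
  shows "\<rho> (mdiff m u f) \<le> 2^(m + m*m) * osc m f t"
proof -
  have bound: "\<rho> (\<lambda>x. (-1)^card S * fdiff m (- (\<Sum>j\<in>S. u j / real j)) f (x + (\<Sum>j\<in>S. u j)))
       \<le> osc m f (2^m * t)" if S: "S \<in> Pow {1..m}" for S
  proof -
    have fin: "finite S" using S by (auto intro: finite_subset)
    have "\<bar>\<Sum>j\<in>S. u j / real j\<bar> \<le> (\<Sum>j\<in>S. t)"
    proof (rule order_trans[OF sum_abs sum_mono])
      fix j assume "j \<in> S"
      with S have j: "j \<in> {1..m}" by auto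
      have "\<bar>u j / real j\<bar> \<le> \<bar>u j\<bar>"
        using j mult_right_mono[of 1 "real j" "\<bar>u j\<bar>"] by (simp add: field_simps)
      with u[OF j] show "\<bar>u j / real j\<bar> \<le> t" by linarith
    qed
    also have "\<dots> \<le> real m * t"
      using t S card_mono[of "{1..m}" S] by (auto simp: mult_right_mono)
    also have "\<dots> < 2^m * t"
      using t of_nat_less_two_power[of m] by (intro mult_strict_right_mono) auto
    finally have lt: "\<bar>- (\<Sum>j\<in>S. u j / real j)\<bar> < 2^m * t" by simp
    have "\<rho> (\<lambda>x. (-1)^card S * fdiff m (- (\<Sum>j\<in>S. u j / real j)) f (x + (\<Sum>j\<in>S. u j)))
        \<le> \<rho> (\<lambda>x. fdiff m (- (\<Sum>j\<in>S. u j / real j)) f (x + (\<Sum>j\<in>S. u j)))"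
      using f by (intro sign_le) auto
    also have "\<dots> \<le> \<rho> (fdiff m (- (\<Sum>j\<in>S. u j / real j)) f)"
      using f by (intro shift_le) auto
    also have "\<dots> \<le> osc m f (2^m * t)"
      by (rule fdiff_osc[OF f m lt])
    finally show ?thesis .
  qed
  have "\<rho> (mdiff m u f) \<le> (\<Sum>S\<in>Pow {1..m}. \<rho> (\<lambda>x. (-1)^card S *
            fdiff m (- (\<Sum>j\<in>S. u j / real j)) f (x + (\<Sum>j\<in>S. u j))))"
    unfolding mdiff_eq_sum_fdiff[abs_def] using f by (intro sum_le) auto
  also have "\<dots> \<le> (\<Sum>S\<in>Pow {1..m}. osc m f (2^m * t))"
    by (rule sum_mono[OF bound])
  also have "\<dots> = 2^m * osc m f (2^m * t)"
    by (simp add: card_Pow)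
  also have "\<dots> \<le> 2^m * (2^(m*m) * osc m f t)"
    by (intro mult_left_mono osc_double[OF f]) auto
  finally show ?thesis by (simp add: power_add mult.assoc)
qed

end


section \<open>Mean values over a period\<close>

text \<open>The normalized Lebesgue measure on one period. The period is centred at \<open>0\<close> because the kernels
  below are concentrated there.\<close>

definition circ :: "real measure" where
  "circ = uniform_measure lborel {- pi..<pi}"

lemma sets_circ [measurable_cong]: "sets circ = sets borel"
  by (simp add: circ_def)

lemma space_circ [simp]: "space circ = UNIV"
  by (simp add: circ_def)

lemma borel_measurable_circ [simp]: "borel_measurable circ = borel_measurable borel"
  by (intro measurable_cong_sets) (auto simp: sets_circ)

lemma nn_integral_circ:
  assumes "f \<in> borel_measurable borel"
  shows "(\<integral>\<^sup>+x. f x \<partial>circ) = ennreal (1 / (2 * pi)) * (\<integral>\<^sup>+x\<in>{- pi..<pi}. f x \<partial>lborel)"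
proof -
  have "emeasure lborel {- pi..<pi} = ennreal (2 * pi)" by simp
  moreover have "x / ennreal (2 * pi) = ennreal (1 / (2 * pi)) * x" for x
  proof -
    have "inverse (ennreal (2 * pi)) = ennreal (inverse (2 * pi))"
      by (rule inverse_ennreal) simp
    then show ?thesis
      unfolding divide_ennreal_def by (simp only: divide_inverse mult_1 mult.commute)
  qed
  moreover have "(\<integral>\<^sup>+x. f x \<partial>circ) = (\<integral>\<^sup>+x\<in>{- pi..<pi}. f x \<partial>lborel) / emeasure lborel {- pi..<pi}"
    unfolding circ_def using assms by (intro nn_integral_uniform_measure) auto
  ultimately show ?thesis by simp
qed

lemma emeasure_circ_UNIV [simp]: "emeasure circ UNIV = 1"
proof -
  have "emeasure circ UNIV = (\<integral>\<^sup>+x. 1 \<partial>circ)" by simp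
  also have "\<dots> = 1"
    by (subst nn_integral_circ) (auto simp flip: ennreal_mult)
  finally show ?thesis .
qed

lemma finite_measure_circ: "finite_measure circ"
  by (rule finite_measureI) simp

interpretation circ: finite_measure circ by (rule finite_measure_circ)

lemma nn_integral_circ_const [simp]: "(\<integral>\<^sup>+x. c \<partial>circ) = c"
  by (simp add: nn_integral_const)

lemma AE_circ: "(\<And>x. x \<in> {- pi..<pi} \<Longrightarrow> P x) \<Longrightarrow> AE x in circ. P x"
  unfolding circ_def by (rule AE_uniform_measureI) auto

lemma periodic_int:
  fixes \<phi> :: "real \<Rightarrow> 'a" and j :: int
  assumes per: "\<And>x. \<phi> (x + 2 * pi) = \<phi> x"
  shows "\<phi> (x + 2 * pi * of_int j) = \<phi> x"
proof (induction j arbitrary: x rule: int_induct[of _ 0])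
  case (step1 i)
  have "\<phi> (x + 2 * pi * of_int (i + 1)) = \<phi> ((x + 2 * pi * of_int i) + 2 * pi)"
    by (simp add: algebra_simps)
  then show ?case using step1 by (simp add: per)
next
  case (step2 i)
  have "\<phi> (x + 2 * pi * of_int (i - 1)) = \<phi> ((x + 2 * pi * of_int (i - 1)) + 2 * pi)"
    by (simp add: per)
  also have "(x + 2 * pi * of_int (i - 1)) + 2 * pi = x + 2 * pi * of_int i"
    by (simp add: algebra_simps)
  finally show ?case using step2 by simp
qed simp

lemma nn_integral_periodic_interval:
  fixes \<phi> :: "real \<Rightarrow> ennreal"
  assumes [measurable]: "\<phi> \<in> borel_measurable borel" and per: "\<And>x. \<phi> (x + 2 * pi) = \<phi> x"
  shows "(\<integral>\<^sup>+x\<in>{a..<a + 2 * pi}. \<phi> x \<partial>lborel) = (\<integral>\<^sup>+x\<in>{- pi..<pi}. \<phi> x \<partial>lborel)"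
proof -
  have sh: "(\<integral>\<^sup>+x\<in>{u..<v}. \<phi> x \<partial>lborel)
      = (\<integral>\<^sup>+x\<in>{u + 2 * pi * of_int j..<v + 2 * pi * of_int j}. \<phi> x \<partial>lborel)" for u v and j :: int
    by (subst (2) nn_integral_real_affine[where c = 1 and t = "2 * pi * of_int j"])
       (auto simp: add.commute[of "2 * pi * of_int j"] periodic_int[of \<phi>, OF per] indicator_def
             intro!: nn_integral_cong)
  have split: "(\<integral>\<^sup>+x\<in>{u..<w}. \<phi> x \<partial>lborel)
      = (\<integral>\<^sup>+x\<in>{u..<v}. \<phi> x \<partial>lborel) + (\<integral>\<^sup>+x\<in>{v..<w}. \<phi> x \<partial>lborel)" if "u \<le> v" "v \<le> w" for u v w
    by (subst nn_integral_add[symmetric])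
       (use that in \<open>auto intro!: nn_integral_cong simp: indicator_def\<close>)
  define k :: int where "k = \<lceil>(a + pi) / (2 * pi)\<rceil>"
  define c where "c = - pi + 2 * pi * of_int k"
  have "(a + pi) / (2 * pi) \<le> of_int k" "of_int k < (a + pi) / (2 * pi) + 1"
    unfolding k_def by linarith+
  then have c: "a \<le> c" "c \<le> a + 2 * pi"
    by (simp_all add: c_def field_simps)
  have "(\<integral>\<^sup>+x\<in>{a..<a + 2 * pi}. \<phi> x \<partial>lborel)
     = (\<integral>\<^sup>+x\<in>{a..<c}. \<phi> x \<partial>lborel) + (\<integral>\<^sup>+x\<in>{c..<a + 2 * pi}. \<phi> x \<partial>lborel)"
    by (rule split[OF c])
  also have "(\<integral>\<^sup>+x\<in>{a..<c}. \<phi> x \<partial>lborel) = (\<integral>\<^sup>+x\<in>{a + 2 * pi - 2 * pi * of_int k..<pi}. \<phi> x \<partial>lborel)"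
    by (subst sh[where j = "1 - k"]) (simp add: c_def algebra_simps)
  also have "(\<integral>\<^sup>+x\<in>{c..<a + 2 * pi}. \<phi> x \<partial>lborel)
      = (\<integral>\<^sup>+x\<in>{- pi..<a + 2 * pi - 2 * pi * of_int k}. \<phi> x \<partial>lborel)"
    by (subst sh[where j = "- k"]) (simp add: c_def algebra_simps)
  also have "(\<integral>\<^sup>+x\<in>{a + 2 * pi - 2 * pi * of_int k..<pi}. \<phi> x \<partial>lborel) + \<dots>
      = (\<integral>\<^sup>+x\<in>{- pi..<pi}. \<phi> x \<partial>lborel)"
    using c by (subst add.commute, subst split[symmetric]) (simp_all add: c_def)
  finally show ?thesis .
qed

lemma nn_integral_circ_shift:
  fixes \<phi> :: "real \<Rightarrow> ennreal"
  assumes [measurable]: "\<phi> \<in> borel_measurable borel" and per: "\<And>x. \<phi> (x + 2 * pi) = \<phi> x"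
  shows "(\<integral>\<^sup>+x. \<phi> (x + u) \<partial>circ) = (\<integral>\<^sup>+x. \<phi> x \<partial>circ)"
proof -
  have "(\<integral>\<^sup>+x\<in>{- pi..<pi}. \<phi> (x + u) \<partial>lborel) = (\<integral>\<^sup>+x\<in>{u - pi..<u - pi + 2 * pi}. \<phi> x \<partial>lborel)"
    by (subst (2) nn_integral_real_affine[where c = 1 and t = u])
       (auto simp: add.commute[of u] indicator_def intro!: nn_integral_cong)
  also have "\<dots> = (\<integral>\<^sup>+x\<in>{- pi..<pi}. \<phi> x \<partial>lborel)"
    by (rule nn_integral_periodic_interval) (use per in auto)
  finally show ?thesis by (simp add: nn_integral_circ)
qed

text \<open>The representative of \<open>x\<close> modulo \<open>2\<pi>\<close> in \<open>[-\<pi>,\<pi>)\<close>.\<close>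

definition wrap :: "real \<Rightarrow> real" where
  "wrap x = x - 2 * pi * of_int \<lfloor>(x + pi) / (2 * pi)\<rfloor>"

lemma wrap_measurable [measurable]: "wrap \<in> borel_measurable borel"
  unfolding wrap_def by measurable

lemma wrap_id: "x \<in> {- pi..<pi} \<Longrightarrow> wrap x = x"
proof -
  assume x: "x \<in> {- pi..<pi}"
  then have "\<lfloor>(x + pi) / (2 * pi)\<rfloor> = 0"
    by (intro floor_unique) (auto simp: field_simps)
  then show ?thesis by (simp add: wrap_def)
qed

lemma wrap_periodic: "wrap (x + 2 * pi) = wrap x"
proof -
  have "(x + 2 * pi + pi) / (2 * pi) = (x + pi) / (2 * pi) + of_int 1" by (simp add: field_simps)
  then have "\<lfloor>(x + 2 * pi + pi) / (2 * pi)\<rfloor> = \<lfloor>(x + pi) / (2 * pi)\<rfloor> + 1" by (metis floor_add_int)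
  then show ?thesis by (simp add: wrap_def algebra_simps)
qed

lemma periodic_wrap:
  assumes "\<And>x. \<phi> (x + 2 * pi) = \<phi> x" shows "\<phi> (wrap x) = \<phi> x"
  using periodic_int[of \<phi> x "- \<lfloor>(x + pi) / (2 * pi)\<rfloor>", OF assms] by (simp add: wrap_def)

text \<open>Translation modulo \<open>2\<pi>\<close> preserves \<open>circ\<close>; this yields translation invariance for integrals of
  complex-valued functions.\<close>

lemma distr_circ_wrap: "distr circ borel (\<lambda>x. wrap (x + u)) = circ"
proof (rule measure_eqI)
  fix A assume "A \<in> sets (distr circ borel (\<lambda>x. wrap (x + u)))"
  then have [measurable]: "A \<in> sets borel" by simp
  have "emeasure (distr circ borel (\<lambda>x. wrap (x + u))) A
      = (\<integral>\<^sup>+x. indicator A (wrap (x + u)) \<partial>circ)"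
    by (subst nn_integral_indicator[symmetric], simp) (subst nn_integral_distr, auto)
  also have "\<dots> = (\<integral>\<^sup>+x. indicator A (wrap x) \<partial>circ)"
    by (rule nn_integral_circ_shift) (auto simp: wrap_periodic)
  also have "\<dots> = (\<integral>\<^sup>+x. indicator A x \<partial>circ)"
    by (rule nn_integral_cong_AE, rule AE_circ) (simp add: wrap_id)
  also have "\<dots> = emeasure circ A"
    by (subst nn_integral_indicator) (auto simp: sets_circ)
  finally show "emeasure (distr circ borel (\<lambda>x. wrap (x + u))) A = emeasure circ A" .
qed (simp add: sets_circ)

lemma integral_circ_shift:
  fixes \<phi> :: "real \<Rightarrow> complex"
  assumes [measurable]: "\<phi> \<in> borel_measurable borel" and per: "\<And>x. \<phi> (x + 2 * pi) = \<phi> x"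
  shows "(LINT x|circ. \<phi> (x + u)) = (LINT x|circ. \<phi> x)"
proof -
  have "(LINT x|circ. \<phi> x) = (LINT x|distr circ borel (\<lambda>x. wrap (x + u)). \<phi> x)"
    by (simp add: distr_circ_wrap)
  also have "\<dots> = (LINT x|circ. \<phi> (wrap (x + u)))"
    by (subst integral_distr) auto
  finally show ?thesis by (simp add: periodic_wrap[of \<phi>, OF per])
qed

section \<open>Powers of extended nonnegative reals\<close>

lemma ennpowr_ennreal: "x \<ge> 0 \<Longrightarrow> ennpowr (ennreal x) a = ennreal (x powr a)"
  by (simp add: ennpowr_def)

lemma ennpowr_0 [simp]: "ennpowr 0 a = 0"
  by (simp add: ennpowr_def)

lemma ennpowr_top [simp]: "ennpowr top a = top"
  by (simp add: ennpowr_def)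

lemma ennpowr_1 [simp]: "ennpowr x 1 = x"
  by (cases x) (auto simp: ennpowr_ennreal)

lemma ennpowr_mono: "a > 0 \<Longrightarrow> x \<le> y \<Longrightarrow> ennpowr x a \<le> ennpowr y a"
proof (cases y)
  case (real r)
  assume *: "a > 0" "x \<le> y"
  with real obtain s where "x = ennreal s" "0 \<le> s" "s \<le> r"
    by (cases x) (auto simp: top_unique)
  then show ?thesis using real * by (auto simp: ennpowr_ennreal intro!: ennreal_leI powr_mono2)
qed simp

lemma ennpowr_ennpowr: "ennpowr (ennpowr x a) b = ennpowr x (a * b)"
  by (cases x) (auto simp: ennpowr_ennreal powr_powr)

lemma ennpowr_mult:
  assumes "a > 0" shows "ennpowr (x * y) a = ennpowr x a * ennpowr y a"
proof (cases x; cases y)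
  fix r s assume "0 \<le> r" "0 \<le> s" "x = ennreal r" "y = ennreal s"
  then show ?thesis
    by (simp add: ennpowr_ennreal powr_mult flip: ennreal_mult)
next
  fix r assume "0 \<le> r" "x = ennreal r" "y = top"
  then show ?thesis
    using assms by (cases "r = 0") (auto simp: ennpowr_ennreal ennreal_mult_top)
next
  fix r assume "0 \<le> r" "y = ennreal r" "x = top"
  then show ?thesis
    using assms by (cases "r = 0") (auto simp: ennpowr_ennreal ennreal_top_mult)
qed simp

lemma ennpowr_less_top_iff [simp]: "ennpowr x a < top \<longleftrightarrow> x < top"
  by (cases x) (auto simp: ennpowr_ennreal)

section \<open>Translation invariance and the triangle inequality in \<open>L\<^sub>p\<close>\<close>

text \<open>The \<open>p\<close>-th power of the \<open>L\<^sub>p\<close> norm.\<close>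

definition pmean :: "real \<Rightarrow> (real \<Rightarrow> complex) \<Rightarrow> ennreal" where
  "pmean p f = (\<integral>\<^sup>+x. ennreal (norm (f x) powr p) \<partial>circ)"

lemma Lp_norm_eq_pmean:
  assumes f: "f \<in> periodic_borel" and p: "p \<noteq> \<infinity>"
  shows "Lp_norm p f = ennpowr (pmean (enn2real p) f) (1 / enn2real p)"
proof -
  have [measurable]: "f \<in> borel_measurable borel"
    using f by (rule periodic_borel_measurable)
  have "(\<integral>\<^sup>+x\<in>{0..<2*pi}. ennreal (norm (f x) powr enn2real p) \<partial>lebesgue)
      = (\<integral>\<^sup>+x\<in>{0..<0 + 2*pi}. ennreal (norm (f x) powr enn2real p) \<partial>lborel)"
    by (simp add: nn_integral_completion)
  also have "\<dots> = (\<integral>\<^sup>+x\<in>{-pi..<pi}. ennreal (norm (f x) powr enn2real p) \<partial>lborel)"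
    by (rule nn_integral_periodic_interval) (auto simp: periodic_borel_periodic[OF f])
  finally show ?thesis
    using p by (simp add: Lp_norm_def pmean_def nn_integral_circ)
qed

lemma pmean_shift:
  assumes "f \<in> periodic_borel" shows "pmean p (\<lambda>x. f (x + u)) = pmean p f"
proof -
  have [measurable]: "f \<in> borel_measurable borel"
    using assms by (rule periodic_borel_measurable)
  show ?thesis unfolding pmean_def
    by (rule nn_integral_circ_shift[where \<phi> = "\<lambda>x. ennreal (norm (f x) powr p)"])
       (auto simp: periodic_borel_periodic[OF assms])
qed

lemma pmean_scale:
  assumes "f \<in> periodic_borel"
  shows "pmean p (\<lambda>x. c * f x) = ennreal (norm c powr p) * pmean p f"
proof -
  have [measurable]: "f \<in> borel_measurable borel"
    using assms by (rule periodic_borel_measurable)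
  show ?thesis unfolding pmean_def
    by (simp add: norm_mult powr_mult ennreal_mult nn_integral_cmult)
qed

lemma powr_add_le:
  fixes x y p :: real
  assumes "x \<ge> 0" "y \<ge> 0" "0 < p" "p \<le> 1"
  shows "(x + y) powr p \<le> x powr p + y powr p"
proof (cases "x + y = 0")
  case False
  with assms have s: "x + y > 0" by auto
  have *: "z / (x + y) \<le> (z / (x + y)) powr p" if "0 \<le> z" "z \<le> x + y" for z
    using powr_mono'[of p 1 "z / (x + y)"] that assms s by simp
  have "1 = x / (x + y) + y / (x + y)" using s by (simp add: add_divide_distrib[symmetric])
  also have "\<dots> \<le> (x / (x + y)) powr p + (y / (x + y)) powr p"
    using assms by (intro add_mono *) auto
  also have "\<dots> = (x powr p + y powr p) / (x + y) powr p"
    using assms s by (simp add: powr_divide add_divide_distrib)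
  finally show ?thesis using s by (simp add: field_simps)
qed (use assms in auto)

lemma norm_sum_powr_le:
  fixes f :: "'b \<Rightarrow> 'a::real_normed_vector" and p :: real
  assumes "finite I" "0 < p" "p \<le> 1"
  shows "norm (\<Sum>i\<in>I. f i) powr p \<le> (\<Sum>i\<in>I. norm (f i) powr p)"
  using assms(1)
proof (induction I)
  case (insert a I)
  have "norm (f a + (\<Sum>i\<in>I. f i)) powr p \<le> (norm (f a) + norm (\<Sum>i\<in>I. f i)) powr p"
    using assms by (intro powr_mono2 norm_triangle_ineq) auto
  also have "\<dots> \<le> norm (f a) powr p + norm (\<Sum>i\<in>I. f i) powr p"
    using assms by (intro powr_add_le) auto
  finally show ?case using insert by simp
qed simp

lemma shift_quasinorm_pmean:
  assumes "0 < p" "p < 1"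
  shows "shift_quasinorm (pmean p) p"
proof
  fix f g assume f: "f \<in> periodic_borel" and g: "g \<in> periodic_borel"
  have [measurable]: "f \<in> borel_measurable borel" "g \<in> borel_measurable borel"
    using f g by auto
  have "pmean p (\<lambda>x. f x + g x) \<le> (\<integral>\<^sup>+x. ennreal (norm (f x) powr p) + ennreal (norm (g x) powr p) \<partial>circ)"
    unfolding pmean_def
  proof (intro nn_integral_mono)
    fix x
    have "norm (f x + g x) powr p \<le> (norm (f x) + norm (g x)) powr p"
      using assms by (intro powr_mono2 norm_triangle_ineq) auto
    also have "\<dots> \<le> norm (f x) powr p + norm (g x) powr p"
      using assms by (intro powr_add_le) auto
    finally show "ennreal (norm (f x + g x) powr p) \<le> ennreal (norm (f x) powr p) + ennreal (norm (g x) powr p)"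
      by (simp flip: ennreal_plus)
  qed
  also have "\<dots> = pmean p f + pmean p g"
    unfolding pmean_def by (intro nn_integral_add) auto
  finally show "pmean p (\<lambda>x. f x + g x) \<le> pmean p f + pmean p g" .
qed (use assms in \<open>auto simp: pmean_scale pmean_shift\<close>)

text \<open>The function \<open>z \<mapsto> z\<^sup>p\<close> lies above its tangent at \<open>t\<close>.\<close>

lemma powr_tangent:
  fixes z t p :: real
  assumes "z \<ge> 0" "t \<ge> 0" "p \<ge> 1"
  shows "p * t powr (p - 1) * z \<le> z powr p + (p - 1) * t powr p"
proof (cases "p = 1")
  case False
  with assms have p: "p > 1" by simp
  define q where "q = p / (p - 1)"
  have q: "1/p + 1/q = 1" "q > 1" "(p - 1) * q = p"
    using p by (auto simp: q_def field_simps)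
  have "z * t powr (p - 1) \<le> z powr p / p + (t powr (p - 1)) powr q / q"
    using assms p q by (intro Youngs_inequality) auto
  also have "(t powr (p - 1)) powr q = t powr p"
    by (simp add: powr_powr q)
  finally have "p * (z * t powr (p - 1)) \<le> p * (z powr p / p + t powr p / q)"
    using p by (intro mult_left_mono) auto
  also have "\<dots> = z powr p + (p - 1) * t powr p"
    using p by (simp add: q_def field_simps)
  finally show ?thesis by (simp add: algebra_simps)
qed (use assms in \<open>auto split: if_splits\<close>)

text \<open>Jensen's inequality for the weight \<open>w\<close> of total mass at most \<open>c\<close>, in the form that bounds a
  finite number \<open>y\<close>. Integrate the tangent inequality at \<open>s = y/c\<close>.\<close>

lemma powr_nn_integral_le:
  fixes w \<phi> :: "'a \<Rightarrow> real"
  assumes [measurable]: "w \<in> borel_measurable M" "\<phi> \<in> borel_measurable M"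
    and nonneg: "\<And>x. w x \<ge> 0" "\<And>x. \<phi> x \<ge> 0"
    and w: "(\<integral>\<^sup>+x. ennreal (w x) \<partial>M) \<le> ennreal c" and c: "c > 0" and p: "p \<ge> 1" and y: "y \<ge> 0"
    and le: "ennreal y \<le> (\<integral>\<^sup>+x. ennreal (w x * \<phi> x) \<partial>M)"
  shows "ennreal (y powr p) \<le> ennreal (c powr (p - 1)) * (\<integral>\<^sup>+x. ennreal (w x * \<phi> x powr p) \<partial>M)"
proof (cases "y = 0")
  case False
  with y have y0: "y > 0" by simp
  define s where "s = y / c"
  have s: "s > 0" using y0 c by (simp add: s_def)
  have "ennreal (p * s powr (p - 1) * y) \<le> ennreal (p * s powr (p - 1)) * (\<integral>\<^sup>+x. ennreal (w x * \<phi> x) \<partial>M)"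
    using p y le by (simp add: ennreal_mult mult_left_mono)
  also have "\<dots> = (\<integral>\<^sup>+x. ennreal (p * s powr (p - 1) * (w x * \<phi> x)) \<partial>M)"
    using p nonneg by (subst nn_integral_cmult[symmetric]) (auto simp: ennreal_mult)
  also have "\<dots> \<le> (\<integral>\<^sup>+x. ennreal (w x * \<phi> x powr p) + ennreal ((p - 1) * s powr p) * ennreal (w x) \<partial>M)"
  proof (rule nn_integral_mono)
    fix x
    have "w x * (p * s powr (p - 1) * \<phi> x) \<le> w x * (\<phi> x powr p + (p - 1) * s powr p)"
      using nonneg p s by (intro mult_left_mono powr_tangent) auto
    then have "p * s powr (p - 1) * (w x * \<phi> x) \<le> w x * \<phi> x powr p + (p - 1) * s powr p * w x"
      by (simp add: algebra_simps)
    then show "ennreal (p * s powr (p - 1) * (w x * \<phi> x))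
        \<le> ennreal (w x * \<phi> x powr p) + ennreal ((p - 1) * s powr p) * ennreal (w x)"
      using nonneg p by (simp flip: ennreal_plus ennreal_mult)
  qed
  also have "\<dots> = (\<integral>\<^sup>+x. ennreal (w x * \<phi> x powr p) \<partial>M) + ennreal ((p - 1) * s powr p) * (\<integral>\<^sup>+x. ennreal (w x) \<partial>M)"
    by (subst nn_integral_add) (auto simp: nn_integral_cmult)
  also have "\<dots> \<le> (\<integral>\<^sup>+x. ennreal (w x * \<phi> x powr p) \<partial>M) + ennreal ((p - 1) * s powr p) * ennreal c"
    by (intro add_left_mono mult_left_mono w) auto
  finally have "ennreal (p * s powr (p - 1) * y)
      \<le> (\<integral>\<^sup>+x. ennreal (w x * \<phi> x powr p) \<partial>M) + ennreal ((p - 1) * s powr p * c)"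
    using p c by (simp add: ennreal_mult)
  moreover have "(p - 1) * s powr p * c = (p - 1) * (s powr (p - 1) * y)"
    using s c y0 by (simp add: s_def powr_diff)
  moreover have "ennreal (p * s powr (p - 1) * y)
      = ennreal (s powr (p - 1) * y) + ennreal ((p - 1) * (s powr (p - 1) * y))"
  proof -
    have "p * s powr (p - 1) * y = s powr (p - 1) * y + (p - 1) * (s powr (p - 1) * y)"
      by (simp add: algebra_simps)
    then show ?thesis using p y0 by (simp only:) (intro ennreal_plus mult_nonneg_nonneg; simp)
  qed
  ultimately have "ennreal (s powr (p - 1) * y) + ennreal ((p - 1) * (s powr (p - 1) * y))
      \<le> (\<integral>\<^sup>+x. ennreal (w x * \<phi> x powr p) \<partial>M) + ennreal ((p - 1) * (s powr (p - 1) * y))"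
    by simp
  then have "ennreal (s powr (p - 1) * y) \<le> (\<integral>\<^sup>+x. ennreal (w x * \<phi> x powr p) \<partial>M)"
    using ennreal_add_left_cancel_le by (simp add: add.commute)
  then have "ennreal (c powr (p - 1)) * ennreal (s powr (p - 1) * y)
      \<le> ennreal (c powr (p - 1)) * (\<integral>\<^sup>+x. ennreal (w x * \<phi> x powr p) \<partial>M)"
    by (intro mult_left_mono) auto
  moreover have "c powr (p - 1) * (s powr (p - 1) * y) = y powr p"
    using c y0 by (simp add: s_def powr_divide powr_diff)
  ultimately show ?thesis using y0 by (simp flip: ennreal_mult)
qed (use p in auto)

text \<open>Minkowski's inequality. With \<open>a'\<close> and \<open>b'\<close> slightly larger than the norms of \<open>f\<close> and \<open>g\<close>,
  convexity bounds \<open>\<bar>f + g\<bar>\<^sup>P\<close> pointwise by a combination of \<open>\<bar>f\<bar>\<^sup>P\<close> and \<open>\<bar>g\<bar>\<^sup>P\<close>.\<close>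

lemma Lp_norm_add_le:
  assumes f: "f \<in> periodic_borel" and g: "g \<in> periodic_borel" and p: "1 \<le> p"
  shows "Lp_norm p (\<lambda>x. f x + g x) \<le> Lp_norm p f + Lp_norm p g"
proof (cases "p = \<infinity>")
  case True
  have "ennreal (norm (f x + g x)) \<le> (SUP x. ennreal (norm (f x))) + (SUP x. ennreal (norm (g x)))" for x
  proof -
    have "ennreal (norm (f x + g x)) \<le> ennreal (norm (f x)) + ennreal (norm (g x))"
      by (simp add: norm_triangle_ineq flip: ennreal_plus)
    also have "\<dots> \<le> (SUP x. ennreal (norm (f x))) + (SUP x. ennreal (norm (g x)))"
      by (intro add_mono SUP_upper) auto
    finally show ?thesis .
  qed
  then show ?thesis using True by (auto simp: Lp_norm_def intro!: SUP_least)
next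
  case False
  define P where "P = enn2real p"
  have P: "P \<ge> 1"
    using p False unfolding P_def by (cases p) (auto simp: ennreal_le_iff2 simp flip: ennreal_1)
  have fg: "(\<lambda>x. f x + g x) \<in> periodic_borel" using f g by simp
  have [measurable]: "f \<in> borel_measurable borel" "g \<in> borel_measurable borel"
    using f g by auto
  note eqs = Lp_norm_eq_pmean[OF f False, folded P_def] Lp_norm_eq_pmean[OF g False, folded P_def]
    Lp_norm_eq_pmean[OF fg False, folded P_def]
  show ?thesis
  proof (cases "pmean P f = top \<or> pmean P g = top")
    case True
    then show ?thesis by (auto simp: eqs)
  next
    case fin: False
    then obtain A B where A: "A \<ge> 0" "pmean P f = ennreal A" and B: "B \<ge> 0" "pmean P g = ennreal B"
      by (cases "pmean P f"; cases "pmean P g") auto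
    define a b where "a = A powr (1/P)" and "b = B powr (1/P)"
    have ab: "a \<ge> 0" "b \<ge> 0" "A = a powr P" "B = b powr P"
      using A B P by (auto simp: a_def b_def powr_powr)
    have "Lp_norm p (\<lambda>x. f x + g x) \<le> ennreal (a + b) + ennreal e" if e: "e > 0" for e
    proof -
      define a' b' where "a' = a + e/2" and "b' = b + e/2"
      have ab': "a' > 0" "b' > 0" "a \<le> a'" "b \<le> b'" using ab e by (auto simp: a'_def b'_def)
      define t where "t = (a' + b') powr (P - 1)"
      have pw: "norm (f x + g x) powr P
          \<le> t * (a' powr (1 - P)) * norm (f x) powr P + t * (b' powr (1 - P)) * norm (g x) powr P" for x
      proof -
        define u where "u = norm (f x)" define v where "v = norm (g x)"
        have uv: "u \<ge> 0" "v \<ge> 0" by (auto simp: u_def v_def)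
        define s where "s = (u + v) / (a' + b')"
        have s: "s \<ge> 0" using uv ab' by (auto simp: s_def)
        have 1: "a' * (P * s powr (P - 1) * (u / a')) \<le> a' * ((u / a') powr P + (P - 1) * s powr P)"
          using uv ab' s P by (intro mult_left_mono powr_tangent) auto
        have 2: "b' * (P * s powr (P - 1) * (v / b')) \<le> b' * ((v / b') powr P + (P - 1) * s powr P)"
          using uv ab' s P by (intro mult_left_mono powr_tangent) auto
        have "P * (s powr (P - 1) * (u + v)) \<le> a' * (u / a') powr P + b' * (v / b') powr P
            + (P - 1) * (s powr P * (a' + b'))"
          using add_mono[OF 1 2] ab' by (simp add: algebra_simps)
        moreover have "s powr (P - 1) * (u + v) = s powr P * (a' + b')"
        proof (cases "s = 0")
          case False
          with s have "s powr P = s powr (P - 1) * s" by (simp add: powr_diff)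
          then show ?thesis using ab' by (simp add: s_def)
        qed (use P in simp)
        ultimately have "P * (s powr P * (a' + b')) \<le> a' * (u / a') powr P + b' * (v / b') powr P
            + (P - 1) * (s powr P * (a' + b'))" by simp
        then have main: "s powr P * (a' + b') \<le> a' * (u / a') powr P + b' * (v / b') powr P"
          unfolding left_diff_distrib by linarith
        have "(u + v) powr P = t * (s powr P * (a' + b'))"
          using ab' uv by (simp add: s_def t_def powr_divide powr_diff)
        also have "\<dots> \<le> t * (a' * (u / a') powr P + b' * (v / b') powr P)"
          using main by (intro mult_left_mono) (auto simp: t_def)
        also have "\<dots> = t * (a' powr (1 - P)) * u powr P + t * (b' powr (1 - P)) * v powr P"
          using ab' uv by (simp add: powr_divide powr_diff field_simps)
        finally have "(u + v) powr P \<le> \<dots>" .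
        moreover have "norm (f x + g x) powr P \<le> (u + v) powr P"
          using P by (intro powr_mono2) (auto simp: u_def v_def norm_triangle_ineq)
        ultimately show ?thesis unfolding u_def v_def by linarith
      qed
      have "pmean P (\<lambda>x. f x + g x) \<le> (\<integral>\<^sup>+x. ennreal (t * a' powr (1 - P)) * ennreal (norm (f x) powr P)
          + ennreal (t * b' powr (1 - P)) * ennreal (norm (g x) powr P) \<partial>circ)"
        unfolding pmean_def using pw
        by (intro nn_integral_mono) (simp add: t_def flip: ennreal_plus ennreal_mult)
      also have "\<dots> = ennreal (t * a' powr (1 - P)) * pmean P f + ennreal (t * b' powr (1 - P)) * pmean P g"
        unfolding pmean_def by (subst nn_integral_add) (auto simp: nn_integral_cmult)
      also have "\<dots> = ennreal (t * (a' powr (1 - P) * a powr P + b' powr (1 - P) * b powr P))"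
        using A B ab by (simp add: t_def algebra_simps flip: ennreal_plus ennreal_mult)
      also have "\<dots> \<le> ennreal (t * (a' powr (1 - P) * a' powr P + b' powr (1 - P) * b' powr P))"
        using P ab ab' by (intro ennreal_leI mult_left_mono add_mono powr_mono2) (auto simp: t_def)
      also have "t * (a' powr (1 - P) * a' powr P + b' powr (1 - P) * b' powr P) = (a' + b') powr P"
        using ab' by (simp add: t_def powr_diff flip: powr_add)
      finally have "Lp_norm p (\<lambda>x. f x + g x) \<le> ennpowr (ennreal ((a' + b') powr P)) (1/P)"
        unfolding eqs using P by (intro ennpowr_mono) auto
      also have "\<dots> = ennreal (a' + b')"
        using ab' P by (simp add: ennpowr_ennreal powr_powr)
      also have "\<dots> = ennreal (a + b) + ennreal e"
        using ab e by (simp add: a'_def b'_def flip: ennreal_plus)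
      finally show ?thesis .
    qed
    then have "Lp_norm p (\<lambda>x. f x + g x) \<le> ennreal (a + b)"
      by (rule ennreal_le_epsilon)
    also have "\<dots> = Lp_norm p f + Lp_norm p g"
      using A B by (simp add: eqs a_def b_def ennpowr_ennreal)
    finally show ?thesis .
  qed
qed

lemma shift_quasinorm_Lp_norm:
  assumes p: "1 \<le> p"
  shows "shift_quasinorm (Lp_norm p) 1"
proof
  fix f :: "real \<Rightarrow> complex" and c assume f: "f \<in> periodic_borel"
  show "Lp_norm p (\<lambda>x. c * f x) \<le> ennreal (norm c powr 1) * Lp_norm p f"
  proof (cases "p = \<infinity>")
    case True
    then show ?thesis
      by (auto simp: Lp_norm_def norm_mult ennreal_mult intro!: SUP_least mult_left_mono SUP_upper)
  next
    case False
    have P: "enn2real p > 0"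
      using p False by (cases p) (auto simp: ennreal_le_iff2 simp flip: ennreal_1)
    have cf: "(\<lambda>x. c * f x) \<in> periodic_borel" using f by simp
    show ?thesis
      using P by (simp add: Lp_norm_eq_pmean[OF f False] Lp_norm_eq_pmean[OF cf False]
          pmean_scale[OF f] ennpowr_mult ennpowr_ennreal powr_powr)
  qed
next
  fix f :: "real \<Rightarrow> complex" and u assume f: "f \<in> periodic_borel"
  show "Lp_norm p (\<lambda>x. f (x + u)) \<le> Lp_norm p f"
  proof (cases "p = \<infinity>")
    case True
    then show ?thesis by (auto simp: Lp_norm_def intro!: SUP_least SUP_upper)
  next
    case False
    have fu: "(\<lambda>x. f (x + u)) \<in> periodic_borel" using f by simp
    show ?thesis
      by (simp add: Lp_norm_eq_pmean[OF f False] Lp_norm_eq_pmean[OF fu False] pmean_shift[OF f])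
  qed
qed (use p in \<open>auto intro: Lp_norm_add_le\<close>)


section \<open>Trigonometric polynomials and localized kernels\<close>

text \<open>The exponential of frequency \<open>\<nu>\<close>.\<close>

definition trig :: "int \<Rightarrow> real \<Rightarrow> complex" where
  "trig \<nu> x = exp (\<i> * of_int \<nu> * of_real x)"

lemma trig_eq_exp: "trig \<nu> x = exp (\<i> * of_real (of_int \<nu> * x))"
  by (simp add: trig_def mult.assoc)

lemma norm_trig [simp]: "norm (trig \<nu> x) = 1"
  unfolding trig_eq_exp by (rule norm_exp_i_times)

lemma trig_0 [simp]: "trig 0 x = 1"
  by (simp add: trig_def)

lemma trig_arg_0 [simp]: "trig \<nu> 0 = 1"
  by (simp add: trig_def)

lemma trig_add_freq: "trig (\<mu> + \<nu>) x = trig \<mu> x * trig \<nu> x"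
  by (simp add: trig_def algebra_simps flip: exp_add)

lemma trig_add: "trig \<nu> (x + y) = trig \<nu> x * trig \<nu> y"
  by (simp add: trig_def algebra_simps flip: exp_add)

lemma trig_uminus: "trig \<nu> (- x) = trig (- \<nu>) x"
  by (simp add: trig_def)

lemma trig_periodic: "trig \<nu> (x + 2 * pi) = trig \<nu> x"
proof -
  have "trig \<nu> (2 * pi) = 1"
    using exp_integer_2pi[of "of_int \<nu>"] by (simp add: trig_def mult_ac)
  then show ?thesis by (simp add: trig_add)
qed

lemma trig_diff_le: "norm (trig \<nu> (x + d) - trig \<nu> x) \<le> \<bar>of_int \<nu>\<bar> * \<bar>d\<bar>"
proof -
  have "trig \<nu> (x + d) - trig \<nu> x = trig \<nu> x * (trig \<nu> d - 1)"
    by (simp add: trig_add algebra_simps)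
  then have "norm (trig \<nu> (x + d) - trig \<nu> x) = norm (trig \<nu> d - 1)"
    by (simp add: norm_mult)
  also have "\<dots> = 2 * \<bar>sin (of_int \<nu> * d / 2)\<bar>"
    unfolding trig_eq_exp by (rule dist_exp_i_1)
  also have "\<dots> \<le> 2 * \<bar>of_int \<nu> * d / 2\<bar>"
    by (intro mult_left_mono abs_sin_x_le_abs_x) auto
  finally show ?thesis by (simp add: abs_mult)
qed

lemma trig_measurable [measurable]: "trig \<nu> \<in> borel_measurable borel"
  unfolding trig_def by measurable

subsection \<open>Closure properties\<close>

lemma trig_polysE:
  assumes "T \<in> trig_polys n"
  obtains c where "T = (\<lambda>x. \<Sum>\<nu>\<in>{- int n..int n}. c \<nu> * trig \<nu> x)"
  using assms unfolding trig_polys_def trig_def by blast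

lemma trig_polysI: "(\<lambda>x. \<Sum>\<nu>\<in>{- int n..int n}. c \<nu> * trig \<nu> x) \<in> trig_polys n"
  unfolding trig_polys_def trig_def by blast

lemma trig_polys_add:
  assumes "S \<in> trig_polys n" "T \<in> trig_polys n"
  shows "(\<lambda>x. S x + T x) \<in> trig_polys n"
proof -
  obtain c d where "S = (\<lambda>x. \<Sum>\<nu>\<in>{- int n..int n}. c \<nu> * trig \<nu> x)"
      "T = (\<lambda>x. \<Sum>\<nu>\<in>{- int n..int n}. d \<nu> * trig \<nu> x)"
    using assms by (metis trig_polysE)
  then have "(\<lambda>x. S x + T x) = (\<lambda>x. \<Sum>\<nu>\<in>{- int n..int n}. (c \<nu> + d \<nu>) * trig \<nu> x)"
    by (simp add: sum.distrib algebra_simps)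
  then show ?thesis using trig_polysI by simp
qed

lemma trig_polys_scale:
  assumes "T \<in> trig_polys n" shows "(\<lambda>x. a * T x) \<in> trig_polys n"
proof -
  obtain c where "T = (\<lambda>x. \<Sum>\<nu>\<in>{- int n..int n}. c \<nu> * trig \<nu> x)"
    using assms by (metis trig_polysE)
  then have "(\<lambda>x. a * T x) = (\<lambda>x. \<Sum>\<nu>\<in>{- int n..int n}. (a * c \<nu>) * trig \<nu> x)"
    by (simp add: sum_distrib_left algebra_simps)
  then show ?thesis using trig_polysI by simp
qed

lemma trig_polys_zero: "(\<lambda>x. 0) \<in> trig_polys n"
  using trig_polysI[where c = "\<lambda>_. 0" and n = n] by simp

lemma trig_polys_diff:
  assumes "S \<in> trig_polys n" "T \<in> trig_polys n"
  shows "(\<lambda>x. S x - T x) \<in> trig_polys n"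
  using trig_polys_add[OF assms(1) trig_polys_scale[OF assms(2), of "-1"]] by simp

lemma trig_polys_sum:
  assumes "\<And>i. i \<in> I \<Longrightarrow> T i \<in> trig_polys n"
  shows "(\<lambda>x. \<Sum>i\<in>I. T i x) \<in> trig_polys n"
  using assms by (induction I rule: infinite_finite_induct) (auto intro: trig_polys_zero trig_polys_add)

lemma trig_in_trig_polys:
  assumes "\<bar>\<nu>\<bar> \<le> int n" shows "trig \<nu> \<in> trig_polys n"
proof -
  have "(\<Sum>\<mu>\<in>{- int n..int n}. (if \<mu> = \<nu> then 1 else 0) * trig \<mu> x) = trig \<nu> x" for x
  proof -
    have "\<nu> \<in> {- int n..int n}" using assms by auto
    then show ?thesis by (simp add: if_distrib[of "\<lambda>c. c * _"] sum.delta cong: if_cong)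
  qed
  then have "trig \<nu> = (\<lambda>x. \<Sum>\<mu>\<in>{- int n..int n}. (if \<mu> = \<nu> then 1 else 0) * trig \<mu> x)"
    by (simp add: fun_eq_iff)
  then show ?thesis using trig_polysI by metis
qed

lemma trig_polys_const: "(\<lambda>x. c) \<in> trig_polys n"
  using trig_polys_scale[OF trig_in_trig_polys[of 0 n], of c] by simp

lemma trig_polys_mono:
  assumes "T \<in> trig_polys m" "m \<le> n" shows "T \<in> trig_polys n"
proof -
  obtain c where T: "T = (\<lambda>x. \<Sum>\<nu>\<in>{- int m..int m}. c \<nu> * trig \<nu> x)"
    using assms by (metis trig_polysE)
  show ?thesis unfolding T
    by (intro trig_polys_sum trig_polys_scale trig_in_trig_polys) (use assms in auto)
qed

lemma trig_polys_mult:
  assumes "S \<in> trig_polys m" "T \<in> trig_polys n"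
  shows "(\<lambda>x. S x * T x) \<in> trig_polys (m + n)"
proof -
  obtain c d where ST: "S = (\<lambda>x. \<Sum>\<nu>\<in>{- int m..int m}. c \<nu> * trig \<nu> x)"
      "T = (\<lambda>x. \<Sum>\<nu>\<in>{- int n..int n}. d \<nu> * trig \<nu> x)"
    using assms by (metis trig_polysE)
  have "(\<lambda>x. S x * T x) = (\<lambda>x. \<Sum>\<mu>\<in>{- int m..int m}. \<Sum>\<nu>\<in>{- int n..int n}. (c \<mu> * d \<nu>) * trig (\<mu> + \<nu>) x)"
    unfolding ST by (simp add: sum_product trig_add_freq algebra_simps)
  also have "\<dots> \<in> trig_polys (m + n)"
    by (intro trig_polys_sum trig_polys_scale trig_in_trig_polys) auto
  finally show ?thesis .
qed

lemma trig_polys_power: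
  assumes "T \<in> trig_polys n" shows "(\<lambda>x. T x ^ k) \<in> trig_polys (k * n)"
proof (induction k)
  case (Suc k)
  then show ?case using trig_polys_mult[OF assms Suc] by simp
qed (auto intro: trig_polys_const)

lemma trig_polys_shift:
  assumes "T \<in> trig_polys n" shows "(\<lambda>x. T (x + u)) \<in> trig_polys n"
proof -
  obtain c where T: "T = (\<lambda>x. \<Sum>\<nu>\<in>{- int n..int n}. c \<nu> * trig \<nu> x)"
    using assms by (metis trig_polysE)
  have "(\<lambda>x. T (x + u)) = (\<lambda>x. \<Sum>\<nu>\<in>{- int n..int n}. (c \<nu> * trig \<nu> u) * trig \<nu> x)"
    unfolding T by (simp add: trig_add algebra_simps)
  then show ?thesis using trig_polysI by simp
qed

lemma trig_polys_reflect:
  assumes "T \<in> trig_polys n" shows "(\<lambda>y. T (x - y)) \<in> trig_polys n"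
proof -
  obtain c where T: "T = (\<lambda>x. \<Sum>\<nu>\<in>{- int n..int n}. c \<nu> * trig \<nu> x)"
    using assms by (metis trig_polysE)
  have eq: "(\<lambda>y. T (x - y)) = (\<lambda>y. \<Sum>\<nu>\<in>{- int n..int n}. (c \<nu> * trig \<nu> x) * trig (- \<nu>) y)"
    unfolding T using trig_add[of _ x "- y" for y] by (simp add: trig_uminus algebra_simps)
  show ?thesis unfolding eq
    by (intro trig_polys_sum trig_polys_scale trig_in_trig_polys) auto
qed

lemma trig_polys_diff1:
  assumes "T \<in> trig_polys n" shows "diff1 u T \<in> trig_polys n"
  unfolding diff1_def by (intro trig_polys_diff trig_polys_shift assms)

lemma trig_polys_periodic_borel: 
  assumes "T \<in> trig_polys n" shows "T \<in> periodic_borel"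
proof -
  obtain c where T: "T = (\<lambda>x. \<Sum>\<nu>\<in>{- int n..int n}. c \<nu> * trig \<nu> x)"
    using assms by (metis trig_polysE)
  show ?thesis unfolding T
    by (intro periodic_borel_sum periodic_borel_scale periodic_borelI) (auto simp: trig_periodic)
qed

subsection \<open>Dirichlet kernels\<close>

definition dirichlet :: "nat \<Rightarrow> real \<Rightarrow> complex" where
  "dirichlet A x = (\<Sum>\<nu>\<in>{- int A..int A}. trig \<nu> x)"

lemma dirichlet_in_trig_polys: "dirichlet A \<in> trig_polys A"
  using trig_polysI[where c = "\<lambda>_. 1" and n = A] by (simp add: dirichlet_def[abs_def])

lemma norm_dirichlet_le: "norm (dirichlet A x) \<le> real (2 * A + 1)"
proof -
  have "norm (dirichlet A x) \<le> (\<Sum>\<nu>\<in>{- int A..int A}. 1)"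
    unfolding dirichlet_def by (rule order_trans[OF norm_sum]) simp
  then show ?thesis by simp
qed

lemma dirichlet_0: "dirichlet A 0 = of_nat (2 * A + 1)"
proof -
  have "dirichlet A 0 = of_nat (card {- int A..int A})" by (simp add: dirichlet_def)
  also have "card {- int A..int A} = 2 * A + 1" by simp
  finally show ?thesis .
qed

lemma dirichlet_diff_le: "norm (dirichlet A (x + d) - dirichlet A x) \<le> real (2 * A + 1) * (real A * \<bar>d\<bar>)"
proof -
  have "norm (dirichlet A (x + d) - dirichlet A x) \<le> (\<Sum>\<nu>\<in>{- int A..int A}. real A * \<bar>d\<bar>)"
    unfolding dirichlet_def sum_subtractf[symmetric]
  proof (rule order_trans[OF norm_sum sum_mono])
    fix \<nu> assume "\<nu> \<in> {- int A..int A}"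
    then have "\<bar>of_int \<nu>\<bar> \<le> real A" by auto
    then have "\<bar>of_int \<nu>\<bar> * \<bar>d\<bar> \<le> real A * \<bar>d\<bar>" by (intro mult_right_mono) auto
    with trig_diff_le[of \<nu> x d] show "norm (trig \<nu> (x + d) - trig \<nu> x) \<le> real A * \<bar>d\<bar>" by linarith
  qed
  then show ?thesis by (simp add: algebra_simps)
qed

lemma abs_sin_half_ge:
  assumes "\<bar>x\<bar> \<le> pi" shows "\<bar>x\<bar> / 4 \<le> \<bar>sin (x / 2)\<bar>"
proof -
  have *: "x / 4 \<le> sin (x / 2)" if "0 \<le> x" "x \<le> pi" for x :: real
  proof -
    have "x / 4 * cos (pi / 4) \<le> sin (x / 4)"
    proof (cases "x = 0")
      case False
      with that have "0 < x / 4" by simp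
      then obtain z where z: "0 < z" "z < x / 4" "sin (x / 4) - sin 0 = (x / 4 - 0) * cos z"
        using MVT2[of 0 "x / 4" sin cos] by (auto intro: DERIV_sin)
      have "cos (pi / 4) \<le> cos z"
        using z that by (intro cos_monotone_0_pi_le) auto
      with z that show ?thesis by (auto intro: mult_left_mono)
    qed simp
    moreover have "cos (pi / 4) \<le> cos (x / 4)"
      using that by (intro cos_monotone_0_pi_le) auto
    moreover have "sqrt 2 / 2 > (0::real)" by simp
    ultimately have "(x / 4 * cos (pi / 4)) * cos (pi / 4) \<le> sin (x / 4) * cos (x / 4)"
      using that by (intro mult_mono) (auto simp: cos_45 intro!: sin_ge_zero)
    moreover have "cos (pi / 4) * cos (pi / 4) = (1/2 :: real)" by (simp add: cos_45)
    ultimately have "x / 8 \<le> sin (x / 4) * cos (x / 4)" by (simp add: mult.assoc)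
    then show ?thesis using sin_double[of "x / 4"] by simp
  qed
  show ?thesis
  proof (cases "x \<ge> 0")
    case True
    then show ?thesis using *[of x] assms by simp
  next
    case False
    then show ?thesis using *[of "- x"] assms by simp
  qed
qed

lemma dirichlet_decay:
  assumes "\<bar>x\<bar> \<le> pi" shows "norm (dirichlet A x) * \<bar>x\<bar> \<le> 4"
proof -
  have tele: "(trig 1 x - 1) * (\<Sum>\<nu>\<in>{a..a + int k}. trig \<nu> x) = trig (a + int k + 1) x - trig a x" for a k
  proof (induction k)
    case (Suc k)
    have "{a..a + int (Suc k)} = insert (a + int k + 1) {a..a + int k}" by auto
    then have "(trig 1 x - 1) * (\<Sum>\<nu>\<in>{a..a + int (Suc k)}. trig \<nu> x)
        = (trig 1 x - 1) * trig (a + int k + 1) x + (trig (a + int k + 1) x - trig a x)"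
      by (simp add: distrib_left Suc)
    moreover have "trig (a + int (Suc k) + 1) x = trig 1 x * trig (a + int k + 1) x"
      by (simp add: algebra_simps flip: trig_add_freq)
    ultimately show ?case by (simp add: algebra_simps)
  qed (simp add: algebra_simps trig_add_freq)
  have "norm (trig 1 x - 1) * norm (dirichlet A x) = norm (trig (int A + 1) x - trig (- int A) x)"
    using tele[of "- int A" "2 * A"] by (simp add: dirichlet_def flip: norm_mult)
  also have "\<dots> \<le> 2"
    using norm_triangle_ineq4[of "trig (int A + 1) x" "trig (- int A) x"] by simp
  finally have 1: "norm (trig 1 x - 1) * norm (dirichlet A x) \<le> 2" .
  have "norm (trig 1 x - 1) = 2 * \<bar>sin (x / 2)\<bar>"
    using dist_exp_i_1[of x] by (simp add: trig_def)
  then have "\<bar>x\<bar> / 2 \<le> norm (trig 1 x - 1)"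
    using abs_sin_half_ge[OF assms] by simp
  then have "\<bar>x\<bar> / 2 * norm (dirichlet A x) \<le> norm (trig 1 x - 1) * norm (dirichlet A x)"
    by (rule mult_right_mono) simp
  with 1 show ?thesis by (simp add: mult.commute)
qed

text \<open>The Dirichlet kernel normalized to the value \<open>1\<close> at \<open>0\<close>.\<close>

definition peak :: "nat \<Rightarrow> real \<Rightarrow> complex" where
  "peak s x = dirichlet s x / of_nat (2 * s + 1)"

lemma peak_in_trig_polys: "peak s \<in> trig_polys s"
  using trig_polys_scale[OF dirichlet_in_trig_polys[of s], of "1 / of_nat (2 * s + 1)"]
  by (simp add: peak_def[abs_def])

lemma peak_0 [simp]: "peak s 0 = 1"
proof -
  have "of_nat (2 * s + 1) \<noteq> (0::complex)"
    unfolding of_nat_eq_0_iff by simp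
  then show ?thesis unfolding peak_def dirichlet_0 by (rule divide_self)
qed

lemma norm_peak: "norm (peak s x) = norm (dirichlet s x) / real (2 * s + 1)"
  unfolding peak_def norm_divide by (simp only: norm_of_nat)

lemma norm_peak_le_1: "norm (peak s x) \<le> 1"
  using norm_dirichlet_le[of s x] by (simp add: norm_peak divide_le_eq)

lemma peak_diff_le: "norm (peak s (x + d) - peak s x) \<le> real s * \<bar>d\<bar>"
proof -
  have "peak s (x + d) - peak s x = (dirichlet s (x + d) - dirichlet s x) / of_nat (2 * s + 1)"
    by (simp add: peak_def diff_divide_distrib)
  then have "norm (peak s (x + d) - peak s x) = norm (dirichlet s (x + d) - dirichlet s x) / real (2 * s + 1)"
    by (simp only: norm_divide norm_of_nat)
  also have "\<dots> \<le> real (2 * s + 1) * (real s * \<bar>d\<bar>) / real (2 * s + 1)"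
    by (intro divide_right_mono dirichlet_diff_le) simp
  finally show ?thesis by simp
qed

text \<open>The degree \<open>n div (2 L)\<close> may vanish for small \<open>n\<close>; the bound then holds because
  \<open>n < 2 L\<close>.\<close>

lemma peak_decay:
  assumes "\<bar>x\<bar> \<le> pi" "L \<ge> 1" shows "norm (peak (n div (2 * L)) x) * (1 + real n * \<bar>x\<bar>) \<le> 1 + 8 * real L"
proof -
  define s where "s = n div (2 * L)"
  have "n < 2 * L * (s + 1)"
    using assms dividend_less_times_div[of "2 * L" n] by (simp add: s_def)
  also have "\<dots> \<le> 2 * L * (2 * s + 1)" by (intro mult_left_mono) auto
  finally have "real n \<le> real (2 * L * (2 * s + 1))" by (simp only: of_nat_le_iff)
  then have n: "real n \<le> 2 * real L * real (2 * s + 1)" by (simp only: of_nat_mult of_nat_numeral)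
  have "norm (peak s x) * (real n * \<bar>x\<bar>) \<le> norm (peak s x) * (2 * real L * real (2 * s + 1) * \<bar>x\<bar>)"
    by (intro mult_left_mono mult_right_mono n) auto
  also have "\<dots> = 2 * real L * (norm (dirichlet s x) * \<bar>x\<bar>)"
    by (simp add: norm_peak)
  also have "\<dots> \<le> 2 * real L * 4"
    by (intro mult_left_mono dirichlet_decay assms) auto
  finally show ?thesis
    using norm_peak_le_1[of s x] by (simp add: s_def distrib_left)
qed

text \<open>A Dirichlet kernel localized by a power of \<open>peak\<close>. The factor \<open>peak s x ^ L\<close> is \<open>1\<close> at
  \<open>0\<close>, so that polynomials of degree at most \<open>A - L s\<close> are still reproduced
  (\<open>sampling_kernel\<close>).\<close>

definition kernel :: "nat \<Rightarrow> nat \<Rightarrow> nat \<Rightarrow> real \<Rightarrow> complex" where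
  "kernel L A s x = dirichlet A x * peak s x ^ L"

lemma kernel_in_trig_polys: "kernel L A s \<in> trig_polys (A + L * s)"
  unfolding kernel_def[abs_def]
  by (intro trig_polys_mult dirichlet_in_trig_polys trig_polys_power peak_in_trig_polys)

lemma kernel_periodic_borel [simp]: "kernel L A s \<in> periodic_borel"
  using kernel_in_trig_polys by (rule trig_polys_periodic_borel)

lemma kernel_measurable [measurable]: "kernel L A s \<in> borel_measurable borel"
  by (rule periodic_borel_measurable) simp

lemma norm_kernel_le: "norm (kernel L A s x) \<le> real (2 * A + 1) * norm (peak s x) ^ L"
  unfolding kernel_def norm_mult norm_power
  by (intro mult_right_mono norm_dirichlet_le) auto

lemma norm_power_diff_le:
  fixes a b :: complex
  assumes "L \<ge> 1"
  shows "norm (a ^ L - b ^ L) \<le> real L * norm (a - b) * (norm a ^ (L - 1) + norm b ^ (L - 1))"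
proof -
  have eq: "norm (a ^ L - b ^ L) = norm (a - b) * norm (\<Sum>i<L. a ^ i * b ^ (L - Suc i))"
    unfolding power_diff_sumr2 norm_mult by (simp add: mult.commute)
  have "norm (\<Sum>i<L. a ^ i * b ^ (L - Suc i)) \<le> (\<Sum>i<L. norm a ^ (L - 1) + norm b ^ (L - 1))"
  proof (rule order_trans[OF norm_sum sum_mono])
    fix i assume i: "i \<in> {..<L}"
    define M where "M = max (norm a) (norm b)"
    have "norm (a ^ i * b ^ (L - Suc i)) \<le> M ^ i * M ^ (L - Suc i)"
      unfolding norm_mult norm_power by (intro mult_mono power_mono) (auto simp: M_def le_max_iff_disj)
    also have "\<dots> = M ^ (L - 1)" using i by (simp flip: power_add)
    also have "\<dots> \<le> norm a ^ (L - 1) + norm b ^ (L - 1)"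
      by (auto simp: M_def max_def)
    finally show "norm (a ^ i * b ^ (L - Suc i)) \<le> norm a ^ (L - 1) + norm b ^ (L - 1)" .
  qed
  then have "norm (a ^ L - b ^ L) \<le> norm (a - b) * (\<Sum>i<L. norm a ^ (L - 1) + norm b ^ (L - 1))"
    unfolding eq by (rule mult_left_mono) simp
  then show ?thesis by (simp add: algebra_simps)
qed

lemma kernel_diff_le:
  assumes L: "L \<ge> 1" and n: "n \<ge> 1" and A: "A \<le> 3 * n" and s: "s \<le> n"
  shows "norm (kernel L A s (x + d) - kernel L A s x)
     \<le> 28 * real L * real n * (real n * \<bar>d\<bar>) * (norm (peak s (x + d)) ^ (L - 1) + norm (peak s x) ^ (L - 1))"
proof -
  let ?G = "norm (peak s (x + d)) ^ (L - 1) + norm (peak s x) ^ (L - 1)"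
  have A': "real (2 * A + 1) \<le> 7 * real n" "real A \<le> 3 * real n"
    using A n by linarith+
  have "kernel L A s (x + d) - kernel L A s x
      = (dirichlet A (x + d) - dirichlet A x) * peak s (x + d) ^ L
        + dirichlet A x * (peak s (x + d) ^ L - peak s x ^ L)"
    by (simp add: kernel_def algebra_simps)
  then have "norm (kernel L A s (x + d) - kernel L A s x)
     \<le> norm (dirichlet A (x + d) - dirichlet A x) * norm (peak s (x + d)) ^ L
       + norm (dirichlet A x) * norm (peak s (x + d) ^ L - peak s x ^ L)"
    by (metis norm_triangle_ineq norm_mult norm_power)
  also have "\<dots> \<le> (7 * real n * (3 * real n * \<bar>d\<bar>)) * ?G + 7 * real n * (real L * (real n * \<bar>d\<bar>) * ?G)"
  proof (intro add_mono mult_mono)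
    have "real (2 * A + 1) * (real A * \<bar>d\<bar>) \<le> 7 * real n * (3 * real n * \<bar>d\<bar>)"
      using A' by (intro mult_mono) auto
    with dirichlet_diff_le[of A x d]
    show "norm (dirichlet A (x + d) - dirichlet A x) \<le> 7 * real n * (3 * real n * \<bar>d\<bar>)" by linarith
    show "norm (peak s (x + d)) ^ L \<le> ?G"
    proof -
      have "norm (peak s (x + d)) ^ L \<le> norm (peak s (x + d)) ^ (L - 1)"
        by (rule power_decreasing) (auto simp: norm_peak_le_1)
      then show ?thesis by (smt (verit) norm_ge_zero zero_le_power)
    qed
    show "norm (dirichlet A x) \<le> 7 * real n"
      using norm_dirichlet_le[of A x] A' by linarith
    have "norm (peak s (x + d) - peak s x) \<le> real n * \<bar>d\<bar>"
      using peak_diff_le[of s x d] s by (smt (verit) abs_ge_zero mult_right_mono of_nat_le_iff)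
    then have "real L * norm (peak s (x + d) - peak s x) * ?G \<le> real L * (real n * \<bar>d\<bar>) * ?G"
      by (intro mult_right_mono mult_left_mono) auto
    with norm_power_diff_le[OF L, of "peak s (x + d)" "peak s x"]
    show "norm (peak s (x + d) ^ L - peak s x ^ L) \<le> real L * (real n * \<bar>d\<bar>) * ?G" by linarith
  qed auto
  also have "\<dots> = (21 + 7 * real L) * (real n * (real n * \<bar>d\<bar>) * ?G)"
    by (simp add: algebra_simps)
  also have "\<dots> \<le> (28 * real L) * (real n * (real n * \<bar>d\<bar>) * ?G)"
    using L by (intro mult_right_mono) auto
  finally show ?thesis by (simp add: mult_ac)
qed

subsection \<open>Sampling on a lattice\<close>

text \<open>The step \<open>2\<pi> / (8n)\<close> of the lattice with \<open>8n\<close> points per period.\<close>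

definition mesh :: "nat \<Rightarrow> real" where
  "mesh n = pi / (4 * real n)"

text \<open>Indices of the lattice points of one period, centred so that \<open>k * mesh n\<close> lies in \<open>[-\<pi>, \<pi>)\<close>.\<close>

definition nodes :: "nat \<Rightarrow> int set" where
  "nodes n = {- 4 * int n..<4 * int n}"

lemma finite_nodes [simp]: "finite (nodes n)"
  by (simp add: nodes_def)

lemma card_nodes [simp]: "card (nodes n) = 8 * n"
  by (simp add: nodes_def)

lemma sum_periodic_interval_shift:
  fixes \<phi> :: "int \<Rightarrow> 'a::comm_monoid_add"
  assumes per: "\<And>k. \<phi> (k + M) = \<phi> k" and M: "M > 0"
  shows "(\<Sum>k\<in>{a + j..<a + j + M}. \<phi> k) = (\<Sum>k\<in>{a..<a + M}. \<phi> k)"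
proof -
  have step: "(\<Sum>k\<in>{b + 1..<b + 1 + M}. \<phi> k) = (\<Sum>k\<in>{b..<b + M}. \<phi> k)" for b
  proof -
    have "{b + 1..<b + 1 + M} = insert (b + M) {b + 1..<b + M}"
         "{b..<b + M} = insert b {b + 1..<b + M}" using M by auto
    then show ?thesis by (simp add: per)
  qed
  show ?thesis
  proof (induction j rule: int_induct[of _ 0])
    case (step1 i)
    then show ?case using step[of "a + i"] by (simp add: add.assoc)
  next
    case (step2 i)
    then show ?case using step[of "a + (i - 1)"] by (simp add: algebra_simps)
  qed simp
qed

lemma sum_nodes_shift:
  fixes \<phi> :: "int \<Rightarrow> 'a::comm_monoid_add"
  assumes per: "\<And>k. \<phi> (k + 8 * int n) = \<phi> k" and n: "n \<ge> 1"
  shows "(\<Sum>k\<in>nodes n. \<phi> (k + j)) = (\<Sum>k\<in>nodes n. \<phi> k)"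
proof -
  have "(\<Sum>k\<in>nodes n. \<phi> (k + j)) = (\<Sum>k\<in>{- 4 * int n + j..<- 4 * int n + j + 8 * int n}. \<phi> k)"
    unfolding nodes_def
    by (rule sum.reindex_bij_witness[where i = "\<lambda>k. k - j" and j = "\<lambda>k. k + j"]) auto
  also have "\<dots> = (\<Sum>k\<in>{- 4 * int n..<- 4 * int n + 8 * int n}. \<phi> k)"
    by (rule sum_periodic_interval_shift) (use per n in auto)
  finally show ?thesis by (simp add: nodes_def)
qed

lemma sum_nodes_reflect:
  fixes \<phi> :: "int \<Rightarrow> 'a::comm_monoid_add"
  assumes per: "\<And>k. \<phi> (k + 8 * int n) = \<phi> k" and n: "n \<ge> 1"
  shows "(\<Sum>k\<in>nodes n. \<phi> (j - k)) = (\<Sum>k\<in>nodes n. \<phi> k)"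
proof -
  have "(\<Sum>k\<in>nodes n. \<phi> (j - k)) = (\<Sum>k\<in>nodes n. \<phi> (k + (j + 1)))"
    unfolding nodes_def
    by (rule sum.reindex_bij_witness[where i = "\<lambda>k. - k - 1" and j = "\<lambda>k. - k - 1"])
       (auto simp: algebra_simps)
  then show ?thesis using sum_nodes_shift[of \<phi> n "j + 1"] assms by simp
qed

lemma mesh_period: "n \<ge> 1 \<Longrightarrow> of_int (k + 8 * int n) * mesh n = of_int k * mesh n + 2 * pi"
  by (simp add: mesh_def field_simps)

lemma sum_trig_nodes:
  assumes n: "n \<ge> 1" and \<nu>: "\<nu> \<noteq> 0" "\<bar>\<nu>\<bar> < 8 * int n"
  shows "(\<Sum>k\<in>nodes n. trig \<nu> (of_int k * mesh n)) = 0"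
proof -
  let ?S = "\<Sum>k\<in>nodes n. trig \<nu> (of_int k * mesh n)"
  have "?S = (\<Sum>k\<in>nodes n. trig \<nu> (of_int (k + 1) * mesh n))"
    by (rule sum_nodes_shift[symmetric]) (use n in \<open>auto simp: mesh_period[OF n] trig_periodic simp del: of_int_add\<close>)
  also have "\<dots> = trig \<nu> (mesh n) * ?S"
  proof -
    have "trig \<nu> (of_int (k + 1) * mesh n) = trig \<nu> (mesh n) * trig \<nu> (of_int k * mesh n)" for k
      using trig_add[of \<nu> "mesh n" "of_int k * mesh n"] by (simp add: algebra_simps)
    then show ?thesis by (simp add: sum_distrib_left)
  qed
  finally have "(trig \<nu> (mesh n) - 1) * ?S = 0" by (simp add: algebra_simps)
  moreover have "trig \<nu> (mesh n) \<noteq> 1"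
  proof
    assume "trig \<nu> (mesh n) = 1"
    then obtain j :: int where "of_int \<nu> * mesh n = of_int (2 * j) * pi"
      unfolding trig_eq_exp by (subst (asm) exp_eq_1) auto
    then have "real_of_int \<nu> = of_int (8 * int n * j)"
      using n by (simp add: mesh_def field_simps)
    then have "\<nu> = 8 * int n * j" by (simp only: of_int_eq_iff)
    with \<nu> show False
      by (metis abs_mult abs_of_nat dvd_imp_le_int dvd_triv_left not_le abs_numeral)
  qed
  ultimately show ?thesis by simp
qed

text \<open>Polynomials of degree at most \<open>A\<close> are reproduced from lattice samples: by orthogonality of the
  exponentials on the lattice, frequencies that differ by less than \<open>8n\<close> do not interfere.\<close>

lemma sampling_dirichlet:
  assumes T: "T \<in> trig_polys A" and n: "n \<ge> 1" and A: "2 * A < 8 * n"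
  shows "(\<Sum>k\<in>nodes n. T (y + of_int k * mesh n) * dirichlet A (x - (y + of_int k * mesh n)))
     = of_nat (8 * n) * T x"
proof -
  obtain c where T: "T = (\<lambda>x. \<Sum>\<nu>\<in>{- int A..int A}. c \<nu> * trig \<nu> x)"
    using T by (metis trig_polysE)
  have split: "trig \<nu> (y + t) * trig \<mu> (x - (y + t)) = trig \<nu> y * trig \<mu> (x - y) * trig (\<nu> - \<mu>) t" for \<nu> \<mu> t
  proof -
    have "trig \<mu> (x - (y + t)) = trig \<mu> (x - y) * trig (- \<mu>) t"
      using trig_add[of \<mu> "x - y" "- t"] by (simp add: trig_uminus algebra_simps)
    then show ?thesis using trig_add_freq[of \<nu> "- \<mu>" t] by (simp add: trig_add)
  qed
  have "(\<Sum>k\<in>nodes n. T (y + of_int k * mesh n) * dirichlet A (x - (y + of_int k * mesh n)))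
     = (\<Sum>k\<in>nodes n. \<Sum>\<nu>\<in>{- int A..int A}. \<Sum>\<mu>\<in>{- int A..int A}.
          c \<nu> * (trig \<nu> y * trig \<mu> (x - y) * trig (\<nu> - \<mu>) (of_int k * mesh n)))"
    unfolding T dirichlet_def sum_product by (simp add: mult.assoc split[unfolded mult.assoc])
  also have "\<dots> = (\<Sum>\<nu>\<in>{- int A..int A}. \<Sum>\<mu>\<in>{- int A..int A}. \<Sum>k\<in>nodes n.
          c \<nu> * (trig \<nu> y * trig \<mu> (x - y) * trig (\<nu> - \<mu>) (of_int k * mesh n)))"
    by (subst sum.swap, rule sum.cong[OF refl], rule sum.swap)
  also have "\<dots> = (\<Sum>\<nu>\<in>{- int A..int A}. \<Sum>\<mu>\<in>{- int A..int A}.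
          if \<mu> = \<nu> then of_nat (8 * n) * (c \<nu> * trig \<nu> x) else 0)"
  proof (intro sum.cong refl)
    fix \<nu> \<mu> assume "\<nu> \<in> {- int A..int A}" "\<mu> \<in> {- int A..int A}"
    then have lt: "\<bar>\<nu> - \<mu>\<bar> < 8 * int n" using A by auto
    have "(\<Sum>k\<in>nodes n. c \<nu> * (trig \<nu> y * trig \<mu> (x - y) * trig (\<nu> - \<mu>) (of_int k * mesh n)))
        = c \<nu> * (trig \<nu> y * trig \<mu> (x - y)) * (\<Sum>k\<in>nodes n. trig (\<nu> - \<mu>) (of_int k * mesh n))"
      by (simp add: sum_distrib_left mult.assoc)
    also have "\<dots> = (if \<mu> = \<nu> then of_nat (8 * n) * (c \<nu> * trig \<nu> x) else 0)"
    proof (cases "\<mu> = \<nu>")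
      case True
      have "trig \<nu> y * trig \<nu> (x - y) = trig \<nu> x" by (simp flip: trig_add)
      then show ?thesis using True by simp
    next
      case False
      then show ?thesis using sum_trig_nodes[OF n _ lt] by simp
    qed
    finally show "(\<Sum>k\<in>nodes n. c \<nu> * (trig \<nu> y * trig \<mu> (x - y) * trig (\<nu> - \<mu>) (of_int k * mesh n)))
        = (if \<mu> = \<nu> then of_nat (8 * n) * (c \<nu> * trig \<nu> x) else 0)" .
  qed
  also have "\<dots> = (\<Sum>\<nu>\<in>{- int A..int A}. of_nat (8 * n) * (c \<nu> * trig \<nu> x))"
    by (intro sum.cong refl) (simp add: sum.delta)
  finally show ?thesis by (simp add: T sum_distrib_left)
qed

text \<open>Apply \<open>sampling_dirichlet\<close> to \<open>z \<mapsto> T z * peak s (x - z) ^ L\<close>, whose value at \<open>x\<close> is \<open>T x\<close>.\<close>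

lemma sampling_kernel:
  assumes T: "T \<in> trig_polys d" and n: "n \<ge> 1" and A: "2 * A < 8 * n" and d: "d + L * s \<le> A"
  shows "(\<Sum>k\<in>nodes n. T (y + of_int k * mesh n) * kernel L A s (x - (y + of_int k * mesh n)))
     = of_nat (8 * n) * T x"
proof -
  have "(\<lambda>z. T z * peak s (x - z) ^ L) \<in> trig_polys (d + L * s)"
    by (intro trig_polys_mult T trig_polys_power trig_polys_reflect peak_in_trig_polys)
  then have "(\<lambda>z. T z * peak s (x - z) ^ L) \<in> trig_polys A"
    using d by (rule trig_polys_mono)
  from sampling_dirichlet[OF this n A, of y x] show ?thesis
    by (simp add: kernel_def mult_ac)
qed


section \<open>The averaging kernel\<close>

lemma nn_integral_inverse_square:
  assumes n: "n \<ge> 1"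
  shows "(\<integral>\<^sup>+x\<in>{0..}. ennreal (1 / (1 + real n * x)\<^sup>2) \<partial>lborel) = ennreal (1 / real n)"
proof -
  define F where "F x = - (1 / real n) / (1 + real n * x)" for x
  have "(\<integral>\<^sup>+x. ennreal (1 / (1 + real n * x)\<^sup>2) * indicator {0..} x \<partial>lborel) = 0 - F 0"
  proof (rule nn_integral_FTC_atLeast)
    fix x :: real assume x: "0 \<le> x"
    then have pos: "1 + real n * x > 0" by (intro add_pos_nonneg) auto
    show "DERIV F x :> 1 / (1 + real n * x)\<^sup>2"
      unfolding F_def using n pos
      by (auto intro!: derivative_eq_intros simp: power2_eq_square divide_simps)
  next
    have "filterlim (\<lambda>x. 1 + real n * x) at_top at_top"
      by (intro filterlim_tendsto_add_at_top[OF tendsto_const]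
            filterlim_tendsto_pos_mult_at_top[OF tendsto_const]) (use n in \<open>auto simp: filterlim_ident\<close>)
    then show "(F \<longlongrightarrow> 0) at_top"
      unfolding F_def by (intro tendsto_divide_0[OF tendsto_const] filterlim_at_top_imp_at_infinity)
  qed auto
  then show ?thesis by (simp add: F_def)
qed

lemma nn_integral_decay:
  assumes n: "n \<ge> 1" and e: "e \<ge> 2"
  shows "(\<integral>\<^sup>+x. ennreal ((1 + real n * \<bar>x\<bar>) powr (- e)) \<partial>circ) \<le> ennreal (1 / real n)"
proof -
  let ?g = "\<lambda>x. ennreal (1 / (1 + real n * x)\<^sup>2) * indicator {0..} x"
  have le: "ennreal ((1 + real n * \<bar>x\<bar>) powr (- e)) \<le> ?g x + ?g (- x)" for x
  proof -
    have pos: "1 + real n * \<bar>x\<bar> \<ge> 1" by simp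
    have "(1 + real n * \<bar>x\<bar>) powr (- e) \<le> (1 + real n * \<bar>x\<bar>) powr (- 2)"
      using e pos by (intro powr_mono) auto
    also have "\<dots> = 1 / (1 + real n * \<bar>x\<bar>)\<^sup>2"
      using pos by (simp add: powr_minus powr_numeral divide_inverse)
    finally have *: "ennreal ((1 + real n * \<bar>x\<bar>) powr (- e)) \<le> ennreal (1 / (1 + real n * \<bar>x\<bar>)\<^sup>2)"
      by (rule ennreal_leI)
    show ?thesis
    proof (cases "x \<ge> 0")
      case True
      with * have "ennreal ((1 + real n * \<bar>x\<bar>) powr (- e)) \<le> ?g x" by simp
      then show ?thesis by (rule order_trans) simp
    next
      case False
      with * have "ennreal ((1 + real n * \<bar>x\<bar>) powr (- e)) \<le> ?g (- x)" by simp
      then show ?thesis by (rule order_trans) simp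
    qed
  qed
  have g: "(\<integral>\<^sup>+x. ?g x \<partial>lborel) = ennreal (1 / real n)"
    by (rule nn_integral_inverse_square[OF n])
  have g': "(\<integral>\<^sup>+x. ?g (- x) \<partial>lborel) = ennreal (1 / real n)"
  proof -
    have "(\<integral>\<^sup>+x. ?g x \<partial>lborel) = (\<integral>\<^sup>+x. ?g (- x) \<partial>lborel)"
      using nn_integral_real_affine[where f = ?g and c = "-1" and t = 0] by simp
    from this[symmetric] g show ?thesis by (rule trans)
  qed
  have "(\<integral>\<^sup>+x. ennreal ((1 + real n * \<bar>x\<bar>) powr (- e)) \<partial>circ)
      = ennreal (1 / (2 * pi)) * (\<integral>\<^sup>+x\<in>{- pi..<pi}. ennreal ((1 + real n * \<bar>x\<bar>) powr (- e)) \<partial>lborel)"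
    by (rule nn_integral_circ) auto
  also have "\<dots> \<le> ennreal (1 / (2 * pi)) * (\<integral>\<^sup>+x. ?g x + ?g (- x) \<partial>lborel)"
    using le by (intro mult_left_mono nn_integral_mono) (auto simp: indicator_def)
  also have "(\<integral>\<^sup>+x. ?g x + ?g (- x) \<partial>lborel) = (\<integral>\<^sup>+x. ?g x \<partial>lborel) + (\<integral>\<^sup>+x. ?g (- x) \<partial>lborel)"
    by (rule nn_integral_add) auto
  also have "\<dots> = ennreal (1 / real n) + ennreal (1 / real n)"
    by (simp only: g g')
  also have "ennreal (1 / (2 * pi)) * (ennreal (1 / real n) + ennreal (1 / real n)) = ennreal (1 / pi * (1 / real n))"
    by (simp flip: ennreal_plus ennreal_mult)
  also have "\<dots> \<le> ennreal (1 / real n)"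
  proof (rule ennreal_leI)
    have "1 / pi \<le> 1" using pi_gt3 by simp
    then have "1 / pi * (1 / real n) \<le> 1 * (1 / real n)" by (intro mult_right_mono) auto
    then show "1 / pi * (1 / real n) \<le> 1 / real n" by simp
  qed
  finally show ?thesis .
qed

lemma peak_decay_powr:
  assumes "\<bar>x\<bar> \<le> pi" "L \<ge> 1" "e \<ge> 0"
  shows "norm (peak (n div (2 * L)) x) powr e \<le> (1 + 8 * real L) powr e * (1 + real n * \<bar>x\<bar>) powr (- e)"
proof -
  have pos: "1 + real n * \<bar>x\<bar> > 0" by (intro add_pos_nonneg) auto
  have "norm (peak (n div (2 * L)) x) \<le> (1 + 8 * real L) / (1 + real n * \<bar>x\<bar>)"
    using peak_decay[OF assms(1,2), of n] pos by (simp add: pos_le_divide_eq)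
  then have "norm (peak (n div (2 * L)) x) powr e \<le> ((1 + 8 * real L) / (1 + real n * \<bar>x\<bar>)) powr e"
    using assms by (intro powr_mono2) auto
  also have "\<dots> = (1 + 8 * real L) powr e * (1 + real n * \<bar>x\<bar>) powr (- e)"
    using pos by (simp add: powr_divide powr_minus_divide)
  finally show ?thesis .
qed

lemma powr_real_nat: "x \<ge> 0 \<Longrightarrow> L \<ge> 1 \<Longrightarrow> x powr real L = x ^ L"
  by (cases "x = 0") (auto simp: powr_realpow)

text \<open>The kernel of degree at most \<open>n\<close> that averages on the scale \<open>1/n\<close>. The Dirichlet factor has
  degree \<open>L s\<close>, which is just enough to reproduce constants.\<close>

definition avg_kernel :: "nat \<Rightarrow> nat \<Rightarrow> real \<Rightarrow> complex" where
  "avg_kernel L n = kernel L (L * (n div (2 * L))) (n div (2 * L))"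

lemma avg_kernel_degree:
  fixes L n :: nat
  shows "2 * (L * (n div (2 * L))) \<le> n"
  unfolding mult.assoc[symmetric] by (rule times_div_less_eq_dividend)

lemma avg_kernel_in_trig_polys: "avg_kernel L n \<in> trig_polys n"
  unfolding avg_kernel_def
  by (rule trig_polys_mono[OF kernel_in_trig_polys]) (use avg_kernel_degree[of L n] in linarith)

lemma avg_kernel_periodic_borel [simp]: "avg_kernel L n \<in> periodic_borel"
  by (simp add: avg_kernel_def)

lemma avg_kernel_measurable [measurable]: "avg_kernel L n \<in> borel_measurable borel"
  by (simp add: avg_kernel_def)

lemma norm_avg_kernel_le:
  assumes "\<bar>x\<bar> \<le> pi" "L \<ge> 1" "n \<ge> 1"
  shows "norm (avg_kernel L n x) \<le> 2 * (1 + 8 * real L) ^ L * (real n * (1 + real n * \<bar>x\<bar>) powr (- real L))"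
proof -
  have "real (2 * (L * (n div (2 * L))) + 1) \<le> 2 * real n"
    using avg_kernel_degree[of L n] assms(3) by linarith
  moreover have "norm (peak (n div (2 * L)) x) ^ L \<le> (1 + 8 * real L) ^ L * (1 + real n * \<bar>x\<bar>) powr (- real L)"
    using peak_decay_powr[of x L "real L" n] assms by (simp add: powr_real_nat)
  ultimately have "real (2 * (L * (n div (2 * L))) + 1) * norm (peak (n div (2 * L)) x) ^ L
      \<le> 2 * real n * ((1 + 8 * real L) ^ L * (1 + real n * \<bar>x\<bar>) powr (- real L))"
    by (intro mult_mono) auto
  with norm_kernel_le[of L "L * (n div (2 * L))" "n div (2 * L)" x] show ?thesis
    unfolding avg_kernel_def by (simp only: mult_ac)
qed

lemma sum_avg_kernel_nodes:
  assumes "n \<ge> 1"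
  shows "(\<Sum>k\<in>nodes n. avg_kernel L n (x - (y + of_int k * mesh n))) = of_nat (8 * n)"
  using sampling_kernel[of "\<lambda>_. 1" 0 n "L * (n div (2 * L))" L "n div (2 * L)" y x]
    assms avg_kernel_degree[of L n] trig_polys_const[of 1 0]
  by (simp add: avg_kernel_def)

lemma measure_circ_UNIV [simp]: "measure circ UNIV = 1"
  by (simp add: measure_def)

lemma integrable_circ_bounded:
  fixes g :: "real \<Rightarrow> complex"
  assumes "g \<in> borel_measurable borel" "\<And>x. norm (g x) \<le> B"
  shows "integrable circ g"
  by (rule circ.integrable_const_bound[where B = B]) (use assms in auto)

lemma integrable_trig: "integrable circ (trig \<nu>)"
  by (rule integrable_circ_bounded[where B = 1]) auto

lemma integral_trig: "\<nu> \<noteq> 0 \<Longrightarrow> (LINT x|circ. trig \<nu> x) = 0"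
proof -
  assume \<nu>: "\<nu> \<noteq> 0"
  have e: "trig \<nu> (pi / of_int \<nu>) = - 1"
    using \<nu> by (simp add: trig_def)
  have "(LINT x|circ. trig \<nu> x) = (LINT x|circ. trig \<nu> (x + pi / of_int \<nu>))"
    by (rule integral_circ_shift[symmetric]) (auto simp: trig_periodic)
  also have "\<dots> = - (LINT x|circ. trig \<nu> x)"
    by (simp add: trig_add e)
  finally show ?thesis by simp
qed

text \<open>Lattice mean and integral mean of a polynomial of degree less than \<open>8n\<close> coincide.\<close>

lemma integral_trig_poly:
  assumes T: "T \<in> trig_polys n" and n: "n \<ge> 1"
  shows "(\<Sum>k\<in>nodes n. T (of_int k * mesh n)) = of_nat (8 * n) * (LINT x|circ. T x)"
proof -
  obtain c where T: "T = (\<lambda>x. \<Sum>\<nu>\<in>{- int n..int n}. c \<nu> * trig \<nu> x)"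
    using T by (metis trig_polysE)
  have I: "(LINT x|circ. trig \<nu> x) = (if \<nu> = 0 then 1 else 0)" for \<nu>
  proof -
    have "trig 0 = (\<lambda>x. 1)" by (simp add: fun_eq_iff)
    then show ?thesis using integral_trig by simp
  qed
  have S: "(\<Sum>k\<in>nodes n. trig \<nu> (of_int k * mesh n)) = of_nat (8 * n) * (LINT x|circ. trig \<nu> x)"
    if "\<nu> \<in> {- int n..int n}" for \<nu>
  proof (cases "\<nu> = 0")
    case True
    then show ?thesis by (simp add: I)
  next
    case False
    have "\<bar>\<nu>\<bar> < 8 * int n" using that n by auto
    then show ?thesis using False sum_trig_nodes[OF n False] I by simp
  qed
  have "(\<Sum>k\<in>nodes n. T (of_int k * mesh n))
      = (\<Sum>\<nu>\<in>{- int n..int n}. c \<nu> * (\<Sum>k\<in>nodes n. trig \<nu> (of_int k * mesh n)))"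
    unfolding T by (subst sum.swap) (simp add: sum_distrib_left)
  also have "\<dots> = (\<Sum>\<nu>\<in>{- int n..int n}. c \<nu> * (of_nat (8 * n) * (LINT x|circ. trig \<nu> x)))"
    by (intro sum.cong refl) (simp only: S)
  also have "\<dots> = of_nat (8 * n) * (\<Sum>\<nu>\<in>{- int n..int n}. c \<nu> * (LINT x|circ. trig \<nu> x))"
    by (simp add: sum_distrib_left mult_ac)
  also have "(\<Sum>\<nu>\<in>{- int n..int n}. c \<nu> * (LINT x|circ. trig \<nu> x)) = (LINT x|circ. T x)"
    unfolding T by (subst Bochner_Integration.integral_sum) (auto intro: integrable_trig)
  finally show ?thesis .
qed

lemma integral_avg_kernel:
  assumes "n \<ge> 1" shows "(LINT y|circ. avg_kernel L n (x - y)) = 1"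
proof -
  have "(\<Sum>k\<in>nodes n. avg_kernel L n (x - of_int k * mesh n)) = of_nat (8 * n) * (LINT y|circ. avg_kernel L n (x - y))"
    by (rule integral_trig_poly[OF trig_polys_reflect[OF avg_kernel_in_trig_polys] assms])
  then have "of_nat (8 * n) * (LINT y|circ. avg_kernel L n (x - y)) = of_nat (8 * n) * 1"
    using sum_avg_kernel_nodes[OF assms, of L x 0] by simp
  moreover have "of_nat (8 * n) \<noteq> (0::complex)" using assms by simp
  ultimately show ?thesis by (metis mult_left_cancel)
qed

section \<open>The direct theorem for \<open>1 \<le> p \<le> \<infinity>\<close>\<close>

text \<open>Convolution with the averaging kernel.\<close>

definition conv :: "nat \<Rightarrow> nat \<Rightarrow> (real \<Rightarrow> complex) \<Rightarrow> real \<Rightarrow> complex" where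
  "conv L n g x = (LINT y|circ. g y * avg_kernel L n (x - y))"

text \<open>The operator \<open>I - J\<close> for \<open>J = conv L n\<close>.\<close>

definition defect :: "nat \<Rightarrow> nat \<Rightarrow> (real \<Rightarrow> complex) \<Rightarrow> real \<Rightarrow> complex" where
  "defect L n g x = g x - conv L n g x"

text \<open>Periodic functions integrable over a period, the domain of \<open>conv\<close>.\<close>

definition L1 :: "(real \<Rightarrow> complex) set" where
  "L1 = {g \<in> periodic_borel. integrable circ g}"

lemma L1I: "g \<in> periodic_borel \<Longrightarrow> integrable circ g \<Longrightarrow> g \<in> L1"
  by (simp add: L1_def)

lemma L1_integrable: "g \<in> L1 \<Longrightarrow> integrable circ g"
  by (simp add: L1_def)

lemma L1_periodic_borel [simp]: "g \<in> L1 \<Longrightarrow> g \<in> periodic_borel"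
  by (simp add: L1_def)

lemma L1_measurable [measurable_dest]: "g \<in> L1 \<Longrightarrow> g \<in> borel_measurable borel"
  by (rule periodic_borel_measurable) (rule L1_periodic_borel)

lemma L1_mult_bounded:
  assumes g: "g \<in> L1" and [measurable]: "w \<in> borel_measurable borel" and w: "\<And>x. norm (w x) \<le> B"
  shows "integrable circ (\<lambda>y. g y * w y)"
proof (rule Bochner_Integration.integrable_bound[where f = "\<lambda>y. of_real B * g y"])
  note [measurable] = L1_measurable[OF g]
  show "integrable circ (\<lambda>y. of_real B * g y)" using L1_integrable[OF g] by simp
  show "(\<lambda>y. g y * w y) \<in> borel_measurable circ" by simp
  have "norm (g y * w y) \<le> norm (of_real B * g y)" for y
  proof -
    have "norm (w y) \<le> \<bar>B\<bar>" using w[of y] by linarith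
    from mult_right_mono[OF this, of "norm (g y)"] show ?thesis
      by (simp add: norm_mult mult.commute)
  qed
  then show "AE x in circ. norm (g x * w x) \<le> norm (of_real B * g x)" by simp
qed

lemma avg_kernel_bounded: "\<exists>B. \<forall>x. norm (avg_kernel L n x) \<le> B"
proof -
  have "norm (avg_kernel L n x) \<le> real (2 * (L * (n div (2 * L))) + 1)" for x
  proof -
    have "norm (peak (n div (2 * L)) x) ^ L \<le> 1"
      by (intro power_le_one norm_peak_le_1) auto
    then have "real (2 * (L * (n div (2 * L))) + 1) * norm (peak (n div (2 * L)) x) ^ L
        \<le> real (2 * (L * (n div (2 * L))) + 1) * 1"
      by (intro mult_left_mono) auto
    from order_trans[OF norm_kernel_le[of L "L * (n div (2 * L))" "n div (2 * L)" x] this]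
    show ?thesis unfolding avg_kernel_def by simp
  qed
  then show ?thesis by blast
qed

lemma integrable_conv:
  assumes "g \<in> L1" shows "integrable circ (\<lambda>y. g y * avg_kernel L n (x - y))"
proof -
  obtain B where "\<forall>x. norm (avg_kernel L n x) \<le> B" using avg_kernel_bounded by blast
  then show ?thesis by (intro L1_mult_bounded[OF assms, where B = B]) auto
qed

lemma integrable_shift:
  assumes g: "g \<in> periodic_borel" and "integrable circ g"
  shows "integrable circ (\<lambda>x. g (x + u))"
proof -
  note [measurable] = periodic_borel_measurable[OF g]
  have "integrable (distr circ borel (\<lambda>x. wrap (x + u))) g"
    unfolding distr_circ_wrap by fact
  then have "integrable circ (\<lambda>x. g (wrap (x + u)))"
    by (subst (asm) integrable_distr_eq) auto
  then show ?thesis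
    using periodic_wrap[of g] periodic_borel_periodic[OF g] by simp
qed

lemma L1_shift [simp]: "g \<in> L1 \<Longrightarrow> (\<lambda>x. g (x + u)) \<in> L1"
  by (rule L1I) (auto intro: integrable_shift L1_integrable)

lemma L1_diff [simp]: "f \<in> L1 \<Longrightarrow> g \<in> L1 \<Longrightarrow> (\<lambda>x. f x - g x) \<in> L1"
  by (rule L1I) (auto intro: L1_integrable)

lemma L1_diff1 [simp]: "f \<in> L1 \<Longrightarrow> diff1 u f \<in> L1"
  by (simp add: diff1_def)

lemma trig_polys_L1: "T \<in> trig_polys n \<Longrightarrow> T \<in> L1"
proof -
  assume T: "T \<in> trig_polys n"
  then obtain c where eq: "T = (\<lambda>x. \<Sum>\<nu>\<in>{- int n..int n}. c \<nu> * trig \<nu> x)"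
    by (metis trig_polysE)
  have "integrable circ T" unfolding eq
    by (intro Bochner_Integration.integrable_sum integrable_mult_right integrable_trig)
  then show ?thesis using trig_polys_periodic_borel[OF T] by (intro L1I)
qed

lemma conv_in_trig_polys:
  assumes g: "g \<in> L1" shows "conv L n g \<in> trig_polys n"
proof -
  obtain c where c: "avg_kernel L n = (\<lambda>x. \<Sum>\<nu>\<in>{- int n..int n}. c \<nu> * trig \<nu> x)"
    using avg_kernel_in_trig_polys by (metis trig_polysE)
  have int: "integrable circ (\<lambda>y. g y * trig (- \<nu>) y)" for \<nu>
    by (rule L1_mult_bounded[OF g, where B = 1]) auto
  have "conv L n g = (\<lambda>x. \<Sum>\<nu>\<in>{- int n..int n}. (c \<nu> * (LINT y|circ. g y * trig (- \<nu>) y)) * trig \<nu> x)"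
  proof
    fix x
    have "conv L n g x = (LINT y|circ. (\<Sum>\<nu>\<in>{- int n..int n}. (c \<nu> * trig \<nu> x) * (g y * trig (- \<nu>) y)))"
    proof -
      have "trig \<nu> (x - y) = trig \<nu> x * trig (- \<nu>) y" for \<nu> y
        using trig_add[of \<nu> x "- y"] by (simp add: trig_uminus)
      then show ?thesis
        unfolding conv_def c by (simp add: sum_distrib_left mult_ac)
    qed
    also have "\<dots> = (\<Sum>\<nu>\<in>{- int n..int n}. (c \<nu> * trig \<nu> x) * (LINT y|circ. g y * trig (- \<nu>) y))"
      using int by (subst Bochner_Integration.integral_sum) auto
    finally show "conv L n g x = (\<Sum>\<nu>\<in>{- int n..int n}. (c \<nu> * (LINT y|circ. g y * trig (- \<nu>) y)) * trig \<nu> x)"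
      by (simp add: mult_ac)
  qed
  then show ?thesis using trig_polysI by simp
qed

lemma defect_L1 [simp]: "g \<in> L1 \<Longrightarrow> defect L n g \<in> L1"
  unfolding defect_def[abs_def] by (intro L1_diff trig_polys_L1[OF conv_in_trig_polys]) auto

lemma conv_shift:
  assumes g: "g \<in> L1" shows "conv L n (\<lambda>x. g (x + v)) x = conv L n g (x + v)"
proof -
  note [measurable] = L1_measurable[OF g]
  have "conv L n (\<lambda>x. g (x + v)) x = (LINT y|circ. g (y + v) * avg_kernel L n (x + v - (y + v)))"
    by (simp add: conv_def)
  also have "\<dots> = (LINT y|circ. g y * avg_kernel L n (x + v - y))"
  proof (rule integral_circ_shift[where \<phi> = "\<lambda>y. g y * avg_kernel L n (x + v - y)"])
    fix y
    show "g (y + 2 * pi) * avg_kernel L n (x + v - (y + 2 * pi)) = g y * avg_kernel L n (x + v - y)"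
      using periodic_borel_periodic[of g y] g by (simp only: L1_periodic_borel periodic_borel_reflect[OF avg_kernel_periodic_borel])
  qed simp
  finally show ?thesis by (simp add: conv_def)
qed

lemma conv_diff:
  assumes "f \<in> L1" "g \<in> L1"
  shows "conv L n (\<lambda>x. f x - g x) x = conv L n f x - conv L n g x"
  unfolding conv_def using assms
  by (simp add: left_diff_distrib integrable_conv)

lemma diff1_defect:
  assumes "g \<in> L1" shows "diff1 v (defect L n g) = defect L n (diff1 v g)"
  using assms by (simp add: fun_eq_iff diff1_def defect_def conv_diff conv_shift)

lemma defect_pow_L1 [simp]: "g \<in> L1 \<Longrightarrow> (defect L n ^^ j) g \<in> L1"
  by (induction j) auto

lemma diff1_defect_pow: "g \<in> L1 \<Longrightarrow> diff1 v ((defect L n ^^ j) g) = (defect L n ^^ j) (diff1 v g)"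
  by (induction j) (auto simp: diff1_defect)

lemma fdiff_L1 [simp]: "g \<in> L1 \<Longrightarrow> fdiff k u g \<in> L1"
  by (induction k) (auto simp: fdiff_Suc)

lemma fdiff_defect_pow: "g \<in> L1 \<Longrightarrow> fdiff k v ((defect L n ^^ j) g) = (defect L n ^^ j) (fdiff k v g)"
  by (induction k) (auto simp: fdiff_Suc diff1_defect_pow)

lemma defect_pow_trig_polys:
  assumes "g \<in> L1" shows "(\<lambda>x. g x - (defect L n ^^ j) g x) \<in> trig_polys n"
proof (induction j)
  case (Suc j)
  have "(\<lambda>x. (g x - (defect L n ^^ j) g x) + conv L n ((defect L n ^^ j) g) x) \<in> trig_polys n"
    using assms by (intro trig_polys_add Suc conv_in_trig_polys) auto
  moreover have "(\<lambda>x. g x - (defect L n ^^ Suc j) g x)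
      = (\<lambda>x. (g x - (defect L n ^^ j) g x) + conv L n ((defect L n ^^ j) g) x)"
    by (simp add: defect_def[of L n "(defect L n ^^ j) g"] fun_eq_iff)
  ultimately show ?case by simp
qed (auto intro: trig_polys_zero)

lemma defect_eq_integral:
  assumes g: "g \<in> L1" and n: "n \<ge> 1"
  shows "defect L n g x = (LINT u|circ. avg_kernel L n (- u) * diff1 u g x)"
    and "integrable circ (\<lambda>u. avg_kernel L n (- u) * diff1 u g x)"
proof -
  note [measurable] = L1_measurable[OF g]
  have sh: "conv L n g x = (LINT u|circ. g (u + x) * avg_kernel L n (x - (u + x)))"
    unfolding conv_def
  proof (rule integral_circ_shift[symmetric])
    fix y
    show "g (y + 2 * pi) * avg_kernel L n (x - (y + 2 * pi)) = g y * avg_kernel L n (x - y)"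
      using periodic_borel_periodic[of g y] g by (simp only: L1_periodic_borel periodic_borel_reflect[OF avg_kernel_periodic_borel])
  qed simp
  have i1: "integrable circ (\<lambda>u. g (u + x) * avg_kernel L n (0 - u))"
    by (rule integrable_conv[of "\<lambda>u. g (u + x)"]) (use g in simp)
  have i2: "integrable circ (\<lambda>u. avg_kernel L n (- u) * g x)"
    using L1_integrable[OF trig_polys_L1[OF trig_polys_reflect[OF avg_kernel_in_trig_polys[of L n], of 0]]]
    by auto
  have eq: "avg_kernel L n (- u) * diff1 u g x = avg_kernel L n (- u) * g x - g (u + x) * avg_kernel L n (0 - u)" for u
    by (simp add: diff1_def algebra_simps)
  show "integrable circ (\<lambda>u. avg_kernel L n (- u) * diff1 u g x)"
    unfolding eq using i1 i2 by (rule Bochner_Integration.integrable_diff[rotated])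
  have "(LINT u|circ. avg_kernel L n (- u) * diff1 u g x) = g x * (LINT u|circ. avg_kernel L n (0 - u)) - conv L n g x"
    unfolding eq sh using i1 i2 by (simp add: mult.commute)
  then show "defect L n g x = (LINT u|circ. avg_kernel L n (- u) * diff1 u g x)"
    by (simp add: integral_avg_kernel[OF n, of L 0, simplified] defect_def)
qed

lemma norm_defect_le:
  assumes g: "g \<in> L1" and n: "n \<ge> 1"
  shows "ennreal (norm (defect L n g x)) \<le> (\<integral>\<^sup>+u. ennreal (norm (avg_kernel L n (- u)) * norm (diff1 u g x)) \<partial>circ)"
  unfolding defect_eq_integral(1)[OF assms]
  using integral_norm_bound_ennreal[OF defect_eq_integral(2)[OF assms, of L x]] by (simp add: norm_mult)

text \<open>The decay exponent \<open>L\<close> pays for the growth of \<open>\<parallel>\<Delta>\<^sub>u g\<parallel>\<close> in \<open>n \<bar>u\<bar>\<close>.\<close>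

lemma avg_kernel_moment:
  assumes L: "real L \<ge> e + 2" "e \<ge> 0" and n: "n \<ge> 1"
  shows "(\<integral>\<^sup>+u. ennreal (norm (avg_kernel L n (- u)) * (1 + real n * \<bar>u\<bar>) powr e) \<partial>circ)
     \<le> ennreal (2 * (1 + 8 * real L) ^ L)"
proof -
  define B where "B = 2 * (1 + 8 * real L) ^ L"
  have L1: "L \<ge> 1" using L by linarith
  have B: "B \<ge> 0" by (simp add: B_def)
  have "(\<integral>\<^sup>+u. ennreal (norm (avg_kernel L n (- u)) * (1 + real n * \<bar>u\<bar>) powr e) \<partial>circ)
      \<le> (\<integral>\<^sup>+u. ennreal (B * real n) * ennreal ((1 + real n * \<bar>u\<bar>) powr (- (real L - e))) \<partial>circ)"
  proof (rule nn_integral_mono_AE, rule AE_circ)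
    fix u assume u: "u \<in> {- pi..<pi}"
    have "norm (avg_kernel L n (- u)) * (1 + real n * \<bar>u\<bar>) powr e
       \<le> (B * (real n * (1 + real n * \<bar>u\<bar>) powr (- real L))) * (1 + real n * \<bar>u\<bar>) powr e"
      unfolding B_def using norm_avg_kernel_le[of "- u" L n] u L1 n by (intro mult_right_mono) auto
    also have "\<dots> = B * real n * (1 + real n * \<bar>u\<bar>) powr (- (real L - e))"
      by (simp add: powr_add[symmetric] mult.assoc)
    finally show "ennreal (norm (avg_kernel L n (- u)) * (1 + real n * \<bar>u\<bar>) powr e)
       \<le> ennreal (B * real n) * ennreal ((1 + real n * \<bar>u\<bar>) powr (- (real L - e)))"
      using B by (subst ennreal_mult[symmetric]) (auto intro: ennreal_leI)
  qed
  also have "\<dots> = ennreal (B * real n) * (\<integral>\<^sup>+u. ennreal ((1 + real n * \<bar>u\<bar>) powr (- (real L - e))) \<partial>circ)"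
    by (rule nn_integral_cmult) simp
  also have "\<dots> \<le> ennreal (B * real n) * ennreal (1 / real n)"
    using L n by (intro mult_left_mono nn_integral_decay) auto
  also have "\<dots> = ennreal B"
    using n B by (simp flip: ennreal_mult)
  finally show ?thesis by (simp add: B_def)
qed

interpretation circ_pair: pair_sigma_finite circ circ ..

text \<open>The range \<open>1 \<le> p \<le> \<infinity>\<close>, where \<open>Lp_norm p\<close> satisfies the triangle inequality.\<close>

locale Lp_Banach =
  fixes p :: ennreal
  assumes one_le_p: "1 \<le> p"

sublocale Lp_Banach \<subseteq> shift_quasinorm "Lp_norm p" 1
  by (rule shift_quasinorm_Lp_norm[OF one_le_p])

context Lp_Banach
begin

lemma modulus_eq_osc: "modulus m f t p = osc m f t"
  by (simp add: modulus_def osc_def)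

lemma enn2real_p_ge_1: "p \<noteq> \<infinity> \<Longrightarrow> enn2real p \<ge> 1"
  using one_le_p by (cases p) (auto simp: ennreal_le_iff2 simp flip: ennreal_1)

lemma Lp_norm_finite_L1:
  assumes f: "f \<in> periodic_borel" and fin: "Lp_norm p f < \<infinity>"
  shows "f \<in> L1"
proof -
  note [measurable] = periodic_borel_measurable[OF f]
  have "integrable circ f"
  proof (cases "p = \<infinity>")
    case True
    have "(SUP x. ennreal (norm (f x))) < \<infinity>" using fin True by (simp add: Lp_norm_def)
    then obtain B where B: "B \<ge> 0" "(SUP x. ennreal (norm (f x))) = ennreal B"
      by (cases "SUP x. ennreal (norm (f x))") auto
    have "ennreal (norm (f x)) \<le> ennreal B" for x
      unfolding B(2)[symmetric] by (rule SUP_upper) simp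
    then show ?thesis using B by (intro integrable_circ_bounded[where B = B]) auto
  next
    case False
    define P where "P = enn2real p"
    have P: "P \<ge> 1" using enn2real_p_ge_1[OF False] by (simp add: P_def)
    have "pmean P f < \<infinity>"
      using fin Lp_norm_eq_pmean[OF f False] by (simp add: P_def)
    moreover have "(\<integral>\<^sup>+x. ennreal (norm (f x)) \<partial>circ) \<le> (\<integral>\<^sup>+x. 1 + ennreal (norm (f x) powr P) \<partial>circ)"
    proof (rule nn_integral_mono)
      fix x
      have "norm (f x) \<le> 1 + norm (f x) powr P"
      proof (cases "norm (f x) \<le> 1")
        case False
        then have "norm (f x) powr 1 \<le> norm (f x) powr P" using P by (intro powr_mono) auto
        then show ?thesis using False by simp
      qed (simp add: add_increasing2)
      then show "ennreal (norm (f x)) \<le> 1 + ennreal (norm (f x) powr P)"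
        by (simp flip: ennreal_plus ennreal_1)
    qed
    moreover have "(\<integral>\<^sup>+x. 1 + ennreal (norm (f x) powr P) \<partial>circ) = 1 + pmean P f"
      unfolding pmean_def by (subst nn_integral_add) auto
    ultimately have "(\<integral>\<^sup>+x. ennreal (norm (f x)) \<partial>circ) < \<infinity>"
      by (auto simp: less_top[symmetric] top_unique)
    then show ?thesis by (intro integrableI_bounded) auto
  qed
  with f show ?thesis by (rule L1I)
qed

lemma defect_le_osc:
  assumes g: "g \<in> L1" and n: "n \<ge> 1" and L: "real L \<ge> (if p = \<infinity> then 1 else enn2real p) + 2"
  shows "Lp_norm p (defect L n g) \<le> ennreal (2 * (1 + 8 * real L) ^ L) * osc 1 g (1 / real n)"
proof -
  note [measurable] = L1_measurable[OF g]
  define c where "c = 2 * (1 + 8 * real L) ^ L"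
  have c: "c > 0" by (simp add: c_def add_pos_nonneg)
  define \<Omega> where "\<Omega> = osc 1 g (1 / real n)"
  have diff: "Lp_norm p (diff1 u g) \<le> ennreal (1 + real n * \<bar>u\<bar>) * \<Omega>" for u
    using diff1_osc[of g "1 / real n" u] g n by (simp add: \<Omega>_def mult.commute)
  show ?thesis unfolding c_def[symmetric] \<Omega>_def[symmetric]
  proof (cases "p = \<infinity>")
    case True
    have "ennreal (norm (defect L n g x)) \<le> ennreal c * \<Omega>" for x
    proof -
      have "ennreal (norm (defect L n g x)) \<le> (\<integral>\<^sup>+u. ennreal (norm (avg_kernel L n (- u)) * norm (diff1 u g x)) \<partial>circ)"
        by (rule norm_defect_le[OF g n])
      also have "\<dots> \<le> (\<integral>\<^sup>+u. ennreal (norm (avg_kernel L n (- u)) * (1 + real n * \<bar>u\<bar>) powr 1) * \<Omega> \<partial>circ)"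
      proof (rule nn_integral_mono)
        fix u
        have "ennreal (norm (diff1 u g x)) \<le> Lp_norm p (diff1 u g)"
          using True by (auto simp: Lp_norm_def intro: SUP_upper)
        also note diff
        finally have "ennreal (norm (avg_kernel L n (- u))) * ennreal (norm (diff1 u g x))
            \<le> ennreal (norm (avg_kernel L n (- u))) * (ennreal (1 + real n * \<bar>u\<bar>) * \<Omega>)"
          by (rule mult_left_mono) simp
        then show "ennreal (norm (avg_kernel L n (- u)) * norm (diff1 u g x))
            \<le> ennreal (norm (avg_kernel L n (- u)) * (1 + real n * \<bar>u\<bar>) powr 1) * \<Omega>"
          by (simp add: ennreal_mult mult.assoc)
      qed
      also have "\<dots> = (\<integral>\<^sup>+u. ennreal (norm (avg_kernel L n (- u)) * (1 + real n * \<bar>u\<bar>) powr 1) \<partial>circ) * \<Omega>"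
        by (rule nn_integral_multc) simp
      also have "\<dots> \<le> ennreal c * \<Omega>"
        unfolding c_def using True L n by (intro mult_right_mono avg_kernel_moment) auto
      finally show ?thesis .
    qed
    then show "Lp_norm p (defect L n g) \<le> ennreal c * \<Omega>"
      using True by (auto simp: Lp_norm_def intro: SUP_least)
  next
    case False
    define P where "P = enn2real p"
    have P: "P \<ge> 1" using enn2real_p_ge_1[OF False] by (simp add: P_def)
    have LP: "real L \<ge> P + 2" using L False by (simp add: P_def)
    note nrm = Lp_norm_eq_pmean[OF _ False, folded P_def]
    have pm: "pmean P (diff1 u g) \<le> ennreal ((1 + real n * \<bar>u\<bar>) powr P) * ennpowr \<Omega> P" for u
    proof -
      have "pmean P (diff1 u g) = ennpowr (Lp_norm p (diff1 u g)) P"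
        using P g by (simp add: nrm ennpowr_ennpowr)
      also have "\<dots> \<le> ennpowr (ennreal (1 + real n * \<bar>u\<bar>) * \<Omega>) P"
        using P by (intro ennpowr_mono diff) auto
      also have "\<dots> = ennreal ((1 + real n * \<bar>u\<bar>) powr P) * ennpowr \<Omega> P"
      proof -
        have "1 + real n * \<bar>u\<bar> \<ge> 0" by simp
        moreover have "P > 0" using P by simp
        ultimately show ?thesis by (simp only: ennpowr_mult ennpowr_ennreal)
      qed
      finally show ?thesis .
    qed
    have pt: "ennreal (norm (defect L n g x) powr P) \<le> ennreal (c powr (P - 1)) *
        (\<integral>\<^sup>+u. ennreal (norm (avg_kernel L n (- u)) * norm (diff1 u g x) powr P) \<partial>circ)" for x
    proof (rule powr_nn_integral_le)
      show "(\<lambda>u. norm (diff1 u g x)) \<in> borel_measurable circ" by (simp add: diff1_def)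
      have "(\<integral>\<^sup>+u. ennreal (norm (avg_kernel L n (- u))) \<partial>circ)
          = (\<integral>\<^sup>+u. ennreal (norm (avg_kernel L n (- u)) * (1 + real n * \<bar>u\<bar>) powr 0) \<partial>circ)"
      proof -
        have "1 + real n * \<bar>u\<bar> \<noteq> 0" for u by (smt (verit) abs_ge_zero mult_nonneg_nonneg of_nat_0_le_iff)
        then show ?thesis by simp
      qed
      also have "\<dots> \<le> ennreal c" unfolding c_def using LP P n by (intro avg_kernel_moment) auto
      finally show "(\<integral>\<^sup>+u. ennreal (norm (avg_kernel L n (- u))) \<partial>circ) \<le> ennreal c" .
    qed (use norm_defect_le[OF g n] c P in auto)
    have "pmean P (defect L n g) \<le> (\<integral>\<^sup>+x. ennreal (c powr (P - 1)) *
        (\<integral>\<^sup>+u. ennreal (norm (avg_kernel L n (- u)) * norm (diff1 u g x) powr P) \<partial>circ) \<partial>circ)"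
      unfolding pmean_def by (rule nn_integral_mono[OF pt])
    also have "\<dots> = ennreal (c powr (P - 1)) *
        (\<integral>\<^sup>+x. (\<integral>\<^sup>+u. ennreal (norm (avg_kernel L n (- u)) * norm (diff1 u g x) powr P) \<partial>circ) \<partial>circ)"
      unfolding diff1_def by (rule nn_integral_cmult) measurable
    also have "(\<integral>\<^sup>+x. (\<integral>\<^sup>+u. ennreal (norm (avg_kernel L n (- u)) * norm (diff1 u g x) powr P) \<partial>circ) \<partial>circ)
        = (\<integral>\<^sup>+u. (\<integral>\<^sup>+x. ennreal (norm (avg_kernel L n (- u)) * norm (diff1 u g x) powr P) \<partial>circ) \<partial>circ)"
      unfolding diff1_def by (rule circ_pair.Fubini') measurable
    also have "\<dots> = (\<integral>\<^sup>+u. ennreal (norm (avg_kernel L n (- u))) * pmean P (diff1 u g) \<partial>circ)"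
      unfolding pmean_def by (simp add: ennreal_mult diff1_def nn_integral_cmult)
    also have "\<dots> \<le> (\<integral>\<^sup>+u. ennreal (norm (avg_kernel L n (- u)) * (1 + real n * \<bar>u\<bar>) powr P) * ennpowr \<Omega> P \<partial>circ)"
    proof (rule nn_integral_mono)
      fix u
      show "ennreal (norm (avg_kernel L n (- u))) * pmean P (diff1 u g)
          \<le> ennreal (norm (avg_kernel L n (- u)) * (1 + real n * \<bar>u\<bar>) powr P) * ennpowr \<Omega> P"
        using mult_left_mono[OF pm[of u], of "ennreal (norm (avg_kernel L n (- u)))"]
        by (simp add: ennreal_mult mult.assoc)
    qed
    also have "\<dots> = (\<integral>\<^sup>+u. ennreal (norm (avg_kernel L n (- u)) * (1 + real n * \<bar>u\<bar>) powr P) \<partial>circ) * ennpowr \<Omega> P"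
      by (rule nn_integral_multc) simp
    also have "\<dots> \<le> ennreal c * ennpowr \<Omega> P"
      unfolding c_def using LP P n by (intro mult_right_mono avg_kernel_moment) auto
    finally have "pmean P (defect L n g) \<le> ennreal (c powr (P - 1)) * (ennreal c * ennpowr \<Omega> P)"
      by (simp add: mult_left_mono)
    also have "\<dots> = ennreal (c powr P) * ennpowr \<Omega> P"
      using c by (simp add: powr_diff mult.assoc[symmetric] flip: ennreal_mult)
    finally have "Lp_norm p (defect L n g) \<le> ennpowr (ennreal (c powr P) * ennpowr \<Omega> P) (1/P)"
      using g P by (simp add: nrm ennpowr_mono)
    also have "\<dots> = ennreal c * \<Omega>"
      using c P by (simp add: ennpowr_mult ennpowr_ennreal ennpowr_ennpowr powr_powr)
    finally show "Lp_norm p (defect L n g) \<le> ennreal c * \<Omega>" .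
  qed
qed


lemma defect_pow_le_mdiff:
  assumes n: "n \<ge> 1" and L: "real L \<ge> (if p = \<infinity> then 1 else enn2real p) + 2"
    and g: "g \<in> L1"
    and X: "\<And>u. (\<And>i. 0 < u i \<and> u i < 1 / real n) \<Longrightarrow> Lp_norm p (mdiff j u g) \<le> X"
  shows "Lp_norm p ((defect L n ^^ j) g) \<le> ennreal (2 * (1 + 8 * real L) ^ L) ^ j * X"
  using g X
proof (induction j arbitrary: g)
  case 0
  have "0 < 1 / (2 * real n) \<and> 1 / (2 * real n) < 1 / real n"
    using n by (simp add: field_simps)
  with "0.prems"(2)[of "\<lambda>_. 1 / (2 * real n)"] show ?case by simp
next
  case (Suc j)
  define c where "c = ennreal (2 * (1 + 8 * real L) ^ L)"
  have "Lp_norm p ((defect L n ^^ Suc j) g) \<le> c * osc 1 ((defect L n ^^ j) g) (1 / real n)"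
    unfolding c_def using defect_le_osc[OF _ n L, of "(defect L n ^^ j) g"] Suc.prems(1) by simp
  also have "osc 1 ((defect L n ^^ j) g) (1 / real n) \<le> c ^ j * X"
    unfolding osc_def
  proof (rule SUP_least)
    fix v assume v: "v \<in> {0<..<1 / real n}"
    have "Lp_norm p ((defect L n ^^ j) (diff1 v g)) \<le> c ^ j * X"
      unfolding c_def
    proof (rule Suc.IH)
      show "diff1 v g \<in> L1" using Suc.prems(1) by simp
      fix u :: "nat \<Rightarrow> real" assume u: "\<And>i. 0 < u i \<and> u i < 1 / real n"
      have "mdiff j u (diff1 v g) = mdiff (Suc j) (u(Suc j := v)) g"
        by (simp add: diff1_mdiff_commute) (rule mdiff_cong, simp)
      moreover have "Lp_norm p (mdiff (Suc j) (u(Suc j := v)) g) \<le> X"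
        by (rule Suc.prems(2)) (use u v in auto)
      ultimately show "Lp_norm p (mdiff j u (diff1 v g)) \<le> X" by (simp only:)
    qed
    then show "Lp_norm p (fdiff 1 v ((defect L n ^^ j) g)) \<le> c ^ j * X"
      using Suc.prems(1) by (simp add: fdiff_1[simplified] diff1_defect_pow)
  qed
  finally show ?case by (simp add: c_def mult.assoc mult_left_mono)
qed

text \<open>One polynomial approximates \<open>f\<close> and, simultaneously, all its differences: \<open>defect\<close> commutes with
  \<open>fdiff j h\<close>.\<close>

lemma jackson:
  assumes m: "m \<ge> 1"
  shows "\<exists>C>0. \<forall>n\<ge>1. \<forall>f\<in>L1. \<exists>T\<in>trig_polys n. \<forall>j h.
    Lp_norm p (fdiff j h (\<lambda>x. f x - T x)) \<le> ennreal C * osc m (fdiff j h f) (1 / real n)"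
proof -
  define L where "L = nat \<lceil>(if p = \<infinity> then 1 else enn2real p) + 2\<rceil>"
  have L: "real L \<ge> (if p = \<infinity> then 1 else enn2real p) + 2"
    unfolding L_def by linarith
  define c where "c = 2 * (1 + 8 * real L) ^ L"
  have c: "c > 0" by (simp add: c_def add_pos_nonneg)
  define C where "C = c ^ m * 2 ^ (m + m * m)"
  have le: "Lp_norm p ((defect L n ^^ m) g) \<le> ennreal C * osc m g (1 / real n)"
    if g: "g \<in> L1" and n: "n \<ge> 1" for g n
  proof -
    have "Lp_norm p ((defect L n ^^ m) g) \<le> ennreal c ^ m * (2 ^ (m + m * m) * osc m g (1 / real n))"
      unfolding c_def
    proof (rule defect_pow_le_mdiff[OF n L g])
      fix u :: "nat \<Rightarrow> real" assume u: "\<And>i. 0 < u i \<and> u i < 1 / real n"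
      show "Lp_norm p (mdiff m u g) \<le> 2 ^ (m + m * m) * osc m g (1 / real n)"
        by (rule mdiff_osc) (use u[THEN conjunct1] u[THEN conjunct2] g m n in \<open>auto simp: less_imp_le abs_of_pos\<close>)
    qed
    also have "ennreal c ^ m * (2 ^ (m + m * m) * osc m g (1 / real n)) = ennreal C * osc m g (1 / real n)"
    proof -
      have "(2::ennreal) ^ (m + m * m) = ennreal (2 ^ (m + m * m))"
        by (simp flip: ennreal_power)
      then show ?thesis using c by (simp add: C_def ennreal_mult ennreal_power mult.assoc)
    qed
    finally show ?thesis .
  qed
  have "C > 0" using c by (simp add: C_def)
  moreover have "\<exists>T\<in>trig_polys n. \<forall>j h.
    Lp_norm p (fdiff j h (\<lambda>x. f x - T x)) \<le> ennreal C * osc m (fdiff j h f) (1 / real n)"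
    if n: "n \<ge> 1" and f: "f \<in> L1" for n f
  proof (intro bexI allI)
    let ?T = "\<lambda>x. f x - (defect L n ^^ m) f x"
    show "?T \<in> trig_polys n" by (rule defect_pow_trig_polys[OF f])
    fix j h
    have "fdiff j h (\<lambda>x. f x - ?T x) = (defect L n ^^ m) (fdiff j h f)"
      using f by (simp add: fdiff_defect_pow)
    then show "Lp_norm p (fdiff j h (\<lambda>x. f x - ?T x)) \<le> ennreal C * osc m (fdiff j h f) (1 / real n)"
      using le[OF _ n, of "fdiff j h f"] f by simp
  qed
  ultimately show ?thesis by blast
qed

lemma osc_le_psi:
  assumes f: "f \<in> periodic_borel" and n: "n \<ge> 1" and k: "k \<ge> 1" and \<alpha>: "\<alpha> > 0"
  shows "osc (r + k) f (1 / real n) \<le> ennreal (real n powr - \<alpha>) * psi_modulus k r \<alpha> f (1 / real n) p"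
  unfolding osc_def
proof (rule SUP_least)
  let ?\<psi> = "psi_modulus k r \<alpha> f (1 / real n) p"
  fix v assume v: "v \<in> {0<..<1 / real n}"
  have "Lp_norm p (fdiff (r + k) v f) \<le> osc k (fdiff r v f) (1 / real n)"
    using v f k by (simp add: fdiff_add[of r k] fdiff_commute[of r v k v] fdiff_osc)
  also have "\<dots> = ennreal (v powr \<alpha>) * (ennreal (v powr - \<alpha>) * osc k (fdiff r v f) (1 / real n))"
    using v by (simp add: mult.assoc[symmetric] powr_minus flip: ennreal_mult)
  also have "\<dots> \<le> ennreal (v powr \<alpha>) * ?\<psi>"
    unfolding psi_modulus_def modulus_eq_osc
    using v by (intro mult_left_mono SUP_upper) auto
  also have "\<dots> \<le> ennreal (real n powr - \<alpha>) * ?\<psi>"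
  proof (intro mult_right_mono ennreal_leI)
    have "v powr \<alpha> \<le> (1 / real n) powr \<alpha>"
      using v \<alpha> by (intro powr_mono2) auto
    then show "v powr \<alpha> \<le> real n powr - \<alpha>"
      using n by (simp add: powr_divide powr_minus_divide)
  qed simp
  finally show "Lp_norm p (fdiff (r + k) v f) \<le> ennreal (real n powr - \<alpha>) * ?\<psi>" .
qed

lemma best_approx_le_psi:
  assumes k: "k \<ge> 1" and \<alpha>: "\<alpha> > 0"
  shows "\<exists>C>0. \<forall>n\<ge>1. \<forall>f\<in>L1.
    best_approx_H n p r \<alpha> f \<le> ennreal C * psi_modulus k r \<alpha> f (1 / real n) p"
proof -
  obtain C where C: "C > 0" and J: "\<And>n f. n \<ge> 1 \<Longrightarrow> f \<in> L1 \<Longrightarrow> \<exists>T\<in>trig_polys n. \<forall>j h.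
    Lp_norm p (fdiff j h (\<lambda>x. f x - T x)) \<le> ennreal C * osc (r + k) (fdiff j h f) (1 / real n)"
    using jackson[of "r + k"] k by (metis trans_le_add2)
  have "best_approx_H n p r \<alpha> f \<le> ennreal (C + 2 ^ r * C) * psi_modulus k r \<alpha> f (1 / real n) p"
    if n: "n \<ge> 1" and f: "f \<in> L1" for n f
  proof -
    let ?\<psi> = "psi_modulus k r \<alpha> f (1 / real n) p"
    obtain T where T: "T \<in> trig_polys n" and J': "\<And>j h. Lp_norm p (fdiff j h (\<lambda>x. f x - T x))
        \<le> ennreal C * osc (r + k) (fdiff j h f) (1 / real n)"
      using J[OF n f] by blast
    have fT: "(\<lambda>x. f x - T x) \<in> periodic_borel"
      using f trig_polys_periodic_borel[OF T] by simp
    have e2: "(2::ennreal) ^ r * ennreal C = ennreal (2 ^ r * C)"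
      using C by (simp add: ennreal_mult flip: ennreal_power)
    have base: "Lp_norm p (\<lambda>x. f x - T x) \<le> ennreal C * (ennreal (real n powr - \<alpha>) * ?\<psi>)"
      using J'[of 0 0] mult_left_mono[OF osc_le_psi[OF L1_periodic_borel[OF f] n k \<alpha>, of r], of "ennreal C"]
      by simp
    have "real n powr - \<alpha> \<le> 1"
      using n \<alpha> by (simp add: powr_minus_divide ge_one_powr_ge_zero)
    then have "ennreal (real n powr - \<alpha>) * ?\<psi> \<le> 1 * ?\<psi>"
      by (intro mult_right_mono) auto
    from mult_left_mono[OF this, of "ennreal C"]
    have N: "Lp_norm p (\<lambda>x. f x - T x) \<le> ennreal C * ?\<psi>"
      using base by (auto intro: order_trans)
    have S: "H_seminorm p r \<alpha> (\<lambda>x. f x - T x) \<le> ennreal (2 ^ r * C) * ?\<psi>"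
      unfolding H_seminorm_def
    proof (rule SUP_least)
      fix h :: real assume "h \<in> {0<..}"
      then have h: "h > 0" by simp
      show "ennreal (h powr - \<alpha>) * Lp_norm p (fdiff r h (\<lambda>x. f x - T x)) \<le> ennreal (2 ^ r * C) * ?\<psi>"
      proof (cases "h \<le> 1 / real n")
        case True
        have "osc (r + k) (fdiff r h f) (1 / real n) \<le> 2 ^ r * osc k (fdiff r h f) (1 / real n)"
          unfolding osc_def[of "r + k"]
        proof (rule SUP_least)
          fix v assume v: "v \<in> {0<..<1 / real n}"
          have "Lp_norm p (fdiff (r + k) v (fdiff r h f)) \<le> 2 ^ r * Lp_norm p (fdiff k v (fdiff r h f))"
            unfolding fdiff_add using f by (intro fdiff_le) auto
          also have "\<dots> \<le> 2 ^ r * osc k (fdiff r h f) (1 / real n)"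
            using v f k by (intro mult_left_mono fdiff_osc) auto
          finally show "Lp_norm p (fdiff (r + k) v (fdiff r h f)) \<le> 2 ^ r * osc k (fdiff r h f) (1 / real n)" .
        qed
        then have "Lp_norm p (fdiff r h (\<lambda>x. f x - T x))
            \<le> ennreal C * (2 ^ r * osc k (fdiff r h f) (1 / real n))"
          using J'[of r h] by (meson mult_left_mono order_trans zero_le)
        then have "ennreal (h powr - \<alpha>) * Lp_norm p (fdiff r h (\<lambda>x. f x - T x))
            \<le> ennreal (h powr - \<alpha>) * (ennreal C * (2 ^ r * osc k (fdiff r h f) (1 / real n)))"
          by (rule mult_left_mono) simp
        also have "\<dots> = ennreal (2 ^ r * C) * (ennreal (h powr - \<alpha>) * osc k (fdiff r h f) (1 / real n))"
          unfolding e2[symmetric] by (simp add: mult_ac)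
        also have "\<dots> \<le> ennreal (2 ^ r * C) * ?\<psi>"
          unfolding psi_modulus_def modulus_eq_osc
          using h True by (intro mult_left_mono SUP_upper) auto
        finally show ?thesis .
      next
        case False
        have nh: "h powr - \<alpha> \<le> real n powr \<alpha>"
        proof -
          have "h powr - \<alpha> \<le> (1 / real n) powr - \<alpha>"
            using False n \<alpha> by (intro powr_mono2') auto
          then show ?thesis using n by (simp add: powr_divide powr_minus_divide)
        qed
        have "Lp_norm p (fdiff r h (\<lambda>x. f x - T x)) \<le> 2 ^ r * Lp_norm p (\<lambda>x. f x - T x)"
          by (rule fdiff_le[OF fT])
        also have "\<dots> \<le> 2 ^ r * (ennreal C * (ennreal (real n powr - \<alpha>) * ?\<psi>))"
          by (intro mult_left_mono base) simp
        finally have "ennreal (h powr - \<alpha>) * Lp_norm p (fdiff r h (\<lambda>x. f x - T x))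
            \<le> ennreal (real n powr \<alpha>) * (2 ^ r * (ennreal C * (ennreal (real n powr - \<alpha>) * ?\<psi>)))"
          using nh by (intro mult_mono ennreal_leI) auto
        also have "\<dots> = (ennreal (real n powr \<alpha>) * ennreal (real n powr - \<alpha>)) * (ennreal (2 ^ r * C) * ?\<psi>)"
          unfolding e2[symmetric] by (simp add: mult_ac)
        also have "ennreal (real n powr \<alpha>) * ennreal (real n powr - \<alpha>) = 1"
          using n by (simp add: powr_minus flip: ennreal_mult)
        finally show ?thesis by simp
      qed
    qed
    have "best_approx_H n p r \<alpha> f \<le> H_norm p r \<alpha> (\<lambda>x. f x - T x)"
      unfolding best_approx_H_def by (rule INF_lower) (rule T)
    also have "\<dots> \<le> ennreal C * ?\<psi> + ennreal (2 ^ r * C) * ?\<psi>"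
      unfolding H_norm_def by (intro add_mono N S)
    also have "\<dots> = ennreal (C + 2 ^ r * C) * ?\<psi>"
      using C by (simp add: distrib_right ennreal_plus)
    finally show ?thesis .
  qed
  moreover have "C + 2 ^ r * C > 0" using C by (simp add: add_pos_nonneg)
  ultimately show ?thesis by blast
qed

end


section \<open>Dyadic sums and the Marchaud ladder\<close>

lemma divide_ennreal_powr:
  assumes "t > 0" shows "x / ennreal (t powr a) = x * ennreal (t powr - a)"
proof -
  have "inverse (ennreal (t powr a)) = ennreal (inverse (t powr a))"
    using assms by (intro inverse_ennreal) simp
  then show ?thesis by (simp only: divide_ennreal_def powr_minus)
qed

text \<open>On \<open>[b/2\<^sup>i\<^sup>+\<^sup>1, b/2\<^sup>i)\<close> the integrand is bounded below by a constant. Comparing with the resulting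
  step function avoids any measurability assumption on \<open>w\<close>.\<close>

lemma dyadic_sum_le_nn_integral:
  fixes w :: "real \<Rightarrow> ennreal"
  assumes w: "\<And>s t. s \<le> t \<Longrightarrow> w s \<le> w t" and b: "b > 0" and q: "q > 0" and \<alpha>: "\<alpha> > 0"
  shows "(\<Sum>i<J. ennreal ((b / 2^i) powr (- \<alpha> * q)) * ennpowr (w (b / 2 ^ Suc i)) q)
    \<le> 2 * (\<integral>\<^sup>+t\<in>{0<..<b}. ennpowr (w t / ennreal (t powr \<alpha>)) q * ennreal (1 / t) \<partial>lborel)"
proof -
  define c where "c i = ennreal ((b / 2^i) powr (- \<alpha> * q)) * ennpowr (w (b / 2 ^ Suc i)) q" for i
  define A where "A i = {b / 2 ^ Suc i..<b / 2^i}" for i :: nat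
  define F where "F t = ennpowr (w t / ennreal (t powr \<alpha>)) q * ennreal (1 / t) * indicator {0<..<b} t" for t
  have disj: "i = j" if "t \<in> A i" "t \<in> A j" for i j t
  proof -
    have *: "\<not> i < j" if "t \<in> A i" "t \<in> A j" for i j
    proof
      assume "i < j"
      then have "b / 2^j \<le> b / 2 ^ Suc i"
        using b by (intro divide_left_mono power_increasing) auto
      with that show False by (auto simp: A_def)
    qed
    then show ?thesis using that by (meson linorder_neqE_nat)
  qed
  have le: "c i * ennreal (2^i / b) \<le> F t" if t: "t \<in> A i" for i t
  proof -
    have pos: "t > 0" "t < b / 2^i" "b / 2 ^ Suc i \<le> t"
    proof -
      have "0 < b / 2 ^ Suc i" using b by simp
      then show "t > 0" using t unfolding A_def atLeastLessThan_iff by linarith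
    qed (use t in \<open>auto simp: A_def\<close>)
    have "b / 2^i \<le> b" using b by (simp add: field_simps)
    then have tb: "t < b" using pos by linarith
    have "c i * ennreal (2^i / b) \<le> (ennreal (t powr (- \<alpha> * q)) * ennpowr (w t) q) * ennreal (1 / t)"
      unfolding c_def
    proof (intro mult_mono ennreal_leI ennpowr_mono w q)
      show "(b / 2^i) powr (- \<alpha> * q) \<le> t powr (- \<alpha> * q)"
        using pos \<alpha> q by (intro powr_mono2') auto
      show "2^i / b \<le> 1 / t" using pos b by (simp add: field_simps)
    qed (use pos in auto)
    also have "\<dots> = F t"
      using pos tb q by (simp add: F_def divide_ennreal_powr ennpowr_mult ennpowr_ennreal powr_powr mult_ac)
    finally show ?thesis .
  qed
  have "(\<Sum>i<J. c i) = (\<Sum>i<J. 2 * (c i * ennreal (2^i / b) * emeasure lborel (A i)))"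
  proof (intro sum.cong refl)
    fix i
    have "emeasure lborel (A i) = ennreal (b / 2 ^ Suc i)"
      using b by (simp add: A_def field_simps)
    then have "ennreal (2^i / b) * emeasure lborel (A i) = ennreal (1/2)"
      using b by (simp flip: ennreal_mult)
    then have "2 * (c i * ennreal (2^i / b) * emeasure lborel (A i)) = c i * (2 * ennreal (1/2))"
      by (simp only: mult_ac)
    also have "2 * ennreal (1/2) = 1"
    proof -
      have "ennreal 2 * ennreal (1/2) = ennreal (2 * (1/2))" by (rule ennreal_mult[symmetric]) auto
      also have "2 * (1/2) = (1::real)" by simp
      finally show ?thesis by (simp only: ennreal_numeral ennreal_1 zero_le_numeral)
    qed
    finally show "c i = 2 * (c i * ennreal (2^i / b) * emeasure lborel (A i))" by simp
  qed
  also have "\<dots> = 2 * (\<integral>\<^sup>+t. (\<Sum>i<J. c i * ennreal (2^i / b) * indicator (A i) t) \<partial>lborel)"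
    by (subst nn_integral_sum) (auto simp: A_def nn_integral_cmult_indicator sum_distrib_left)
  also have "\<dots> \<le> 2 * (\<integral>\<^sup>+t. F t \<partial>lborel)"
  proof (intro mult_left_mono nn_integral_mono)
    fix t
    show "(\<Sum>i<J. c i * ennreal (2^i / b) * indicator (A i) t) \<le> F t"
    proof (cases "\<exists>i<J. t \<in> A i")
      case True
      then obtain i where i: "i < J" "t \<in> A i" by blast
      have z: "indicator (A j) t = (0::ennreal)" if "j \<noteq> i" for j
        by (metis disj i(2) that indicator_simps(2))
      have "(\<Sum>j<J. c j * ennreal (2^j / b) * indicator (A j) t)
          = (\<Sum>j\<in>{i}. c j * ennreal (2^j / b) * indicator (A j) t)"
        using i by (intro sum.mono_neutral_right) (auto simp: z)
      then show ?thesis using le[OF i(2)] i by simp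
    next
      case False
      then have "indicator (A i) t = (0::ennreal)" if "i < J" for i
        using that by (simp add: indicator_def)
      then have "(\<Sum>i<J. c i * ennreal (2^i / b) * indicator (A i) t) = 0"
        by (intro sum.neutral) simp
      then show ?thesis by (simp only: zero_le)
    qed
  qed simp
  finally show ?thesis by (simp add: c_def F_def mult.assoc)
qed

text \<open>The Marchaud ladder in abstract form: \<open>X s i\<close> stands for \<open>h\<^sub>i\<close> to the power \<open>-\<alpha>\<close> times the norm of a
  difference of order \<open>r + s\<close> with step \<open>h\<^sub>i = h\<^sub>0/2\<^sup>i\<close>. On the lowest rung \<open>s = 0\<close> there need not be any
  contraction, and one sums once; on the rungs \<open>1 \<le> s < k\<close> there is contraction by \<open>1/2\<close>, and the sums
  over \<open>i\<close> are bounded by those of the next rung.\<close>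

lemma ladder_sum:
  fixes X :: "nat \<Rightarrow> nat \<Rightarrow> ennreal"
  assumes k: "k \<ge> 1"
    and X0: "\<And>i. X 0 (Suc i) \<le> X 0 i + Q * X 1 (Suc i)"
    and X1: "\<And>s i. 1 \<le> s \<Longrightarrow> s < k \<Longrightarrow> 2 * X s (Suc i) \<le> X s i + Q * X (Suc s) (Suc i)"
    and E: "\<And>s. s \<le> k \<Longrightarrow> 2 * X s 0 \<le> E"
  shows "X 0 J \<le> (1 + Q) ^ k * (E + (\<Sum>i\<le>J. X k i))"
proof -
  define Z where "Z = E + (\<Sum>i\<le>J. X k i)"
  \<comment> \<open>The extra term \<open>X s J\<close> makes the induction work without subtraction, since values may be infinite.\<close>
  have step: "(\<Sum>i\<le>J. X s i) + X s J \<le> E + Q * (\<Sum>i\<le>J. X (Suc s) i)" if s: "1 \<le> s" "s < k" for s J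
  proof (induction J)
    case 0
    have "X s 0 + X s 0 \<le> E" using E[of s] s by (simp add: mult_2)
    then show ?case by (simp add: add_increasing2)
  next
    case (Suc J)
    have "(\<Sum>i\<le>Suc J. X s i) + X s (Suc J) = (\<Sum>i\<le>J. X s i) + 2 * X s (Suc J)"
      by (simp add: mult_2 add_ac)
    also have "\<dots> \<le> ((\<Sum>i\<le>J. X s i) + X s J) + Q * X (Suc s) (Suc J)"
      unfolding add.assoc by (rule add_left_mono[OF X1[OF s]])
    also have "\<dots> \<le> (E + Q * (\<Sum>i\<le>J. X (Suc s) i)) + Q * X (Suc s) (Suc J)"
      by (rule add_right_mono[OF Suc])
    also have "\<dots> = E + Q * (\<Sum>i\<le>Suc J. X (Suc s) i)"
      by (simp add: distrib_left add_ac)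
    finally show ?case .
  qed
  have sums: "(\<Sum>i\<le>J. X (k - d) i) \<le> (1 + Q) ^ d * Z" if "d < k" for d
    using that
  proof (induction d)
    case 0
    then show ?case by (simp add: Z_def)
  next
    case (Suc d)
    have s: "1 \<le> k - Suc d" "k - Suc d < k" "Suc (k - Suc d) = k - d" using Suc.prems by auto
    have one: "1 \<le> (1 + Q) ^ d" by (rule one_le_power) simp
    have "(\<Sum>i\<le>J. X (k - Suc d) i) \<le> (\<Sum>i\<le>J. X (k - Suc d) i) + X (k - Suc d) J" by simp
    also have "\<dots> \<le> E + Q * (\<Sum>i\<le>J. X (k - d) i)"
      using step[OF s(1,2), of J] s(3) by simp
    also have "\<dots> \<le> 1 * Z + Q * ((1 + Q) ^ d * Z)"
      using Suc by (intro add_mono mult_left_mono) (auto simp: Z_def)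
    also have "\<dots> \<le> (1 + Q) ^ d * Z + Q * ((1 + Q) ^ d * Z)"
      using one by (intro add_right_mono mult_right_mono) auto
    finally show ?case by (simp add: distrib_right mult.assoc)
  qed
  have "X 0 J \<le> X 0 0 + Q * (\<Sum>i\<le>J. X 1 i)"
  proof (induction J)
    case (Suc J)
    have "X 0 (Suc J) \<le> X 0 J + Q * X 1 (Suc J)" by (rule X0)
    also have "\<dots> \<le> (X 0 0 + Q * (\<Sum>i\<le>J. X 1 i)) + Q * X 1 (Suc J)"
      by (rule add_right_mono[OF Suc])
    finally show ?case by (simp add: distrib_left add_ac)
  qed simp
  also have "\<dots> \<le> 1 * Z + Q * ((1 + Q) ^ (k - 1) * Z)"
  proof (intro add_mono mult_left_mono)
    have "X 0 0 \<le> 2 * X 0 0" by (simp add: mult_2)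
    also have "\<dots> \<le> E" by (rule E) simp
    also have "\<dots> \<le> Z" by (simp add: Z_def)
    finally show "X 0 0 \<le> 1 * Z" by simp
    show "(\<Sum>i\<le>J. X 1 i) \<le> (1 + Q) ^ (k - 1) * Z"
      using sums[of "k - 1"] k by simp
  qed simp
  also have "\<dots> \<le> (1 + Q) ^ (k - 1) * Z + Q * ((1 + Q) ^ (k - 1) * Z)"
    by (intro add_right_mono mult_right_mono one_le_power) auto
  also have "\<dots> = (1 + Q) ^ Suc (k - 1) * Z"
    by (simp add: distrib_right mult.assoc)
  finally show ?thesis using k by (simp add: Z_def)
qed

context Lp_Banach
begin

lemma mixed_osc:
  assumes f: "f \<in> periodic_borel" and kr: "r + k \<ge> 1" and \<delta>: "\<delta> > 0" and "\<bar>u\<bar> \<le> \<delta>" "\<bar>h\<bar> \<le> \<delta>"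
  shows "Lp_norm p (fdiff r h (fdiff k u f)) \<le> 2 ^ ((r + k) + (r + k) * (r + k)) * osc (r + k) f \<delta>"
  unfolding mdiff_append[symmetric]
  by (rule mdiff_osc[OF f kr \<delta>]) (use assms in auto)

text \<open>Here \<open>g = \<Delta>\<^sub>u\<^sup>k f\<close> is fixed and the step \<open>h\<close> is doubled \<open>J\<close> times until it lies in
  \<open>[\<delta>/2, \<delta>]\<close>. The top rung \<open>s = k\<close> consists of differences of order \<open>m = r + k\<close> of \<open>f\<close> itself, and
  at the largest step mixed differences are bounded by \<open>mixed_osc\<close>.\<close>

lemma psi_le_modulus_integral:
  assumes k: "k \<ge> 1" and \<alpha>: "\<alpha> > 0" and \<alpha>r: "\<alpha> \<le> real r"
  shows "\<exists>C>0. \<forall>n\<ge>1. \<forall>f\<in>periodic_borel.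
    psi_modulus k r \<alpha> f (1 / real n) p \<le> ennreal C * modulus_integral (r + k) \<alpha> f (1 / real n) p 1"
proof -
  define m where "m = r + k"
  define K :: real where "K = 2 ^ (m + m * m)"
  define Q :: real where "Q = 2 ^ Suc m"
  define A where "A = 2 powr \<alpha> * 2 ^ (k + 2 * m)"
  define B where "B = 2 * (2 powr \<alpha> * 2 ^ k * K * 2 ^ m)"
  define C where "C = (1 + Q) ^ k * (B + A) * 2"
  have K: "K > 0" by (simp add: K_def)
  have AB: "A > 0" "B > 0" using K by (auto simp: A_def B_def)
  have Q: "Q > 0" by (simp add: Q_def)
  have C: "C > 0" using AB Q by (simp add: C_def add_pos_pos)
  have m1: "m \<ge> 1" using k by (simp add: m_def)
  have main: "ennreal (h powr - \<alpha>) * Lp_norm p (fdiff k u (fdiff r h f))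
      \<le> ennreal C * modulus_integral m \<alpha> f \<delta> p 1"
    if \<delta>: "\<delta> > 0" and f: "f \<in> periodic_borel" and h: "0 < h" "h \<le> \<delta>" and u: "0 < u" "u < \<delta>" for \<delta> f h u
  proof -
    define J where "J = nat \<lfloor>log 2 (\<delta> / h)\<rfloor>"
    define h0 where "h0 = h * 2 ^ J"
    have lg: "log 2 (\<delta> / h) \<ge> 0" using h by simp
    have J: "real J \<le> log 2 (\<delta> / h)" "log 2 (\<delta> / h) < real J + 1"
      using lg by (simp_all add: J_def)
    have "2 ^ J \<le> \<delta> / h"
    proof -
      have "(2::real) ^ J = 2 powr real J" by (simp add: powr_realpow)
      also have "\<dots> \<le> 2 powr log 2 (\<delta> / h)" using J by (intro powr_mono) auto
      also have "\<dots> = \<delta> / h" using h \<delta> by simp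
      finally show ?thesis .
    qed
    then have h0\<delta>: "h0 \<le> \<delta>" using h by (simp add: h0_def field_simps)
    have "\<delta> / h \<le> 2 ^ Suc J"
    proof -
      have "\<delta> / h = 2 powr log 2 (\<delta> / h)" using h \<delta> by simp
      also have "\<dots> \<le> 2 powr real (Suc J)" using J by (intro powr_mono) auto
      also have "\<dots> = 2 ^ Suc J" by (subst powr_realpow) auto
      finally show ?thesis .
    qed
    then have \<delta>h0: "\<delta> \<le> 2 * h0" using h by (simp add: h0_def field_simps)
    have h0: "h0 > 0" using h by (simp add: h0_def)
    define hh where "hh i = h0 / 2 ^ i" for i :: nat
    have hh: "hh i > 0" "hh i \<le> \<delta> / 2 ^ i" "\<delta> / 2 ^ i \<le> 2 * hh i" for i
      using h0 h0\<delta> \<delta>h0 by (auto simp: hh_def divide_right_mono)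
    have hh\<delta>: "hh i \<le> \<delta>" for i
      using hh(2)[of i] \<delta> by (smt (verit) divide_le_eq_1 field_sum_of_halves frac_le div_by_1 one_le_power)
    have hhS: "2 * hh (Suc i) = hh i" for i by (simp add: hh_def)
    have hhpow: "hh i powr - \<alpha> \<le> 2 powr \<alpha> * (\<delta> / 2 ^ i) powr - \<alpha>" for i
    proof -
      have "hh i powr - \<alpha> \<le> (\<delta> / 2 ^ i / 2) powr - \<alpha>"
        using hh[of i] \<delta> \<alpha> by (intro powr_mono2') auto
      also have "\<dots> = 2 powr \<alpha> * (\<delta> / 2 ^ i) powr - \<alpha>"
        using \<delta> by (simp add: powr_divide powr_minus_divide powr_mult)
      finally show ?thesis .
    qed
    define g where "g = fdiff k u f"
    have g: "g \<in> periodic_borel" using f by (simp add: g_def)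
    define D where "D s t = Lp_norm p (fdiff (r + s) t g)" for s t
    define X where "X s i = ennreal (hh i powr - \<alpha>) * D s (hh i)" for s i
    define Y where "Y i = ennreal ((\<delta> / 2^i) powr - \<alpha>) * osc m f (\<delta> / 2 ^ Suc i)" for i
    have halving: "X s (Suc i) \<le> ennreal (1 / 2 ^ s) * X s i + ennreal (2 ^ m) * X (Suc s) (Suc i)"
      if s: "s < k" for s i
    proof -
      have "D s (hh (Suc i)) \<le> ennreal (2 powr - real (r + s)) * D s (hh i) + 2 ^ (r + s) * D (Suc s) (hh (Suc i))"
        using fdiff_halving[OF g, of "r + s" "hh (Suc i)"] by (simp add: D_def hhS)
      also have "\<dots> \<le> ennreal (2 powr - real (r + s)) * D s (hh i) + ennreal (2 ^ m) * D (Suc s) (hh (Suc i))"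
      proof -
        have "(2::ennreal) ^ (r + s) \<le> 2 ^ m" using s by (intro power_increasing) (auto simp: m_def)
        also have "\<dots> = ennreal (2 ^ m)" by (simp flip: ennreal_power)
        finally show ?thesis by (intro add_left_mono mult_right_mono) auto
      qed
      finally have "X s (Suc i) \<le> ennreal (hh (Suc i) powr - \<alpha>) * (ennreal (2 powr - real (r + s)) * D s (hh i)
          + ennreal (2 ^ m) * D (Suc s) (hh (Suc i)))"
        unfolding X_def by (rule mult_left_mono) simp
      also have "\<dots> = ennreal (hh (Suc i) powr - \<alpha> * 2 powr - real (r + s)) * D s (hh i)
          + ennreal (2 ^ m) * X (Suc s) (Suc i)"
        by (simp add: X_def distrib_left ennreal_mult mult_ac)
      also have "\<dots> \<le> ennreal (1 / 2 ^ s) * X s i + ennreal (2 ^ m) * X (Suc s) (Suc i)"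
      proof (rule add_right_mono)
        have "hh (Suc i) powr - \<alpha> * 2 powr - real (r + s) = hh i powr - \<alpha> * 2 powr (\<alpha> - real r - real s)"
          using hh(1)[of i] unfolding hh_def
          by (simp add: powr_divide powr_mult powr_diff powr_minus_divide powr_add)
        also have "\<dots> \<le> hh i powr - \<alpha> * 2 powr (- real s)"
          using \<alpha>r by (intro mult_left_mono powr_mono) auto
        also have "\<dots> = 1 / 2 ^ s * hh i powr - \<alpha>"
          by (simp add: powr_minus_divide powr_realpow)
        finally have "ennreal (hh (Suc i) powr - \<alpha> * 2 powr - real (r + s)) \<le> ennreal (1 / 2 ^ s) * ennreal (hh i powr - \<alpha>)"
          by (simp add: ennreal_leI flip: ennreal_mult)
        then show "ennreal (hh (Suc i) powr - \<alpha> * 2 powr - real (r + s)) * D s (hh i) \<le> ennreal (1 / 2 ^ s) * X s i"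
          unfolding X_def mult.assoc[symmetric] by (rule mult_right_mono) simp
      qed
      finally show ?thesis .
    qed
    have top: "2 * X s 0 \<le> ennreal B * Y 0" if s: "s \<le> k" for s
    proof -
      have "D s (hh 0) \<le> 2 ^ s * Lp_norm p (fdiff r (hh 0) g)"
        unfolding D_def add.commute[of r] fdiff_add using g by (intro fdiff_le) auto
      also have "\<dots> \<le> 2 ^ k * (ennreal K * (2 ^ m * osc m f (\<delta> / 2)))"
      proof (intro mult_mono power_increasing s)
        have "Lp_norm p (fdiff r (hh 0) g) \<le> 2 ^ (m + m * m) * osc m f \<delta>"
          unfolding g_def m_def
          by (rule mixed_osc) (use f k \<delta> u hh(1)[of 0] hh\<delta>[of 0] in auto)
        also have "\<dots> \<le> 2 ^ (m + m * m) * (2 ^ m * osc m f (\<delta> / 2))"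
          using osc_double[OF f, of m 1 "\<delta> / 2"] by (intro mult_left_mono) auto
        also have "(2::ennreal) ^ (m + m * m) = ennreal K"
          by (simp add: K_def flip: ennreal_power)
        finally show "Lp_norm p (fdiff r (hh 0) g) \<le> ennreal K * (2 ^ m * osc m f (\<delta> / 2))" .
      qed auto
      finally have "X s 0 \<le> ennreal (2 powr \<alpha> * \<delta> powr - \<alpha>) * (2 ^ k * (ennreal K * (2 ^ m * osc m f (\<delta> / 2))))"
        unfolding X_def using hhpow[of 0] by (intro mult_mono ennreal_leI) auto
      then have "2 * X s 0 \<le> 2 * (ennreal (2 powr \<alpha> * \<delta> powr - \<alpha>) * (2 ^ k * (ennreal K * (2 ^ m * osc m f (\<delta> / 2)))))"
        by (rule mult_left_mono) simp
      also have "\<dots> = ennreal B * Y 0"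
      proof -
        have e: "(2::ennreal) ^ j = ennreal (2 ^ j)" for j by (simp flip: ennreal_power)
        have "(2::ennreal) = ennreal 2" by simp
        then show ?thesis unfolding B_def Y_def e
          using K by (simp add: ennreal_mult mult_ac del: ennreal_numeral)
      qed
      finally show ?thesis .
    qed
    have Xk: "X k i \<le> ennreal A * Y i" for i
    proof -
      have "D k (hh i) \<le> 2 ^ k * Lp_norm p (fdiff m (hh i) f)"
        unfolding D_def g_def m_def fdiff_commute[of "r + k" _ k] using f by (intro fdiff_le) auto
      also have "\<dots> \<le> 2 ^ k * (2 ^ (2 * m) * osc m f (\<delta> / 2 ^ Suc i))"
      proof (intro mult_left_mono)
        have "\<delta> / 2 ^ i > 0" using \<delta> by simp
        then have "\<bar>hh i\<bar> < 2 ^ 2 * (\<delta> / 2 ^ Suc i)"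
          using hh(1,2)[of i] by (simp add: field_simps)
        then have "Lp_norm p (fdiff m (hh i) f) \<le> osc m f (2 ^ 2 * (\<delta> / 2 ^ Suc i))"
          by (rule fdiff_osc[OF f m1])
        also have "\<dots> \<le> 2 ^ (m * 2) * osc m f (\<delta> / 2 ^ Suc i)"
          by (rule osc_double[OF f])
        finally show "Lp_norm p (fdiff m (hh i) f) \<le> 2 ^ (2 * m) * osc m f (\<delta> / 2 ^ Suc i)"
          by (simp add: mult.commute)
      qed simp
      finally have "X k i \<le> ennreal (2 powr \<alpha> * (\<delta> / 2 ^ i) powr - \<alpha>) * (2 ^ k * (2 ^ (2 * m) * osc m f (\<delta> / 2 ^ Suc i)))"
        unfolding X_def using hhpow[of i] by (intro mult_mono ennreal_leI) auto
      also have "\<dots> = ennreal A * Y i"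
      proof -
        have e: "(2::ennreal) ^ j = ennreal (2 ^ j)" for j by (simp flip: ennreal_power)
        show ?thesis unfolding A_def Y_def e
          by (simp add: ennreal_mult power_add mult_ac)
      qed
      finally show ?thesis .
    qed
    have "X 0 J \<le> (1 + ennreal Q) ^ k * (ennreal B * Y 0 + (\<Sum>i\<le>J. X k i))"
    proof (rule ladder_sum[OF k])
      fix i
      have mQ: "ennreal (2 ^ m) \<le> ennreal Q" by (simp add: Q_def ennreal_leI)
      show "X 0 (Suc i) \<le> X 0 i + ennreal Q * X 1 (Suc i)"
      proof -
        have "X 0 (Suc i) \<le> X 0 i + ennreal (2 ^ m) * X 1 (Suc i)"
          using halving[of 0 i] k by simp
        also have "\<dots> \<le> X 0 i + ennreal Q * X 1 (Suc i)"
          by (intro add_left_mono mult_right_mono mQ) simp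
        finally show ?thesis .
      qed
      fix s assume s: "1 \<le> s" "s < k"
      have "2 * X s (Suc i) \<le> 2 * (ennreal (1 / 2 ^ s) * X s i + ennreal (2 ^ m) * X (Suc s) (Suc i))"
        by (intro mult_left_mono halving s) simp
      also have "\<dots> = ennreal (2 * (1 / 2 ^ s)) * X s i + ennreal Q * X (Suc s) (Suc i)"
      proof -
        have "(2::ennreal) = ennreal 2" by simp
        then show ?thesis unfolding Q_def power_Suc
          by (simp only: ennreal_mult'[of 2] distrib_left mult.assoc)
      qed
      also have "\<dots> \<le> 1 * X s i + ennreal Q * X (Suc s) (Suc i)"
      proof (intro add_right_mono mult_right_mono)
        have "(2::real) ^ 1 \<le> 2 ^ s" using s by (intro power_increasing) auto
        then show "ennreal (2 * (1 / 2 ^ s)) \<le> 1" by (simp flip: ennreal_1)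
      qed simp
      finally show "2 * X s (Suc i) \<le> X s i + ennreal Q * X (Suc s) (Suc i)" by simp
    qed (rule top)
    also have "\<dots> \<le> (1 + ennreal Q) ^ k * (ennreal B * (\<Sum>i<Suc J. Y i) + ennreal A * (\<Sum>i<Suc J. Y i))"
    proof (intro mult_left_mono add_mono)
      show "Y 0 \<le> (\<Sum>i<Suc J. Y i)" by (rule member_le_sum) auto
      have "(\<Sum>i\<le>J. X k i) \<le> (\<Sum>i\<le>J. ennreal A * Y i)" by (rule sum_mono[OF Xk])
      then show "(\<Sum>i\<le>J. X k i) \<le> ennreal A * (\<Sum>i<Suc J. Y i)"
        by (simp add: sum_distrib_left lessThan_Suc_atMost)
    qed auto
    also have "\<dots> \<le> (1 + ennreal Q) ^ k * (ennreal B * (2 * modulus_integral m \<alpha> f \<delta> p 1)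
        + ennreal A * (2 * modulus_integral m \<alpha> f \<delta> p 1))"
    proof -
      have "(\<Sum>i<Suc J. Y i) \<le> 2 * modulus_integral m \<alpha> f \<delta> p 1"
        using dyadic_sum_le_nn_integral[of "osc m f" \<delta> 1 \<alpha> "Suc J"] osc_mono \<delta> \<alpha>
        by (simp add: Y_def modulus_integral_def modulus_eq_osc)
      then show ?thesis by (intro mult_left_mono add_mono) auto
    qed
    also have "\<dots> = ennreal C * modulus_integral m \<alpha> f \<delta> p 1"
    proof -
      have "1 + ennreal Q = ennreal (1 + Q)" using ennreal_plus[of 1 Q] Q by simp
      then have 1: "(1 + ennreal Q) ^ k = ennreal ((1 + Q) ^ k)"
        using Q by (simp only: ennreal_power)
      have "ennreal C = ennreal ((1 + Q) ^ k) * ennreal (B + A) * ennreal 2"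
        using AB Q unfolding C_def by (subst ennreal_mult, simp, simp, subst ennreal_mult, auto)
      also have "ennreal (B + A) = ennreal B + ennreal A"
        using AB by (intro ennreal_plus) auto
      finally show ?thesis
        unfolding 1 by (simp add: distrib_left distrib_right mult_ac)
    qed
    also have "X 0 J = ennreal (h powr - \<alpha>) * Lp_norm p (fdiff k u (fdiff r h f))"
      by (simp add: X_def D_def g_def hh_def h0_def fdiff_commute)
    finally show ?thesis .
  qed
  have "psi_modulus k r \<alpha> f (1 / real n) p \<le> ennreal C * modulus_integral (r + k) \<alpha> f (1 / real n) p 1"
    if n: "n \<ge> 1" and f: "f \<in> periodic_borel" for n f
    unfolding psi_modulus_def
  proof (rule SUP_least)
    fix h assume h: "h \<in> {0<..1 / real n}"
    show "ennreal (h powr - \<alpha>) * modulus k (fdiff r h f) (1 / real n) p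
        \<le> ennreal C * modulus_integral (r + k) \<alpha> f (1 / real n) p 1"
      unfolding modulus_def
    proof (subst SUP_mult_left_ennreal, rule SUP_least)
      fix u assume "u \<in> {0<..<1 / real n}"
      then show "ennreal (h powr - \<alpha>) * Lp_norm p (fdiff k u (fdiff r h f))
          \<le> ennreal C * modulus_integral (r + k) \<alpha> f (1 / real n) p 1"
        using main[of "1 / real n" f h u] n f h by (simp add: m_def)
    qed
  qed
  with C show ?thesis by blast
qed

end


section \<open>Sampling operators for \<open>0 < p < 1\<close>\<close>

text \<open>The kernel that reproduces polynomials of degree at most \<open>2n\<close> from their values on the lattice.
  The degree \<open>3n\<close> of the Dirichlet factor exceeds \<open>2n + L s\<close>, and \<open>2 * 3n < 8n\<close>.\<close>

definition repro_kernel :: "nat \<Rightarrow> nat \<Rightarrow> real \<Rightarrow> complex" where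
  "repro_kernel L n = kernel L (3 * n) (n div (2 * L))"

text \<open>Discrete convolution with the kernel \<open>K\<close> over the lattice through \<open>y\<close>.\<close>

definition samp :: "(real \<Rightarrow> complex) \<Rightarrow> nat \<Rightarrow> real \<Rightarrow> (real \<Rightarrow> complex) \<Rightarrow> real \<Rightarrow> complex" where
  "samp K n y g x = (\<Sum>k\<in>nodes n. g (y + of_int k * mesh n) * K (x - (y + of_int k * mesh n))) / of_nat (8 * n)"

text \<open>The operator \<open>I - J\<close> for the discrete averaging operator \<open>J\<close>.\<close>

definition sdefect :: "nat \<Rightarrow> nat \<Rightarrow> real \<Rightarrow> (real \<Rightarrow> complex) \<Rightarrow> real \<Rightarrow> complex" where
  "sdefect L n y g x = g x - samp (avg_kernel L n) n y g x"

lemma repro_kernel_periodic_borel [simp]: "repro_kernel L n \<in> periodic_borel"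
  by (simp add: repro_kernel_def)

lemma repro_kernel_measurable [measurable]: "repro_kernel L n \<in> borel_measurable borel"
  by (simp add: repro_kernel_def)

lemma samp_in_trig_polys:
  assumes "K \<in> trig_polys d" shows "samp K n y g \<in> trig_polys d"
proof -
  have "(\<lambda>x. \<Sum>k\<in>nodes n. g (y + of_int k * mesh n) * K (x + (- (y + of_int k * mesh n)))) \<in> trig_polys d"
    by (intro trig_polys_sum trig_polys_scale trig_polys_shift assms)
  then have "(\<lambda>x. \<Sum>k\<in>nodes n. g (y + of_int k * mesh n) * K (x - (y + of_int k * mesh n))) \<in> trig_polys d"
    by (simp only: add_uminus_conv_diff)
  from trig_polys_scale[OF this, of "1 / of_nat (8 * n)"] show ?thesis
    by (simp add: samp_def[abs_def])
qed

lemma samp_repro_kernel: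
  assumes T: "T \<in> trig_polys (2 * n)" and n: "n \<ge> 1"
  shows "samp (repro_kernel L n) n y T x = T x"
proof -
  have "2 * n + L * (n div (2 * L)) \<le> 3 * n" using avg_kernel_degree[of L n] by linarith
  from sampling_kernel[OF T n _ this, of y x] n show ?thesis
    by (simp add: samp_def repro_kernel_def)
qed

lemma sum_repro_kernel_nodes:
  assumes "n \<ge> 1" shows "(\<Sum>k\<in>nodes n. repro_kernel L n (x - (y + of_int k * mesh n))) = of_nat (8 * n)"
  using samp_repro_kernel[OF trig_polys_const[of 1] assms, of L y x] assms by (simp add: samp_def)

lemma sdefect_pow_trig_polys:
  "(\<lambda>x. g x - (sdefect L n y ^^ j) g x) \<in> trig_polys n"
proof (induction j)
  case (Suc j)
  have "(\<lambda>x. (g x - (sdefect L n y ^^ j) g x) + samp (avg_kernel L n) n y ((sdefect L n y ^^ j) g) x) \<in> trig_polys n"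
    by (intro trig_polys_add Suc samp_in_trig_polys avg_kernel_in_trig_polys)
  moreover have "(\<lambda>x. g x - (sdefect L n y ^^ Suc j) g x)
      = (\<lambda>x. (g x - (sdefect L n y ^^ j) g x) + samp (avg_kernel L n) n y ((sdefect L n y ^^ j) g) x)"
    by (simp add: sdefect_def[of L n y "(sdefect L n y ^^ j) g"] fun_eq_iff)
  ultimately show ?case by simp
qed (auto intro: trig_polys_zero)

lemma sum_nodes_shift_periodic:
  fixes \<phi> :: "real \<Rightarrow> 'a::comm_monoid_add"
  assumes per: "\<And>x. \<phi> (x + 2 * pi) = \<phi> x" and n: "n \<ge> 1"
  shows "(\<Sum>k\<in>nodes n. \<phi> (y + of_int (k + j) * mesh n)) = (\<Sum>k\<in>nodes n. \<phi> (y + of_int k * mesh n))"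
proof (rule sum_nodes_shift[OF _ n, where \<phi> = "\<lambda>k. \<phi> (y + of_int k * mesh n)"])
  fix k
  have "y + of_int (k + 8 * int n) * mesh n = (y + of_int k * mesh n) + 2 * pi"
    using mesh_period[OF n, of k] by simp
  then show "\<phi> (y + of_int (k + 8 * int n) * mesh n) = \<phi> (y + of_int k * mesh n)"
    by (simp only: per)
qed

lemma sum_nodes_reflect_periodic:
  fixes \<phi> :: "real \<Rightarrow> 'a::comm_monoid_add"
  assumes per: "\<And>x. \<phi> (x + 2 * pi) = \<phi> x" and n: "n \<ge> 1"
  shows "(\<Sum>k\<in>nodes n. \<phi> (y + of_int (j - k) * mesh n)) = (\<Sum>k\<in>nodes n. \<phi> (y + of_int k * mesh n))"
proof (rule sum_nodes_reflect[OF _ n, where \<phi> = "\<lambda>k. \<phi> (y + of_int k * mesh n)"])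
  fix k
  have "y + of_int (k + 8 * int n) * mesh n = (y + of_int k * mesh n) + 2 * pi"
    using mesh_period[OF n, of k] by simp
  then show "\<phi> (y + of_int (k + 8 * int n) * mesh n) = \<phi> (y + of_int k * mesh n)"
    by (simp only: per)
qed

lemma samp_shift_mesh:
  assumes g: "g \<in> periodic_borel" and n: "n \<ge> 1"
  shows "samp (avg_kernel L n) n y (\<lambda>x. g (x + mesh n)) x = samp (avg_kernel L n) n y g (x + mesh n)"
proof -
  define \<phi> where "\<phi> z = g z * avg_kernel L n (x + mesh n - z)" for z
  have "(\<Sum>k\<in>nodes n. g (y + of_int k * mesh n + mesh n) * avg_kernel L n (x - (y + of_int k * mesh n)))
      = (\<Sum>k\<in>nodes n. \<phi> (y + of_int (k + 1) * mesh n))"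
    by (rule sum.cong) (auto simp: \<phi>_def algebra_simps)
  also have "\<dots> = (\<Sum>k\<in>nodes n. \<phi> (y + of_int k * mesh n))"
    by (rule sum_nodes_shift_periodic[OF _ n])
       (simp only: \<phi>_def periodic_borel_reflect[OF avg_kernel_periodic_borel] periodic_borel_periodic[OF g])
  finally show ?thesis by (simp add: samp_def \<phi>_def)
qed

lemma samp_diff: "samp K n y (\<lambda>x. f x - g x) x = samp K n y f x - samp K n y g x"
  by (simp add: samp_def left_diff_distrib sum_subtractf diff_divide_distrib)

lemma sdefect_periodic_borel [simp]: "g \<in> periodic_borel \<Longrightarrow> sdefect L n y g \<in> periodic_borel"
  unfolding sdefect_def[abs_def]
  by (intro periodic_borel_diff trig_polys_periodic_borel[OF samp_in_trig_polys[OF avg_kernel_in_trig_polys]])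

lemma sdefect_pow_periodic_borel [simp]:
  "g \<in> periodic_borel \<Longrightarrow> (sdefect L n y ^^ j) g \<in> periodic_borel"
  by (induction j) auto

lemma diff1_sdefect:
  assumes "g \<in> periodic_borel" "n \<ge> 1"
  shows "diff1 (mesh n) (sdefect L n y g) = sdefect L n y (diff1 (mesh n) g)"
  using assms by (simp add: fun_eq_iff diff1_def sdefect_def samp_diff samp_shift_mesh)

lemma diff1_sdefect_pow:
  assumes "g \<in> periodic_borel" "n \<ge> 1"
  shows "diff1 (mesh n) ((sdefect L n y ^^ j) g) = (sdefect L n y ^^ j) (diff1 (mesh n) g)"
  using assms by (induction j) (auto simp: diff1_sdefect)

lemma sum_int_inverse_square_le:
  assumes "finite S" shows "(\<Sum>l\<in>S. 1 / (1 + \<bar>real_of_int l\<bar>)\<^sup>2) \<le> 4"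
proof -
  have nat: "(\<Sum>j<Suc N. 1 / (1 + real j)\<^sup>2) \<le> 2 - 1 / (real N + 1)" for N
  proof (induction N)
    case (Suc N)
    have "1 / (1 + real (Suc N))\<^sup>2 \<le> 1 / ((real N + 1) * (real N + 2))"
      by (intro divide_left_mono mult_pos_pos zero_less_power) (auto simp: power2_eq_square algebra_simps)
    also have "\<dots> = 1 / (real N + 1) - 1 / (real N + 2)"
      by (simp add: field_simps)
    finally show ?case using Suc by (simp add: add.commute)
  qed simp
  have half: "(\<Sum>l\<in>A. 1 / (1 + \<bar>real_of_int l\<bar>)\<^sup>2) \<le> 2"
    if A: "finite A" and inj: "inj_on (\<lambda>l. nat \<bar>l\<bar>) A" for A
  proof -
    obtain N where N: "(\<lambda>l. nat \<bar>l\<bar>) ` A \<subseteq> {..<N}"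
      using finite_nat_iff_bounded[of "(\<lambda>l. nat \<bar>l\<bar>) ` A"] A by blast
    have "(\<Sum>l\<in>A. 1 / (1 + \<bar>real_of_int l\<bar>)\<^sup>2) = (\<Sum>j\<in>(\<lambda>l. nat \<bar>l\<bar>) ` A. 1 / (1 + real j)\<^sup>2)"
      by (subst sum.reindex[OF inj]) simp
    also have "\<dots> \<le> (\<Sum>j<Suc N. 1 / (1 + real j)\<^sup>2)"
      using N by (intro sum_mono2) auto
    also have "\<dots> \<le> 2" using nat[of N] by (rule order_trans) simp
    finally show ?thesis .
  qed
  have "(\<Sum>l\<in>S. 1 / (1 + \<bar>real_of_int l\<bar>)\<^sup>2)
      = (\<Sum>l\<in>S \<inter> {0..}. 1 / (1 + \<bar>real_of_int l\<bar>)\<^sup>2) + (\<Sum>l\<in>S - {0..}. 1 / (1 + \<bar>real_of_int l\<bar>)\<^sup>2)"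
    using assms by (rule sum.Int_Diff)
  also have "\<dots> \<le> 2 + 2"
    using assms by (intro add_mono half) (auto simp: inj_on_def)
  finally show ?thesis by simp
qed

text \<open>The range \<open>0 < p < 1\<close>, with a real exponent.\<close>

locale Lp_quasi =
  fixes p :: real
  assumes p_pos: "0 < p" and p_less_1: "p < 1"

sublocale Lp_quasi \<subseteq> shift_quasinorm "pmean p" p
  by (rule shift_quasinorm_pmean[OF p_pos p_less_1])

context Lp_quasi
begin

text \<open>The \<open>p\<close>-th power sum of the values on the lattice through \<open>y\<close>.\<close>

definition node_sum :: "nat \<Rightarrow> real \<Rightarrow> (real \<Rightarrow> complex) \<Rightarrow> real" where
  "node_sum n y g = (\<Sum>k\<in>nodes n. norm (g (y + of_int k * mesh n)) powr p)"

lemma node_sum_nonneg [simp]: "node_sum n y g \<ge> 0"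
  by (simp add: node_sum_def sum_nonneg)

lemma powr_norm_add_le: "norm (a + b :: complex) powr p \<le> norm a powr p + norm b powr p"
proof -
  have "norm (a + b) powr p \<le> (norm a + norm b) powr p"
    using p_pos by (intro powr_mono2 norm_triangle_ineq) auto
  also have "\<dots> \<le> norm a powr p + norm b powr p"
    using p_pos p_less_1 by (intro powr_add_le) auto
  finally show ?thesis .
qed

lemma node_sum_add_le: "node_sum n y (\<lambda>x. f x + g x) \<le> node_sum n y f + node_sum n y g"
  unfolding node_sum_def sum.distrib[symmetric] by (intro sum_mono powr_norm_add_le)

lemma node_sum_diff_le: "node_sum n y (\<lambda>x. f x - g x) \<le> node_sum n y f + node_sum n y g"
  using node_sum_add_le[of n y f "\<lambda>x. - g x"] by (simp add: node_sum_def)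

lemma node_sum_shift:
  assumes "g \<in> periodic_borel" "n \<ge> 1"
  shows "node_sum n y (\<lambda>x. g (x + of_int j * mesh n)) = node_sum n y g"
proof -
  have "node_sum n y (\<lambda>x. g (x + of_int j * mesh n)) = (\<Sum>k\<in>nodes n. norm (g (y + of_int (k + j) * mesh n)) powr p)"
    by (simp add: node_sum_def algebra_simps)
  also have "\<dots> = node_sum n y g"
    unfolding node_sum_def
    by (rule sum_nodes_shift_periodic[where \<phi> = "\<lambda>x. norm (g x) powr p"])
       (use assms in \<open>auto simp: periodic_borel_periodic\<close>)
  finally show ?thesis .
qed

lemma node_sum_increment_nat:
  assumes g: "g \<in> periodic_borel" and n: "n \<ge> 1"
  shows "node_sum n y (diff1 (real l * mesh n) g) \<le> real l * node_sum n y (diff1 (mesh n) g)"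
proof (induction l)
  case 0
  have "diff1 0 g = (\<lambda>x. 0)" by (simp add: diff1_def)
  then show ?case using p_pos by (simp add: node_sum_def)
next
  case (Suc l)
  have "diff1 (real (Suc l) * mesh n) g = (\<lambda>x. diff1 (real l * mesh n) g x + diff1 (mesh n) g (x + of_int (int l) * mesh n))"
    by (simp add: diff1_def fun_eq_iff algebra_simps)
  then have "node_sum n y (diff1 (real (Suc l) * mesh n) g)
      \<le> node_sum n y (diff1 (real l * mesh n) g) + node_sum n y (\<lambda>x. diff1 (mesh n) g (x + of_int (int l) * mesh n))"
    by (simp only: node_sum_add_le)
  also have "\<dots> \<le> real l * node_sum n y (diff1 (mesh n) g) + node_sum n y (diff1 (mesh n) g)"
    using g n by (intro add_mono Suc) (simp only: node_sum_shift periodic_borel_diff1)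
  finally show ?case by (simp add: algebra_simps)
qed

lemma node_sum_increment:
  assumes g: "g \<in> periodic_borel" and n: "n \<ge> 1"
  shows "node_sum n y (diff1 (of_int l * mesh n) g) \<le> \<bar>of_int l\<bar> * node_sum n y (diff1 (mesh n) g)"
proof (cases "l \<ge> 0")
  case True
  then have "real (nat l) = of_int l" by simp
  then show ?thesis using node_sum_increment_nat[OF g n, of y "nat l"] True by simp
next
  case False
  then have e: "real (nat (- l)) = - of_int l" by simp
  have "node_sum n y (diff1 (of_int l * mesh n) g) = node_sum n y (\<lambda>x. diff1 (- of_int l * mesh n) g (x + of_int l * mesh n))"
    by (simp add: node_sum_def diff1_def norm_minus_commute algebra_simps)
  also have "\<dots> = node_sum n y (diff1 (- of_int l * mesh n) g)"
    using g n by (simp only: node_sum_shift periodic_borel_diff1)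
  also have "\<dots> \<le> - of_int l * node_sum n y (diff1 (mesh n) g)"
    using node_sum_increment_nat[OF g n, of y "nat (- l)"] unfolding e .
  finally show ?thesis using False by simp
qed

text \<open>At a lattice point, \<open>sdefect\<close> is a weighted sum of differences with steps \<open>l * mesh n\<close>; each costs
  \<open>\<bar>l\<bar>\<close> differences with step \<open>mesh n\<close>, and the \<open>p\<close>-th powers of the weights decay like
  \<open>\<bar>l\<bar>\<^sup>-\<^sup>3\<close>.\<close>

lemma node_sum_sdefect_le:
  assumes g: "g \<in> periodic_borel" and n: "n \<ge> 1" and L: "L \<ge> 1" "real L * p \<ge> 3"
  shows "node_sum n y (sdefect L n y g) \<le> 4 * (2 ^ L * (1 + 8 * real L) ^ L) powr p * node_sum n y (diff1 (mesh n) g)"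
proof -
  define c where "c = (2 ^ L * (1 + 8 * real L) ^ L) powr p"
  define S where "S = node_sum n y (diff1 (mesh n) g)"
  define w where "w l = norm (avg_kernel L n (of_int l * mesh n)) / real (8 * n)" for l
  have eq: "sdefect L n y g (y + of_int k * mesh n)
      = (\<Sum>l\<in>nodes n. avg_kernel L n (of_int l * mesh n) / of_nat (8 * n) * diff1 (of_int (- l) * mesh n) g (y + of_int k * mesh n))" for k
  proof -
    let ?x = "y + of_int k * mesh n"
    define \<phi> where "\<phi> z = (g ?x - g z) * avg_kernel L n (?x - z)" for z
    have "(of_nat (8 * n) :: complex) * sdefect L n y g ?x = (\<Sum>j\<in>nodes n. \<phi> (y + of_int j * mesh n))"
      using sum_avg_kernel_nodes[OF n, of L ?x y] n
      by (simp add: sdefect_def samp_def \<phi>_def left_diff_distrib sum_subtractf sum_distrib_left[symmetric]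
            right_diff_distrib mult.commute)
    also have "\<dots> = (\<Sum>l\<in>nodes n. \<phi> (y + of_int (k - l) * mesh n))"
      by (rule sum_nodes_reflect_periodic[OF _ n, symmetric])
         (simp only: \<phi>_def periodic_borel_reflect[OF avg_kernel_periodic_borel] periodic_borel_periodic[OF g])
    also have "\<dots> = (\<Sum>l\<in>nodes n. avg_kernel L n (of_int l * mesh n) * diff1 (of_int (- l) * mesh n) g ?x)"
      by (rule sum.cong) (auto simp: \<phi>_def diff1_def algebra_simps)
    finally have "sdefect L n y g ?x = (\<Sum>l\<in>nodes n. avg_kernel L n (of_int l * mesh n) * diff1 (of_int (- l) * mesh n) g ?x) / of_nat (8 * n)"
      using n by (simp add: field_simps)
    then show ?thesis by (simp add: sum_divide_distrib mult_ac)
  qed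
  have w: "w l powr p * \<bar>of_int l\<bar> \<le> c * (1 / (1 + \<bar>real_of_int l\<bar>)\<^sup>2)" if l: "l \<in> nodes n" for l
  proof -
    let ?a = "\<bar>real_of_int l\<bar>"
    have n0: "real n > 0" using n by simp
    have "?a \<le> 4 * real n" using l by (auto simp: nodes_def)
    then have lh: "\<bar>of_int l * mesh n\<bar> \<le> pi"
      using n0 by (simp add: mesh_def abs_mult field_simps)
    have nm: "real n * \<bar>of_int l * mesh n\<bar> = ?a * (pi / 4)"
      using n0 by (simp add: mesh_def abs_mult)
    have "(1 + ?a) / 2 \<le> 1 + ?a * (pi / 4)"
    proof -
      have "?a * (1/2) \<le> ?a * (pi / 4)" using pi_gt3 by (intro mult_left_mono) auto
      then show ?thesis by (simp add: field_simps)
    qed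
    then have "(1 + ?a * (pi / 4)) powr (- real L) \<le> ((1 + ?a) / 2) powr (- real L)"
      by (intro powr_mono2') auto
    also have "\<dots> = 2 ^ L * (1 + ?a) powr (- real L)"
      by (simp add: powr_divide powr_minus_divide powr_real_nat[OF _ L(1)] powr_realpow)
    finally have dec: "(1 + ?a * (pi / 4)) powr (- real L) \<le> 2 ^ L * (1 + ?a) powr (- real L)" .
    have "w l \<le> 2 * (1 + 8 * real L) ^ L * (real n * (1 + ?a * (pi / 4)) powr (- real L)) / real (8 * n)"
      unfolding w_def using norm_avg_kernel_le[OF lh L(1) n] nm by (intro divide_right_mono) auto
    also have "\<dots> = (1/4) * (1 + 8 * real L) ^ L * (1 + ?a * (pi / 4)) powr (- real L)"
      using n0 by (simp add: field_simps)
    also have "\<dots> \<le> 1 * (1 + 8 * real L) ^ L * (2 ^ L * (1 + ?a) powr (- real L))"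
      using dec by (intro mult_mono) auto
    finally have "w l powr p \<le> (2 ^ L * (1 + 8 * real L) ^ L * (1 + ?a) powr (- real L)) powr p"
      using p_pos n0 by (intro powr_mono2) (auto simp: w_def mult_ac)
    also have "\<dots> = c * (1 + ?a) powr (- (real L * p))"
      by (simp add: c_def powr_mult powr_powr)
    also have "\<dots> \<le> c * (1 + ?a) powr (- 3)"
      using L by (intro mult_left_mono powr_mono) (auto simp: c_def)
    finally have "w l powr p * ?a \<le> c * (1 + ?a) powr (- 3) * (1 + ?a)"
      by (intro mult_mono) (auto simp: c_def)
    also have "\<dots> = c * (1 / (1 + ?a)\<^sup>2)"
    proof -
      have "(1 + ?a) powr (- 3) * (1 + ?a) = (1 + ?a) powr (- 2)"
        using powr_add[of "1 + ?a" "- 3" 1] by (simp add: add_nonneg_pos)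
      also have "\<dots> = 1 / (1 + ?a)\<^sup>2"
        by (simp add: powr_minus_divide powr_numeral)
      finally show ?thesis by (simp only: mult.assoc)
    qed
    finally show ?thesis .
  qed
  have "node_sum n y (sdefect L n y g) \<le> (\<Sum>k\<in>nodes n. \<Sum>l\<in>nodes n. w l powr p * norm (diff1 (of_int (- l) * mesh n) g (y + of_int k * mesh n)) powr p)"
    unfolding node_sum_def eq
  proof (rule sum_mono)
    fix k
    have "norm (\<Sum>l\<in>nodes n. avg_kernel L n (of_int l * mesh n) / of_nat (8 * n) * diff1 (of_int (- l) * mesh n) g (y + of_int k * mesh n)) powr p
        \<le> (\<Sum>l\<in>nodes n. norm (avg_kernel L n (of_int l * mesh n) / of_nat (8 * n) * diff1 (of_int (- l) * mesh n) g (y + of_int k * mesh n)) powr p)"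
      using p_pos p_less_1 by (intro norm_sum_powr_le) auto
    also have "\<dots> = (\<Sum>l\<in>nodes n. w l powr p * norm (diff1 (of_int (- l) * mesh n) g (y + of_int k * mesh n)) powr p)"
      unfolding w_def norm_mult norm_divide norm_of_nat by (simp only: powr_mult)
    finally show "norm (\<Sum>l\<in>nodes n. avg_kernel L n (of_int l * mesh n) / of_nat (8 * n) * diff1 (of_int (- l) * mesh n) g (y + of_int k * mesh n)) powr p
        \<le> (\<Sum>l\<in>nodes n. w l powr p * norm (diff1 (of_int (- l) * mesh n) g (y + of_int k * mesh n)) powr p)" .
  qed
  also have "\<dots> = (\<Sum>l\<in>nodes n. w l powr p * node_sum n y (diff1 (of_int (- l) * mesh n) g))"
    by (subst sum.swap) (simp add: node_sum_def sum_distrib_left)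
  also have "\<dots> \<le> (\<Sum>l\<in>nodes n. w l powr p * (\<bar>of_int (- l)\<bar> * S))"
    unfolding S_def by (intro sum_mono mult_left_mono node_sum_increment[OF g n]) auto
  also have "\<dots> = (\<Sum>l\<in>nodes n. w l powr p * \<bar>of_int l\<bar>) * S"
    by (simp add: sum_distrib_right mult.assoc)
  also have "\<dots> \<le> (\<Sum>l\<in>nodes n. c * (1 / (1 + \<bar>real_of_int l\<bar>)\<^sup>2)) * S"
    using w by (intro mult_right_mono sum_mono) (auto simp: S_def)
  also have "\<dots> \<le> c * 4 * S"
    unfolding sum_distrib_left[symmetric]
    by (intro mult_right_mono mult_left_mono sum_int_inverse_square_le) (auto simp: S_def c_def)
  finally show ?thesis by (simp add: c_def S_def mult_ac)
qed

lemma node_sum_sdefect_pow_le: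
  assumes g: "g \<in> periodic_borel" and n: "n \<ge> 1" and L: "L \<ge> 1" "real L * p \<ge> 3"
  shows "node_sum n y ((sdefect L n y ^^ m) g)
    \<le> (4 * (2 ^ L * (1 + 8 * real L) ^ L) powr p) ^ m * node_sum n y (fdiff m (mesh n) g)"
  using g
proof (induction m arbitrary: g)
  case (Suc m)
  let ?c = "4 * (2 ^ L * (1 + 8 * real L) ^ L) powr p"
  have "node_sum n y ((sdefect L n y ^^ Suc m) g) \<le> ?c * node_sum n y (diff1 (mesh n) ((sdefect L n y ^^ m) g))"
    using Suc.prems by (auto intro: node_sum_sdefect_le n L)
  also have "\<dots> = ?c * node_sum n y ((sdefect L n y ^^ m) (diff1 (mesh n) g))"
    using Suc.prems n by (simp add: diff1_sdefect_pow)
  also have "\<dots> \<le> ?c * (?c ^ m * node_sum n y (fdiff m (mesh n) (diff1 (mesh n) g)))"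
    using Suc.prems by (intro mult_left_mono Suc.IH) auto
  finally show ?case by (simp only: fdiff_Suc' power_Suc mult.assoc)
qed simp

end


section \<open>A Bernstein inequality for \<open>0 < p < 1\<close>\<close>

context Lp_quasi
begin

text \<open>The decay exponent of the kernels, large enough for \<open>L p \<ge> 3\<close> and even \<open>(L - 1) p \<ge> 3\<close>; the latter
  is what remains after taking a difference of the kernel.\<close>

definition decay_exp :: nat where "decay_exp = nat \<lceil>3 / p\<rceil> + 1"

text \<open>The constant of \<open>peak_decay\<close> for \<open>L = decay_exp\<close>.\<close>

definition decay_const :: real where "decay_const = 1 + 8 * real decay_exp"

lemma decay_exp: "decay_exp \<ge> 1" "real (decay_exp - 1) * p \<ge> 3" "real decay_exp * p \<ge> 3"
proof -
  have "3 / p \<le> real (nat \<lceil>3 / p\<rceil>)" by linarith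
  then have *: "3 \<le> real (nat \<lceil>3 / p\<rceil>) * p" using p_pos by (simp only: pos_divide_le_eq)
  have e: "real (decay_exp - 1) = real (nat \<lceil>3 / p\<rceil>)" by (simp add: decay_exp_def)
  show 1: "real (decay_exp - 1) * p \<ge> 3" using * by (simp only: e)
  have "real decay_exp * p = real (decay_exp - 1) * p + p" by (simp add: decay_exp_def distrib_right)
  then show "real decay_exp * p \<ge> 3" using 1 p_pos by linarith
  show "decay_exp \<ge> 1" by (simp add: decay_exp_def)
qed

lemma decay_const_pos: "decay_const > 0"
  by (simp add: decay_const_def add_pos_nonneg)

lemma nn_integral_peak:
  assumes n: "n \<ge> 1" and e: "e \<ge> 2"
  shows "(\<integral>\<^sup>+x. ennreal (norm (peak (n div (2 * decay_exp)) x) powr e) \<partial>circ) \<le> ennreal (decay_const powr e / real n)"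
proof -
  have "(\<integral>\<^sup>+x. ennreal (norm (peak (n div (2 * decay_exp)) x) powr e) \<partial>circ)
      \<le> (\<integral>\<^sup>+x. ennreal (decay_const powr e) * ennreal ((1 + real n * \<bar>x\<bar>) powr (- e)) \<partial>circ)"
  proof (rule nn_integral_mono_AE, rule AE_circ)
    fix x assume "x \<in> {- pi..<pi}"
    then show "ennreal (norm (peak (n div (2 * decay_exp)) x) powr e)
        \<le> ennreal (decay_const powr e) * ennreal ((1 + real n * \<bar>x\<bar>) powr (- e))"
      using peak_decay_powr[of x decay_exp e n] e decay_exp(1)
      by (subst ennreal_mult[symmetric]) (auto simp: decay_const_def intro!: ennreal_leI)
  qed
  also have "\<dots> = ennreal (decay_const powr e) * (\<integral>\<^sup>+x. ennreal ((1 + real n * \<bar>x\<bar>) powr (- e)) \<partial>circ)"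
    by (rule nn_integral_cmult) simp
  also have "\<dots> \<le> ennreal (decay_const powr e) * ennreal (1 / real n)"
    by (intro mult_left_mono nn_integral_decay n e) simp
  also have "\<dots> = ennreal (decay_const powr e / real n)"
    by (subst ennreal_mult[symmetric]) auto
  finally show ?thesis .
qed

lemma peak_measurable [measurable]: "peak s \<in> borel_measurable borel"
  by (rule periodic_borel_measurable, rule trig_polys_periodic_borel, rule peak_in_trig_polys)

lemma pmean_repro_kernel:
  assumes n: "n \<ge> 1"
  shows "pmean p (repro_kernel decay_exp n) \<le> ennreal ((7 * real n) powr p * (decay_const powr (real decay_exp * p) / real n))"
proof -
  let ?F = "\<lambda>x. norm (peak (n div (2 * decay_exp)) x)"
  have "pmean p (repro_kernel decay_exp n) \<le> (\<integral>\<^sup>+x. ennreal ((7 * real n) powr p) * ennreal (?F x powr (real decay_exp * p)) \<partial>circ)"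
    unfolding pmean_def
  proof (rule nn_integral_mono)
    fix x
    have "norm (repro_kernel decay_exp n x) \<le> real (2 * (3 * n) + 1) * ?F x ^ decay_exp"
      unfolding repro_kernel_def by (rule norm_kernel_le)
    also have "\<dots> \<le> 7 * real n * ?F x ^ decay_exp"
      using n by (intro mult_right_mono) auto
    finally have "norm (repro_kernel decay_exp n x) powr p \<le> (7 * real n * ?F x ^ decay_exp) powr p"
      using p_pos by (intro powr_mono2) auto
    also have "\<dots> = (7 * real n) powr p * ?F x powr (real decay_exp * p)"
      by (simp add: powr_mult powr_powr flip: powr_real_nat[OF norm_ge_zero decay_exp(1)])
    finally show "ennreal (norm (repro_kernel decay_exp n x) powr p) \<le> ennreal ((7 * real n) powr p) * ennreal (?F x powr (real decay_exp * p))"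
      by (subst ennreal_mult[symmetric]) (auto intro: ennreal_leI)
  qed
  also have "\<dots> = ennreal ((7 * real n) powr p) * (\<integral>\<^sup>+x. ennreal (?F x powr (real decay_exp * p)) \<partial>circ)"
    by (rule nn_integral_cmult) simp
  also have "\<dots> \<le> ennreal ((7 * real n) powr p) * ennreal (decay_const powr (real decay_exp * p) / real n)"
    using decay_exp(3) by (intro mult_left_mono nn_integral_peak n) auto
  finally show ?thesis by (subst ennreal_mult) auto
qed

lemma pmean_diff1_repro_kernel:
  assumes n: "n \<ge> 1"
  shows "pmean p (diff1 d (repro_kernel decay_exp n))
    \<le> ennreal ((28 * real decay_exp * real n * (real n * \<bar>d\<bar>)) powr p * (2 * (decay_const powr (real (decay_exp - 1) * p) / real n)))"
proof -
  let ?P = "peak (n div (2 * decay_exp))"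
  let ?e = "real (decay_exp - 1) * p"
  define M where "M = 28 * real decay_exp * real n * (real n * \<bar>d\<bar>)"
  have M: "M \<ge> 0" by (simp add: M_def)
  have L1: "decay_exp - 1 \<ge> 1"
  proof (rule ccontr)
    assume "\<not> 1 \<le> decay_exp - 1" then have "decay_exp - 1 = 0" by simp
    then show False using decay_exp(2) by (simp only:)
  qed
  have "pmean p (diff1 d (repro_kernel decay_exp n))
      \<le> (\<integral>\<^sup>+x. ennreal (M powr p) * (ennreal (norm (?P (x + d)) powr ?e) + ennreal (norm (?P x) powr ?e)) \<partial>circ)"
    unfolding pmean_def
  proof (rule nn_integral_mono)
    fix x
    have "norm (diff1 d (repro_kernel decay_exp n) x) \<le> M * (norm (?P (x + d)) ^ (decay_exp - 1) + norm (?P x) ^ (decay_exp - 1))"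
      unfolding M_def diff1_def repro_kernel_def norm_minus_commute[of _ "kernel _ _ _ (x + d)"]
      by (rule kernel_diff_le[OF decay_exp(1) n]) auto
    then have "norm (diff1 d (repro_kernel decay_exp n) x) powr p
        \<le> (M * (norm (?P (x + d)) ^ (decay_exp - 1) + norm (?P x) ^ (decay_exp - 1))) powr p"
      using p_pos by (intro powr_mono2) auto
    also have "\<dots> = M powr p * (norm (?P (x + d)) ^ (decay_exp - 1) + norm (?P x) ^ (decay_exp - 1)) powr p"
      using M by (simp add: powr_mult)
    also have "\<dots> \<le> M powr p * ((norm (?P (x + d)) ^ (decay_exp - 1)) powr p + (norm (?P x) ^ (decay_exp - 1)) powr p)"
      using p_pos p_less_1 by (intro mult_left_mono powr_add_le) auto
    also have "\<dots> = M powr p * (norm (?P (x + d)) powr ?e + norm (?P x) powr ?e)"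
    proof -
      have "(norm z ^ (decay_exp - 1)) powr p = norm z powr ?e" for z :: complex
        by (subst powr_real_nat[OF norm_ge_zero L1, symmetric]) (simp only: powr_powr)
      then show ?thesis by (simp only:)
    qed
    finally show "ennreal (norm (diff1 d (repro_kernel decay_exp n) x) powr p)
        \<le> ennreal (M powr p) * (ennreal (norm (?P (x + d)) powr ?e) + ennreal (norm (?P x) powr ?e))"
      by (subst ennreal_plus[symmetric], simp, simp, subst ennreal_mult[symmetric]) (auto intro: ennreal_leI)
  qed
  also have "\<dots> = ennreal (M powr p) * ((\<integral>\<^sup>+x. ennreal (norm (?P (x + d)) powr ?e) \<partial>circ)
      + (\<integral>\<^sup>+x. ennreal (norm (?P x) powr ?e) \<partial>circ))"
    by (subst nn_integral_cmult, simp) (subst nn_integral_add, auto)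
  also have "(\<integral>\<^sup>+x. ennreal (norm (?P (x + d)) powr ?e) \<partial>circ) = (\<integral>\<^sup>+x. ennreal (norm (?P x) powr ?e) \<partial>circ)"
    by (rule nn_integral_circ_shift)
       (auto simp: periodic_borel_periodic[OF trig_polys_periodic_borel[OF peak_in_trig_polys]])
  also have "ennreal (M powr p) * ((\<integral>\<^sup>+x. ennreal (norm (?P x) powr ?e) \<partial>circ) + (\<integral>\<^sup>+x. ennreal (norm (?P x) powr ?e) \<partial>circ))
      \<le> ennreal (M powr p) * (ennreal (decay_const powr ?e / real n) + ennreal (decay_const powr ?e / real n))"
  proof -
    have "?e \<ge> 2" using decay_exp(2) by linarith
    from nn_integral_peak[OF n this] show ?thesis by (intro mult_left_mono add_mono) auto
  qed
  also have "\<dots> = ennreal (M powr p * (2 * (decay_const powr ?e / real n)))"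
    by (subst ennreal_plus[symmetric], simp, simp, subst ennreal_mult[symmetric]) auto
  finally show ?thesis by (simp add: M_def)
qed

lemma pmean_samp:
  assumes K: "K \<in> periodic_borel"
  shows "pmean p (samp K n y g) \<le> ennreal (node_sum n y g / real (8 * n) powr p) * pmean p K"
proof -
  let ?c = "\<lambda>k. g (y + of_int k * mesh n) / of_nat (8 * n)"
  have eq: "samp K n y g = (\<lambda>x. \<Sum>k\<in>nodes n. ?c k * K (x + (- (y + of_int k * mesh n))))"
    unfolding add_uminus_conv_diff by (simp add: fun_eq_iff samp_def sum_divide_distrib)
  have "pmean p (samp K n y g) \<le> (\<Sum>k\<in>nodes n. pmean p (\<lambda>x. ?c k * K (x + (- (y + of_int k * mesh n)))))"
    unfolding eq by (intro sum_le finite_nodes periodic_borel_scale periodic_borel_shift K)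
  also have "\<dots> \<le> (\<Sum>k\<in>nodes n. ennreal (norm (?c k) powr p) * pmean p K)"
  proof (rule sum_mono)
    fix k
    have "pmean p (\<lambda>x. ?c k * K (x + (- (y + of_int k * mesh n))))
        \<le> ennreal (norm (?c k) powr p) * pmean p (\<lambda>x. K (x + (- (y + of_int k * mesh n))))"
      by (intro scale_le periodic_borel_shift K)
    also have "\<dots> \<le> ennreal (norm (?c k) powr p) * pmean p K"
      by (intro mult_left_mono shift_le K) simp
    finally show "pmean p (\<lambda>x. ?c k * K (x + (- (y + of_int k * mesh n)))) \<le> ennreal (norm (?c k) powr p) * pmean p K" .
  qed
  also have "\<dots> = ennreal (\<Sum>k\<in>nodes n. norm (?c k) powr p) * pmean p K"
    unfolding sum_distrib_right[symmetric] by (subst sum_ennreal) auto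
  also have "(\<Sum>k\<in>nodes n. norm (?c k) powr p) = node_sum n y g / real (8 * n) powr p"
    unfolding node_sum_def sum_divide_distrib norm_divide norm_of_nat
    by (intro sum.cong refl) (simp add: powr_divide)
  finally show ?thesis .
qed

text \<open>The constants of \<open>pmean_samp_repro_kernel\<close> and \<open>bernstein\<close>.\<close>

definition sampling_const :: real where "sampling_const = 8 * decay_const powr (real decay_exp * p)"

definition bernstein_const :: real where "bernstein_const = 16 * (4 * real decay_exp) powr p * decay_const powr (real (decay_exp - 1) * p)"

lemma sampling_const_pos: "sampling_const > 0" using decay_const_pos by (simp add: sampling_const_def)

lemma bernstein_const_pos: "bernstein_const > 0" using decay_const_pos decay_exp(1) by (simp add: bernstein_const_def)

lemma pmean_samp_repro_kernel:
  assumes n: "n \<ge> 1"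
  shows "pmean p (samp (repro_kernel decay_exp n) n y g) \<le> ennreal (sampling_const * (node_sum n y g / real (8 * n)))"
proof -
  have "pmean p (samp (repro_kernel decay_exp n) n y g) \<le> ennreal (node_sum n y g / real (8 * n) powr p) * pmean p (repro_kernel decay_exp n)"
    by (rule pmean_samp) simp
  also have "\<dots> \<le> ennreal (node_sum n y g / real (8 * n) powr p) * ennreal ((7 * real n) powr p * (decay_const powr (real decay_exp * p) / real n))"
    by (intro mult_left_mono pmean_repro_kernel n) simp
  also have "\<dots> = ennreal (node_sum n y g / real (8 * n) powr p * ((7 * real n) powr p * (decay_const powr (real decay_exp * p) / real n)))"
    by (subst ennreal_mult[symmetric]) auto
  also have "\<dots> \<le> ennreal (sampling_const * (node_sum n y g / real (8 * n)))"
  proof (rule ennreal_leI)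
    have "(7 * real n) powr p \<le> real (8 * n) powr p"
      using p_pos by (intro powr_mono2) auto
    then have "(7 * real n) powr p / real (8 * n) powr p \<le> 1"
      using n by (simp add: divide_le_eq)
    then have "(7 * real n) powr p / real (8 * n) powr p * (node_sum n y g * (decay_const powr (real decay_exp * p) / real n))
        \<le> 1 * (node_sum n y g * (decay_const powr (real decay_exp * p) / real n))"
      by (intro mult_right_mono mult_nonneg_nonneg) auto
    then show "node_sum n y g / real (8 * n) powr p * ((7 * real n) powr p * (decay_const powr (real decay_exp * p) / real n))
        \<le> sampling_const * (node_sum n y g / real (8 * n))"
      using n by (simp add: sampling_const_def mult_ac)
  qed
  finally show ?thesis .
qed

lemma pmean_diff1_samp_repro_kernel:
  assumes n: "n \<ge> 1"
  shows "pmean p (diff1 d (samp (repro_kernel decay_exp n) n y g))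
    \<le> ennreal (bernstein_const * (real n * \<bar>d\<bar>) powr p * (node_sum n y g / real (8 * n)))"
proof -
  define Z where "Z = decay_const powr (real (decay_exp - 1) * p)"
  have eq: "diff1 d (samp (repro_kernel decay_exp n) n y g) = samp (diff1 d (repro_kernel decay_exp n)) n y g"
    by (simp add: fun_eq_iff diff1_def samp_def algebra_simps sum_subtractf diff_divide_distrib)
  have "pmean p (diff1 d (samp (repro_kernel decay_exp n) n y g)) \<le> ennreal (node_sum n y g / real (8 * n) powr p) * pmean p (diff1 d (repro_kernel decay_exp n))"
    unfolding eq by (rule pmean_samp) simp
  also have "\<dots> \<le> ennreal (node_sum n y g / real (8 * n) powr p) *
      ennreal ((28 * real decay_exp * real n * (real n * \<bar>d\<bar>)) powr p * (2 * (Z / real n)))"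
    unfolding Z_def by (intro mult_left_mono pmean_diff1_repro_kernel n) simp
  also have "\<dots> = ennreal (node_sum n y g / real (8 * n) powr p * ((28 * real decay_exp * real n * (real n * \<bar>d\<bar>)) powr p * (2 * (Z / real n))))"
    by (subst ennreal_mult[symmetric]) (auto simp: Z_def)
  also have "\<dots> \<le> ennreal (bernstein_const * (real n * \<bar>d\<bar>) powr p * (node_sum n y g / real (8 * n)))"
  proof (rule ennreal_leI)
    have "(28 * real decay_exp * real n * (real n * \<bar>d\<bar>)) powr p / real (8 * n) powr p
        = (28 * real decay_exp * real n * (real n * \<bar>d\<bar>) / real (8 * n)) powr p"
      by (rule powr_divide[symmetric])
    also have "\<dots> \<le> (4 * real decay_exp * (real n * \<bar>d\<bar>)) powr p"
      using n p_pos by (intro powr_mono2) (auto simp: field_simps)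
    also have "\<dots> = (4 * real decay_exp) powr p * (real n * \<bar>d\<bar>) powr p"
      by (simp add: powr_mult)
    finally have "(28 * real decay_exp * real n * (real n * \<bar>d\<bar>)) powr p / real (8 * n) powr p * (node_sum n y g * (2 * (Z / real n)))
       \<le> (4 * real decay_exp) powr p * (real n * \<bar>d\<bar>) powr p * (node_sum n y g * (2 * (Z / real n)))"
      by (intro mult_right_mono mult_nonneg_nonneg) (auto simp: Z_def)
    then show "node_sum n y g / real (8 * n) powr p * ((28 * real decay_exp * real n * (real n * \<bar>d\<bar>)) powr p * (2 * (Z / real n)))
        \<le> bernstein_const * (real n * \<bar>d\<bar>) powr p * (node_sum n y g / real (8 * n))"
      using n unfolding bernstein_const_def Z_def[symmetric] by (simp add: mult_ac)
  qed
  finally show ?thesis .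
qed

lemma node_sum_measurable [measurable]:
  assumes [measurable]: "g \<in> borel_measurable borel"
  shows "(\<lambda>y. node_sum n y g) \<in> borel_measurable borel"
  unfolding node_sum_def by measurable

lemma nn_integral_node_sum:
  assumes g: "g \<in> periodic_borel" and n: "n \<ge> 1"
  shows "(\<integral>\<^sup>+y. ennreal (node_sum n y g / real (8 * n)) \<partial>circ) = pmean p g"
proof -
  note [measurable] = periodic_borel_measurable[OF g]
  have "(\<integral>\<^sup>+y. ennreal (node_sum n y g / real (8 * n)) \<partial>circ)
      = (\<integral>\<^sup>+y. (\<Sum>k\<in>nodes n. ennreal (1 / real (8 * n)) * ennreal (norm (g (y + of_int k * mesh n)) powr p)) \<partial>circ)"
  proof (rule nn_integral_cong)
    fix y
    have "(\<Sum>k\<in>nodes n. ennreal (1 / real (8 * n)) * ennreal (norm (g (y + of_int k * mesh n)) powr p))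
        = (\<Sum>k\<in>nodes n. ennreal (1 / real (8 * n) * norm (g (y + of_int k * mesh n)) powr p))"
      by (intro sum.cong refl ennreal_mult[symmetric]) auto
    also have "\<dots> = ennreal (\<Sum>k\<in>nodes n. 1 / real (8 * n) * norm (g (y + of_int k * mesh n)) powr p)"
      by (rule sum_ennreal) simp
    finally show "ennreal (node_sum n y g / real (8 * n))
        = (\<Sum>k\<in>nodes n. ennreal (1 / real (8 * n)) * ennreal (norm (g (y + of_int k * mesh n)) powr p))"
      by (simp add: node_sum_def sum_divide_distrib)
  qed
  also have "\<dots> = (\<Sum>k\<in>nodes n. ennreal (1 / real (8 * n)) * (\<integral>\<^sup>+y. ennreal (norm (g (y + of_int k * mesh n)) powr p) \<partial>circ))"
    by (subst nn_integral_sum, simp) (intro sum.cong refl nn_integral_cmult, simp)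
  also have "\<dots> = (\<Sum>k\<in>nodes n. ennreal (1 / real (8 * n)) * pmean p g)"
    using pmean_shift[OF g, of p] by (simp add: pmean_def)
  also have "\<dots> = (of_nat (8 * n) * ennreal (1 / real (8 * n))) * pmean p g"
    by (simp add: mult.assoc)
  also have "of_nat (8 * n) * ennreal (1 / real (8 * n)) = ennreal (real (8 * n) * (1 / real (8 * n)))"
    by (subst ennreal_mult) (auto simp: ennreal_of_nat_eq_real_of_nat)
  also have "real (8 * n) * (1 / real (8 * n)) = 1" using n by simp
  finally show ?thesis by simp
qed

text \<open>Write \<open>T\<close> through its samples on the lattice through \<open>y\<close> and average over \<open>y\<close>.\<close>

lemma bernstein:
  assumes T: "T \<in> trig_polys (2 * n)" and n: "n \<ge> 1"
  shows "pmean p (diff1 d T) \<le> ennreal (bernstein_const * (real n * \<bar>d\<bar>) powr p) * pmean p T"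
proof -
  have ST: "samp (repro_kernel decay_exp n) n y T = T" for y
    by (rule ext) (rule samp_repro_kernel[OF T n])
  note [measurable] = periodic_borel_measurable[OF trig_polys_periodic_borel[OF T]]
  have "pmean p (diff1 d T) = (\<integral>\<^sup>+y. pmean p (diff1 d T) \<partial>circ)" by simp
  also have "\<dots> \<le> (\<integral>\<^sup>+y. ennreal (bernstein_const * (real n * \<bar>d\<bar>) powr p) * ennreal (node_sum n y T / real (8 * n)) \<partial>circ)"
  proof (rule nn_integral_mono)
    fix y
    show "pmean p (diff1 d T) \<le> ennreal (bernstein_const * (real n * \<bar>d\<bar>) powr p) * ennreal (node_sum n y T / real (8 * n))"
      using pmean_diff1_samp_repro_kernel[OF n, of d y T] bernstein_const_pos unfolding ST
      by (subst ennreal_mult[symmetric]) auto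
  qed
  also have "\<dots> = ennreal (bernstein_const * (real n * \<bar>d\<bar>) powr p) * pmean p T"
    by (subst nn_integral_cmult, simp)
       (simp only: nn_integral_node_sum[OF trig_polys_periodic_borel[OF T] n])
  finally show ?thesis .
qed

lemma fdiff_trig_polys: "T \<in> trig_polys n \<Longrightarrow> fdiff k d T \<in> trig_polys n"
  by (induction k) (auto simp: fdiff_Suc intro: trig_polys_diff1)

lemma bernstein_fdiff:
  assumes T: "T \<in> trig_polys (2 * n)" and n: "n \<ge> 1"
  shows "pmean p (fdiff r d T) \<le> ennreal ((bernstein_const * (real n * \<bar>d\<bar>) powr p) ^ r) * pmean p T"
proof (induction r)
  case (Suc r)
  let ?c = "bernstein_const * (real n * \<bar>d\<bar>) powr p"
  have c: "?c \<ge> 0" using bernstein_const_pos by simp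
  have "pmean p (fdiff (Suc r) d T) \<le> ennreal ?c * pmean p (fdiff r d T)"
    unfolding fdiff_Suc by (rule bernstein[OF fdiff_trig_polys[OF T] n])
  also have "\<dots> \<le> ennreal ?c * (ennreal (?c ^ r) * pmean p T)"
    by (intro mult_left_mono Suc) simp
  also have "\<dots> = ennreal (?c ^ Suc r) * pmean p T"
  proof -
    have "ennreal (?c ^ Suc r) = ennreal ?c * ennreal (?c ^ r)"
      unfolding power_Suc using c by (intro ennreal_mult) auto
    then show ?thesis by (simp only: mult.assoc)
  qed
  finally show ?case .
qed simp

text \<open>For \<open>n d \<le> 1\<close> use the Bernstein inequality and \<open>\<alpha> \<le> r\<close>; for larger \<open>d\<close> the trivial bound of
  the difference suffices.\<close>

lemma bernstein_holder:
  assumes T: "T \<in> trig_polys (2 * n)" and n: "n \<ge> 1" and d: "d > 0" and \<alpha>: "0 < \<alpha>" "\<alpha> \<le> real r"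
  shows "ennreal (d powr - (\<alpha> * p)) * pmean p (fdiff r d T)
    \<le> ennreal ((bernstein_const ^ r + 2 ^ r) * sampling_const * (real n powr (\<alpha> * p)) * (node_sum n y T / real (8 * n)))"
proof -
  have n0: "real n > 0" using n by simp
  have ST: "samp (repro_kernel decay_exp n) n y T = T"
    by (rule ext) (rule samp_repro_kernel[OF T n])
  have N: "pmean p T \<le> ennreal (sampling_const * (node_sum n y T / real (8 * n)))"
    using pmean_samp_repro_kernel[OF n, of y T] by (simp only: ST)
  have "ennreal (d powr - (\<alpha> * p)) * pmean p (fdiff r d T) \<le> ennreal ((bernstein_const ^ r + 2 ^ r) * real n powr (\<alpha> * p)) * pmean p T"
  proof (cases "real n * d \<le> 1")
    case True
    have "ennreal (d powr - (\<alpha> * p)) * pmean p (fdiff r d T)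
        \<le> ennreal (d powr - (\<alpha> * p)) * (ennreal ((bernstein_const * (real n * \<bar>d\<bar>) powr p) ^ r) * pmean p T)"
      by (intro mult_left_mono bernstein_fdiff T n) simp
    also have "\<dots> = ennreal (d powr - (\<alpha> * p) * (bernstein_const * (real n * \<bar>d\<bar>) powr p) ^ r) * pmean p T"
      using bernstein_const_pos by (subst ennreal_mult) (auto simp: mult.assoc)
    also have "\<dots> \<le> ennreal ((bernstein_const ^ r + 2 ^ r) * real n powr (\<alpha> * p)) * pmean p T"
    proof (intro mult_right_mono ennreal_leI)
      have e: "d powr - (\<alpha> * p) = real n powr (\<alpha> * p) * (real n * d) powr - (\<alpha> * p)"
        using n0 d by (simp add: powr_mult powr_minus)
      have "d powr - (\<alpha> * p) * (bernstein_const * (real n * \<bar>d\<bar>) powr p) ^ r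
          = bernstein_const ^ r * (real n powr (\<alpha> * p) * ((real n * d) powr - (\<alpha> * p) * (real n * d) powr (p * real r)))"
        using d n0 by (simp add: e power_mult_distrib powr_powr[symmetric] powr_realpow mult_ac)
      also have "(real n * d) powr - (\<alpha> * p) * (real n * d) powr (p * real r) = (real n * d) powr ((real r - \<alpha>) * p)"
        by (simp add: algebra_simps flip: powr_add)
      also have "\<dots> \<le> 1"
        using True d n0 \<alpha> p_pos by (intro powr_le1) auto
      finally have "d powr - (\<alpha> * p) * (bernstein_const * (real n * \<bar>d\<bar>) powr p) ^ r \<le> bernstein_const ^ r * (real n powr (\<alpha> * p) * 1)"
        using bernstein_const_pos by (simp add: mult_left_mono)
      also have "\<dots> \<le> (bernstein_const ^ r + 2 ^ r) * real n powr (\<alpha> * p)"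
        by (simp add: distrib_right)
      finally show "d powr - (\<alpha> * p) * (bernstein_const * (real n * \<bar>d\<bar>) powr p) ^ r \<le> (bernstein_const ^ r + 2 ^ r) * real n powr (\<alpha> * p)" .
    qed simp
    finally show ?thesis .
  next
    case False
    have "d powr - (\<alpha> * p) \<le> (1 / real n) powr - (\<alpha> * p)"
      using False n0 d \<alpha> p_pos by (intro powr_mono2') (auto simp: field_simps)
    also have "\<dots> = real n powr (\<alpha> * p)"
      using n0 by (simp add: powr_divide powr_minus_divide)
    finally have "ennreal (d powr - (\<alpha> * p)) * pmean p (fdiff r d T) \<le> ennreal (real n powr (\<alpha> * p)) * (2 ^ r * pmean p T)"
      using fdiff_le[OF trig_polys_periodic_borel[OF T], of r d] by (intro mult_mono ennreal_leI) auto
    also have "\<dots> = ennreal (2 ^ r * real n powr (\<alpha> * p)) * pmean p T"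
    proof -
      have "(2::ennreal) ^ r = ennreal (2 ^ r)" by (simp flip: ennreal_power)
      then show ?thesis by (simp add: ennreal_mult mult_ac)
    qed
    also have "\<dots> \<le> ennreal ((bernstein_const ^ r + 2 ^ r) * real n powr (\<alpha> * p)) * pmean p T"
      using bernstein_const_pos by (intro mult_right_mono ennreal_leI) auto
    finally show ?thesis .
  qed
  also have "\<dots> \<le> ennreal ((bernstein_const ^ r + 2 ^ r) * real n powr (\<alpha> * p)) * ennreal (sampling_const * (node_sum n y T / real (8 * n)))"
    by (intro mult_left_mono N) simp
  also have "\<dots> = ennreal ((bernstein_const ^ r + 2 ^ r) * sampling_const * (real n powr (\<alpha> * p)) * (node_sum n y T / real (8 * n)))"
    using bernstein_const_pos sampling_const_pos by (subst ennreal_mult[symmetric]) (auto simp: mult_ac)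
  finally show ?thesis .
qed

subsection \<open>Convergence in the mean\<close>

text \<open>Averaged over the offset \<open>y\<close>, sampling error becomes an average over \<open>u\<close> of \<open>\<Delta>\<^sub>u f\<close> with the
  localized weight \<open>w (- u)\<^sup>p\<close>.\<close>

lemma nn_integral_samp_repro_kernel_error:
  assumes f: "f \<in> periodic_borel" and n: "n \<ge> 1"
  shows "(\<integral>\<^sup>+y. pmean p (\<lambda>x. f x - samp (repro_kernel decay_exp n) n y f x) \<partial>circ) \<le> ennreal sampling_const * osc 1 f (1 / real n)"
proof -
  note [measurable] = periodic_borel_measurable[OF f]
  have n0: "real n > 0" using n by simp
  define w where "w z = norm (repro_kernel decay_exp n z) / real (8 * n)" for z
  have [measurable]: "w \<in> borel_measurable borel" unfolding w_def[abs_def] by measurable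
  define G where "G x z = w (x - z) powr p * norm (f x - f z) powr p" for x z
  have Gper: "G x (z + 2 * pi) = G x z" for x z
    by (simp only: G_def w_def periodic_borel_reflect[OF repro_kernel_periodic_borel] periodic_borel_periodic[OF f])
  have [measurable]: "(\<lambda>z. G x z) \<in> borel_measurable borel" for x
    unfolding G_def by measurable
  have pt: "ennreal (norm (f x - samp (repro_kernel decay_exp n) n y f x) powr p)
      \<le> (\<Sum>k\<in>nodes n. ennreal (G x (y + of_int k * mesh n)))" for x y
  proof -
    let ?z = "\<lambda>k. y + of_int k * mesh n"
    have "(\<Sum>k\<in>nodes n. repro_kernel decay_exp n (x - ?z k) / of_nat (8 * n) * (f x - f (?z k)))
        = (f x * (\<Sum>k\<in>nodes n. repro_kernel decay_exp n (x - ?z k)) - (\<Sum>k\<in>nodes n. f (?z k) * repro_kernel decay_exp n (x - ?z k))) / of_nat (8 * n)"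
      unfolding sum_distrib_left sum_subtractf[symmetric] sum_divide_distrib
      by (rule sum.cong) (simp_all add: algebra_simps diff_divide_distrib)
    also have "\<dots> = f x - samp (repro_kernel decay_exp n) n y f x"
      using n by (simp add: sum_repro_kernel_nodes[OF n] samp_def diff_divide_distrib)
    finally have "f x - samp (repro_kernel decay_exp n) n y f x = (\<Sum>k\<in>nodes n. repro_kernel decay_exp n (x - ?z k) / of_nat (8 * n) * (f x - f (?z k)))" ..
    then have "norm (f x - samp (repro_kernel decay_exp n) n y f x) powr p
        \<le> (\<Sum>k\<in>nodes n. norm (repro_kernel decay_exp n (x - ?z k) / of_nat (8 * n) * (f x - f (?z k))) powr p)"
      by (simp only:) (intro norm_sum_powr_le; use p_pos p_less_1 in simp)
    also have "\<dots> = (\<Sum>k\<in>nodes n. G x (?z k))"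
      unfolding G_def w_def norm_mult norm_divide norm_of_nat by (simp only: powr_mult)
    finally have "ennreal (norm (f x - samp (repro_kernel decay_exp n) n y f x) powr p) \<le> ennreal (\<Sum>k\<in>nodes n. G x (?z k))"
      by (rule ennreal_leI)
    then show ?thesis by (subst sum_ennreal) (auto simp: G_def)
  qed
  have inner: "(\<integral>\<^sup>+y. ennreal (G x (y + c)) \<partial>circ) = (\<integral>\<^sup>+u. ennreal (w (- u) powr p) * ennreal (norm (diff1 u f x) powr p) \<partial>circ)" for x c
  proof -
    have "(\<integral>\<^sup>+y. ennreal (G x (y + c)) \<partial>circ) = (\<integral>\<^sup>+y. ennreal (G x y) \<partial>circ)"
      by (rule nn_integral_circ_shift[where \<phi> = "\<lambda>y. ennreal (G x y)"]) (auto simp: Gper)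
    also have "\<dots> = (\<integral>\<^sup>+y. ennreal (G x (y + x)) \<partial>circ)"
      by (rule nn_integral_circ_shift[where \<phi> = "\<lambda>y. ennreal (G x y)", symmetric]) (auto simp: Gper)
    also have "\<dots> = (\<integral>\<^sup>+u. ennreal (w (- u) powr p) * ennreal (norm (diff1 u f x) powr p) \<partial>circ)"
      by (rule nn_integral_cong) (simp add: G_def diff1_def ennreal_mult add.commute)
    finally show ?thesis .
  qed
  have "(\<integral>\<^sup>+y. pmean p (\<lambda>x. f x - samp (repro_kernel decay_exp n) n y f x) \<partial>circ)
      \<le> (\<integral>\<^sup>+y. (\<integral>\<^sup>+x. (\<Sum>k\<in>nodes n. ennreal (G x (y + of_int k * mesh n))) \<partial>circ) \<partial>circ)"
    unfolding pmean_def by (intro nn_integral_mono pt)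
  also have "\<dots> = (\<integral>\<^sup>+x. (\<integral>\<^sup>+y. (\<Sum>k\<in>nodes n. ennreal (G x (y + of_int k * mesh n))) \<partial>circ) \<partial>circ)"
    unfolding G_def by (rule circ_pair.Fubini') measurable
  also have "\<dots> = (\<integral>\<^sup>+x. of_nat (8 * n) * (\<integral>\<^sup>+u. ennreal (w (- u) powr p) * ennreal (norm (diff1 u f x) powr p) \<partial>circ) \<partial>circ)"
    by (subst nn_integral_sum) (auto simp: inner)
  also have "\<dots> = of_nat (8 * n) * (\<integral>\<^sup>+x. (\<integral>\<^sup>+u. ennreal (w (- u) powr p) * ennreal (norm (diff1 u f x) powr p) \<partial>circ) \<partial>circ)"
    unfolding diff1_def by (rule nn_integral_cmult) measurable
  also have "(\<integral>\<^sup>+x. (\<integral>\<^sup>+u. ennreal (w (- u) powr p) * ennreal (norm (diff1 u f x) powr p) \<partial>circ) \<partial>circ)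
      = (\<integral>\<^sup>+u. (\<integral>\<^sup>+x. ennreal (w (- u) powr p) * ennreal (norm (diff1 u f x) powr p) \<partial>circ) \<partial>circ)"
    unfolding diff1_def by (rule circ_pair.Fubini') measurable
  also have "\<dots> = (\<integral>\<^sup>+u. ennreal (w (- u) powr p) * pmean p (diff1 u f) \<partial>circ)"
    unfolding pmean_def by (intro nn_integral_cong nn_integral_cmult) (simp add: diff1_def)
  also have "\<dots> \<le> (\<integral>\<^sup>+u. ennreal (decay_const powr (real decay_exp * p)) * ennreal ((1 + real n * \<bar>u\<bar>) powr - (real decay_exp * p - 1)) * osc 1 f (1 / real n) \<partial>circ)"
  proof (rule nn_integral_mono_AE, rule AE_circ)
    fix u assume u: "u \<in> {- pi..<pi}"
    have "w (- u) \<le> real (2 * (3 * n) + 1) * norm (peak (n div (2 * decay_exp)) (- u)) ^ decay_exp / real (8 * n)"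
      unfolding w_def repro_kernel_def by (intro divide_right_mono norm_kernel_le) simp
    also have "\<dots> \<le> real (8 * n) * norm (peak (n div (2 * decay_exp)) (- u)) ^ decay_exp / real (8 * n)"
      using n by (intro divide_right_mono mult_right_mono) auto
    also have "\<dots> = norm (peak (n div (2 * decay_exp)) (- u)) ^ decay_exp" using n by simp
    finally have "w (- u) powr p \<le> (norm (peak (n div (2 * decay_exp)) (- u)) ^ decay_exp) powr p"
      using p_pos by (intro powr_mono2) (auto simp: w_def)
    also have "\<dots> = norm (peak (n div (2 * decay_exp)) (- u)) powr (real decay_exp * p)"
      by (simp add: powr_powr flip: powr_real_nat[OF norm_ge_zero decay_exp(1)])
    also have "\<dots> \<le> decay_const powr (real decay_exp * p) * (1 + real n * \<bar>u\<bar>) powr - (real decay_exp * p)"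
    proof -
      have "\<bar>- u\<bar> \<le> pi" using u by auto
      from peak_decay_powr[OF this decay_exp(1), of "real decay_exp * p" n] decay_exp(3) show ?thesis by (simp add: decay_const_def)
    qed
    finally have W: "w (- u) powr p \<le> decay_const powr (real decay_exp * p) * (1 + real n * \<bar>u\<bar>) powr - (real decay_exp * p)" .
    have "pmean p (diff1 u f) \<le> ennreal (1 + real n * \<bar>u\<bar>) * osc 1 f (1 / real n)"
      using diff1_osc[OF f, of "1 / real n" u] n0 by (simp add: mult.commute)
    then have "ennreal (w (- u) powr p) * pmean p (diff1 u f)
        \<le> ennreal (decay_const powr (real decay_exp * p) * (1 + real n * \<bar>u\<bar>) powr - (real decay_exp * p)) * (ennreal (1 + real n * \<bar>u\<bar>) * osc 1 f (1 / real n))"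
      using W by (intro mult_mono ennreal_leI) auto
    also have "\<dots> = ennreal (decay_const powr (real decay_exp * p)) * ennreal ((1 + real n * \<bar>u\<bar>) powr - (real decay_exp * p) * (1 + real n * \<bar>u\<bar>)) * osc 1 f (1 / real n)"
      by (subst ennreal_mult, simp, simp, subst ennreal_mult) (auto simp: mult_ac)
    also have "(1 + real n * \<bar>u\<bar>) powr - (real decay_exp * p) * (1 + real n * \<bar>u\<bar>) = (1 + real n * \<bar>u\<bar>) powr - (real decay_exp * p - 1)"
      using powr_add[of "1 + real n * \<bar>u\<bar>" "- (real decay_exp * p)" 1] by (simp add: add_nonneg_pos)
    finally show "ennreal (w (- u) powr p) * pmean p (diff1 u f)
        \<le> ennreal (decay_const powr (real decay_exp * p)) * ennreal ((1 + real n * \<bar>u\<bar>) powr - (real decay_exp * p - 1)) * osc 1 f (1 / real n)" .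
  qed
  also have "\<dots> = ennreal (decay_const powr (real decay_exp * p)) * (\<integral>\<^sup>+u. ennreal ((1 + real n * \<bar>u\<bar>) powr - (real decay_exp * p - 1)) \<partial>circ) * osc 1 f (1 / real n)"
    by (subst nn_integral_multc, simp) (subst nn_integral_cmult, auto)
  also have "\<dots> \<le> ennreal (decay_const powr (real decay_exp * p)) * ennreal (1 / real n) * osc 1 f (1 / real n)"
    using decay_exp(3) by (intro mult_right_mono mult_left_mono nn_integral_decay n) auto
  finally have "(\<integral>\<^sup>+y. pmean p (\<lambda>x. f x - samp (repro_kernel decay_exp n) n y f x) \<partial>circ)
     \<le> of_nat (8 * n) * (ennreal (decay_const powr (real decay_exp * p)) * ennreal (1 / real n) * osc 1 f (1 / real n))"
    by (simp add: mult_left_mono)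
  also have "\<dots> = (of_nat (8 * n) * ennreal (decay_const powr (real decay_exp * p)) * ennreal (1 / real n)) * osc 1 f (1 / real n)"
    by (simp only: mult.assoc)
  also have "of_nat (8 * n) * ennreal (decay_const powr (real decay_exp * p)) * ennreal (1 / real n)
      = ennreal (real (8 * n) * decay_const powr (real decay_exp * p) * (1 / real n))"
    by (subst ennreal_mult, simp, simp, subst ennreal_mult) (auto simp: ennreal_of_nat_eq_real_of_nat)
  also have "real (8 * n) * decay_const powr (real decay_exp * p) * (1 / real n) = sampling_const"
    using n by (simp add: sampling_const_def)
  finally show ?thesis .
qed

lemma osc_halving:
  assumes f: "f \<in> periodic_borel"
  shows "osc R f t \<le> ennreal (2 powr (- real R * p)) * osc R f (2 * t) + 2 ^ R * osc (Suc R) f t"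
  unfolding osc_def[of R f t]
proof (rule SUP_least)
  fix v assume v: "v \<in> {0<..<t}"
  have "pmean p (fdiff R v f) \<le> ennreal (2 powr (- real R * p)) * pmean p (fdiff R (2 * v) f) + 2 ^ R * pmean p (fdiff (Suc R) v f)"
    by (rule fdiff_halving[OF f])
  also have "\<dots> \<le> ennreal (2 powr (- real R * p)) * osc R f (2 * t) + 2 ^ R * osc (Suc R) f t"
    unfolding osc_def using v by (intro add_mono mult_left_mono SUP_upper) auto
  finally show "pmean p (fdiff R v f) \<le> ennreal (2 powr (- real R * p)) * osc R f (2 * t) + 2 ^ R * osc (Suc R) f t" .
qed

lemma osc_finite:
  assumes f: "f \<in> periodic_borel" and fin: "pmean p f < \<infinity>"
  shows "osc R f t < \<infinity>"
proof -
  have "osc R f t \<le> 2 ^ R * pmean p f"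
    unfolding osc_def by (intro SUP_least fdiff_le f)
  also have "\<dots> < \<infinity>" using fin by (simp add: ennreal_mult_less_top power_less_top_ennreal)
  finally show ?thesis .
qed

text \<open>By \<open>osc_halving\<close> the limit \<open>a\<close> of the left-hand sequence satisfies \<open>a \<le> \<theta> a\<close> with \<open>\<theta> < 1\<close>.\<close>

lemma osc_vanish_step:
  assumes f: "f \<in> periodic_borel" and fin: "pmean p f < \<infinity>" and R: "R \<ge> 1"
    and lim: "(\<lambda>j. osc (Suc R) f (1 / 2 ^ j)) \<longlonglongrightarrow> 0"
  shows "(\<lambda>j. osc R f (1 / 2 ^ j)) \<longlonglongrightarrow> 0"
proof -
  define u where "u j = osc R f (1 / 2 ^ j)" for j :: nat
  define a where "a = (INF j. u j)"
  define \<theta> where "\<theta> = 2 powr (- real R * p)"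
  have \<theta>: "0 < \<theta>" "\<theta> < 1" using R p_pos by (auto simp: \<theta>_def powr_less_one)
  have "decseq u"
    unfolding decseq_def u_def by (auto intro!: osc_mono divide_left_mono power_increasing)
  then have ua: "u \<longlonglongrightarrow> a" unfolding a_def by (rule LIMSEQ_INF)
  have le: "u (Suc j) \<le> ennreal \<theta> * u j + 2 ^ R * osc (Suc R) f (1 / 2 ^ Suc j)" for j
    using osc_halving[OF f, of R "1 / 2 ^ Suc j"] by (simp add: u_def \<theta>_def)
  have "(\<lambda>j. ennreal \<theta> * u j + 2 ^ R * osc (Suc R) f (1 / 2 ^ Suc j)) \<longlonglongrightarrow> ennreal \<theta> * a + 2 ^ R * 0"
    by (intro tendsto_add ennreal_tendsto_cmult ua LIMSEQ_Suc[OF lim]) (auto simp: power_less_top_ennreal)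
  then have "a \<le> ennreal \<theta> * a"
    using LIMSEQ_le[OF LIMSEQ_Suc[OF ua]] le by auto
  moreover have "a < \<infinity>"
  proof -
    have "a \<le> u 0" unfolding a_def by (rule INF_lower) simp
    also have "\<dots> < \<infinity>" unfolding u_def by (rule osc_finite[OF f fin])
    finally show ?thesis .
  qed
  ultimately have "a = 0"
  proof (cases a)
    case (real b)
    then have "b \<le> \<theta> * b" using \<open>a \<le> ennreal \<theta> * a\<close> \<theta> by (simp flip: ennreal_mult)
    then have "(1 - \<theta>) * b \<le> 0" by (simp add: algebra_simps)
    then have "b \<le> 0" using \<theta> by (simp add: mult_le_0_iff)
    then show ?thesis using real by simp
  qed simp
  with ua show ?thesis by (simp add: u_def[abs_def])
qed

lemma osc_1_vanish:
  assumes f: "f \<in> periodic_borel" and fin: "pmean p f < \<infinity>" and r: "r \<ge> 1"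
    and lim: "(\<lambda>j. osc r f (1 / 2 ^ j)) \<longlonglongrightarrow> 0"
  shows "(\<lambda>j. osc 1 f (1 / 2 ^ j)) \<longlonglongrightarrow> 0"
  using r lim
proof (induction r rule: dec_induct)
  case (step s)
  show ?case by (rule step.IH) (rule osc_vanish_step[OF f fin step.hyps(1) step.prems])
qed

end


section \<open>Approximation on nested lattices\<close>

text \<open>A point where \<open>A\<close> does not exceed the bound of its mean and, by Fatou's lemma, \<open>R j\<close> comes arbitrarily close
  to \<open>0\<close>.\<close>

lemma exists_good_node:
  fixes A :: "real \<Rightarrow> ennreal" and R :: "nat \<Rightarrow> real \<Rightarrow> ennreal"
  assumes [measurable]: "A \<in> borel_measurable borel" "\<And>j. R j \<in> borel_measurable borel"
    and A: "(\<integral>\<^sup>+y. A y \<partial>circ) \<le> G" and G: "G < \<infinity>"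
    and R: "(\<lambda>j. \<integral>\<^sup>+y. R j y \<partial>circ) \<longlonglongrightarrow> 0"
  shows "\<exists>y. A y \<le> G \<and> liminf (\<lambda>j. R j y) = 0"
proof (rule ccontr)
  assume "\<not> ?thesis"
  then have no: "liminf (\<lambda>j. R j y) = 0 \<Longrightarrow> G < A y" for y by (meson not_le)
  have [measurable]: "(\<lambda>y. liminf (\<lambda>j. R j y)) \<in> borel_measurable borel" by measurable
  have "(\<integral>\<^sup>+y. liminf (\<lambda>j. R j y) \<partial>circ) \<le> liminf (\<lambda>j. \<integral>\<^sup>+y. R j y \<partial>circ)"
    by (rule nn_integral_liminf) simp
  also have "\<dots> = 0" by (rule lim_imp_Liminf[OF _ R]) simp
  finally have "(\<integral>\<^sup>+y. liminf (\<lambda>j. R j y) \<partial>circ) = 0" by simp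
  then have "AE y in circ. liminf (\<lambda>j. R j y) = 0"
    by (subst (asm) nn_integral_0_iff_AE) auto
  then have big: "AE y in circ. G < A y" by eventually_elim (rule no)
  have Afin: "(\<integral>\<^sup>+y. A y \<partial>circ) < \<infinity>" using A G by (rule le_less_trans)
  have "(\<integral>\<^sup>+y. A y - G \<partial>circ) = (\<integral>\<^sup>+y. A y \<partial>circ) - (\<integral>\<^sup>+y. G \<partial>circ)"
    by (rule nn_integral_diff) (use big G Afin in \<open>auto simp: less_top\<close>)
  also have "\<dots> = 0" using A G Afin by (subst diff_eq_0_iff_ennreal) auto
  finally have "AE y in circ. A y - G = 0"
    by (subst (asm) nn_integral_0_iff_AE) auto
  with big have "AE y in circ. False"
    by eventually_elim (use G in \<open>auto simp: diff_eq_0_iff_ennreal\<close>)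
  then have "emeasure circ UNIV = 0"
    by (simp add: AE_iff_null null_sets_def)
  then show False by simp
qed

context Lp_quasi
begin

lemma node_sum_refine: "n \<ge> 1 \<Longrightarrow> node_sum n y g \<le> node_sum (2 * n) y g"
proof -
  assume n: "n \<ge> 1"
  have "node_sum n y g = (\<Sum>k\<in>(\<lambda>k. 2 * k) ` nodes n. norm (g (y + of_int k * mesh (2 * n))) powr p)"
    unfolding node_sum_def using n
    by (subst sum.reindex) (auto simp: inj_on_def mesh_def mult.commute)
  also have "\<dots> \<le> node_sum (2 * n) y g"
    unfolding node_sum_def by (rule sum_mono2) (auto simp: nodes_def)
  finally show ?thesis .
qed

lemma pmean_telescope:
  assumes V: "\<And>i. V i \<in> periodic_borel"
  shows "pmean p (fdiff j d (V 0)) \<le> (\<Sum>i<J. pmean p (fdiff j d (\<lambda>x. V i x - V (Suc i) x))) + pmean p (fdiff j d (V J))"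
proof (induction J)
  case (Suc J)
  have "fdiff j d (V J) = (\<lambda>x. fdiff j d (\<lambda>x. V J x - V (Suc J) x) x + fdiff j d (V (Suc J)) x)"
    by (simp add: fdiff_diff)
  then have "pmean p (fdiff j d (V J)) \<le> pmean p (fdiff j d (\<lambda>x. V J x - V (Suc J) x)) + pmean p (fdiff j d (V (Suc J)))"
    using add_le[of "fdiff j d (\<lambda>x. V J x - V (Suc J) x)" "fdiff j d (V (Suc J))"] V by simp
  then have "(\<Sum>i<J. pmean p (fdiff j d (\<lambda>x. V i x - V (Suc i) x))) + pmean p (fdiff j d (V J))
     \<le> (\<Sum>i<J. pmean p (fdiff j d (\<lambda>x. V i x - V (Suc i) x))) +
       (pmean p (fdiff j d (\<lambda>x. V J x - V (Suc J) x)) + pmean p (fdiff j d (V (Suc J))))"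
    by (rule add_left_mono)
  from order_trans[OF Suc this] show ?case by (simp add: add.assoc)
qed simp

text \<open>The quantity \<open>E i y\<close> is the lattice mean at level \<open>i\<close> of the \<open>m\<close>-th differences, and \<open>V i = f - T\<^sub>i\<close>. On
  the lattice of level \<open>i\<close>, which is contained in that of level \<open>i + 1\<close>, the polynomial
  \<open>T\<^sub>i\<^sub>+\<^sub>1 - T\<^sub>i = V i - V (i + 1)\<close> is bounded by \<open>E i y\<close> and \<open>E (i + 1) y\<close>; off the lattice the
  error is controlled along a subsequence by \<open>R j y\<close>. The polynomial that is found does not depend on the
  step \<open>d\<close>, because the offset \<open>y\<close> is chosen before \<open>d\<close>.\<close>

lemma multilevel_approximation:
  assumes r: "r \<ge> 1" and m: "m \<ge> 1" and \<alpha>: "0 < \<alpha>" "\<alpha> \<le> real r"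
  shows "\<exists>C>0. \<forall>n\<ge>1. \<forall>f\<in>periodic_borel. \<forall>G. pmean p f < \<infinity> \<longrightarrow>
      (\<lambda>j. osc 1 f (1 / 2 ^ j)) \<longlonglongrightarrow> 0 \<longrightarrow> G < \<infinity> \<longrightarrow>
      (\<Sum>i. ennreal (real (n * 2 ^ i) powr (\<alpha> * p)) * pmean p (fdiff m (mesh (n * 2 ^ i)) f)) \<le> G \<longrightarrow>
      (\<exists>T\<in>trig_polys n. pmean p (\<lambda>x. f x - T x) \<le> ennreal C * G \<and>
        (\<forall>d>0. ennreal (d powr - (\<alpha> * p)) * pmean p (fdiff r d (\<lambda>x. f x - T x)) \<le> ennreal C * G))"
proof -
  define c1 where "c1 = (4 * (2 ^ decay_exp * (1 + 8 * real decay_exp) ^ decay_exp) powr p) ^ m"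
  define c4 where "c4 = (bernstein_const ^ r + 2 ^ r + 1) * sampling_const"
  define C where "C = c4 * (c1 * 3)"
  have c1: "c1 > 0" unfolding c1_def using decay_const_pos by (simp add: decay_const_def)
  have c4: "c4 > 0" unfolding c4_def using sampling_const_pos bernstein_const_pos by (intro mult_pos_pos add_pos_pos) auto
  have C: "C > 0" using c1 c4 by (simp add: C_def)
  have "\<exists>T\<in>trig_polys n. pmean p (\<lambda>x. f x - T x) \<le> ennreal C * G \<and>
        (\<forall>d>0. ennreal (d powr - (\<alpha> * p)) * pmean p (fdiff r d (\<lambda>x. f x - T x)) \<le> ennreal C * G)"
    if n: "n \<ge> 1" and f: "f \<in> periodic_borel" and fin: "pmean p f < \<infinity>"
      and van: "(\<lambda>j. osc 1 f (1 / 2 ^ j)) \<longlonglongrightarrow> 0" and G: "G < \<infinity>"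
      and le: "(\<Sum>i. ennreal (real (n * 2 ^ i) powr (\<alpha> * p)) * pmean p (fdiff m (mesh (n * 2 ^ i)) f)) \<le> G"
    for n f G
  proof -
    note [measurable] = periodic_borel_measurable[OF f]
    define lev where "lev i = n * 2 ^ i" for i :: nat
    have lev: "lev i \<ge> 1" "lev (Suc i) = 2 * lev i" for i using n by (auto simp: lev_def)
    define w where "w i = real (lev i) powr (\<alpha> * p)" for i
    have w1: "w i \<ge> 1" for i
      unfolding w_def using lev(1)[of i] \<alpha> p_pos by (intro ge_one_powr_ge_zero) auto
    have wmono: "w i \<le> w (Suc i)" for i
      unfolding w_def lev(2) using \<alpha> p_pos by (intro powr_mono2) auto
    define E where "E i y = node_sum (lev i) y (fdiff m (mesh (lev i)) f) / real (8 * lev i)" for i y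
    have E0: "E i y \<ge> 0" for i y by (simp add: E_def)
    have [measurable]: "fdiff m (mesh (lev i)) f \<in> borel_measurable borel" for i
      using f by (intro periodic_borel_measurable) simp
    have [measurable]: "(\<lambda>y. E i y) \<in> borel_measurable borel" for i unfolding E_def by measurable
    define A where "A y = (\<Sum>i. ennreal (w i) * ennreal (E i y))" for y
    define R where "R j y = pmean p (\<lambda>x. f x - samp (repro_kernel decay_exp (lev j)) (lev j) y f x)" for j y
    have A_meas: "A \<in> borel_measurable borel" unfolding A_def[abs_def] by measurable
    have R_meas: "R j \<in> borel_measurable borel" for j
      unfolding R_def[abs_def] pmean_def samp_def by measurable
    have "(\<integral>\<^sup>+y. A y \<partial>circ) = (\<Sum>i. (\<integral>\<^sup>+y. ennreal (w i) * ennreal (E i y) \<partial>circ))"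
      unfolding A_def by (rule nn_integral_suminf) simp
    also have "\<dots> = (\<Sum>i. ennreal (w i) * pmean p (fdiff m (mesh (lev i)) f))"
    proof (rule arg_cong[where f = suminf], rule ext)
      fix i
      have "(\<integral>\<^sup>+y. ennreal (w i) * ennreal (E i y) \<partial>circ) = ennreal (w i) * (\<integral>\<^sup>+y. ennreal (E i y) \<partial>circ)"
        by (rule nn_integral_cmult) simp
      also have "(\<integral>\<^sup>+y. ennreal (E i y) \<partial>circ) = pmean p (fdiff m (mesh (lev i)) f)"
        unfolding E_def by (rule nn_integral_node_sum) (use f lev in auto)
      finally show "(\<integral>\<^sup>+y. ennreal (w i) * ennreal (E i y) \<partial>circ) = ennreal (w i) * pmean p (fdiff m (mesh (lev i)) f)" .
    qed
    also have "\<dots> \<le> G" using le by (simp only: w_def lev_def)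
    finally have AG: "(\<integral>\<^sup>+y. A y \<partial>circ) \<le> G" .
    have Rlim: "(\<lambda>j. \<integral>\<^sup>+y. R j y \<partial>circ) \<longlonglongrightarrow> 0"
    proof (rule tendsto_sandwich[OF _ _ tendsto_const])
      show "\<forall>\<^sub>F j in sequentially. (\<integral>\<^sup>+y. R j y \<partial>circ) \<le> ennreal sampling_const * osc 1 f (1 / 2 ^ j)"
      proof (rule always_eventually, rule allI)
        fix j
        have "(\<integral>\<^sup>+y. R j y \<partial>circ) \<le> ennreal sampling_const * osc 1 f (1 / real (lev j))"
          unfolding R_def by (rule nn_integral_samp_repro_kernel_error[OF f lev(1)])
        also have "\<dots> \<le> ennreal sampling_const * osc 1 f (1 / 2 ^ j)"
          using n by (intro mult_left_mono osc_mono divide_left_mono) (auto simp: lev_def)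
        finally show "(\<integral>\<^sup>+y. R j y \<partial>circ) \<le> ennreal sampling_const * osc 1 f (1 / 2 ^ j)" .
      qed
      show "(\<lambda>j. ennreal sampling_const * osc 1 f (1 / 2 ^ j)) \<longlonglongrightarrow> 0"
        using ennreal_tendsto_cmult[OF _ van, of "ennreal sampling_const"] by simp
    qed auto
    obtain y where Ay: "A y \<le> G" and Ry: "liminf (\<lambda>j. R j y) = 0"
      using exists_good_node[OF A_meas R_meas AG G Rlim] by blast
    define V where "V i = (sdefect decay_exp (lev i) y ^^ m) f" for i
    have V: "V i \<in> periodic_borel" for i using f by (simp add: V_def)
    have lsV: "node_sum (lev i) y (V i) \<le> c1 * (real (8 * lev i) * E i y)" for i
      using node_sum_sdefect_pow_le[OF f lev(1)[of i] decay_exp(1) decay_exp(3), of y m] lev(1)[of i]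
      by (simp add: V_def c1_def E_def)
    have T: "(\<lambda>x. f x - V i x) \<in> trig_polys (lev i)" for i
      unfolding V_def by (rule sdefect_pow_trig_polys)
    have D: "(\<lambda>x. V i x - V (Suc i) x) \<in> trig_polys (2 * lev i)" for i
    proof -
      have "(\<lambda>x. f x - V i x) \<in> trig_polys (2 * lev i)"
        by (rule trig_polys_mono[OF T]) simp
      from trig_polys_diff[OF T[of "Suc i", unfolded lev(2)] this] show ?thesis by simp
    qed
    have lsD: "node_sum (lev i) y (\<lambda>x. V i x - V (Suc i) x) / real (8 * lev i) \<le> c1 * (E i y + 2 * E (Suc i) y)" for i
    proof -
      have l0: "real (lev i) > 0" using lev(1)[of i] by simp
      have "node_sum (lev i) y (\<lambda>x. V i x - V (Suc i) x) \<le> node_sum (lev i) y (V i) + node_sum (lev i) y (V (Suc i))"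
        by (rule node_sum_diff_le)
      also have "node_sum (lev i) y (V (Suc i)) \<le> node_sum (lev (Suc i)) y (V (Suc i))"
        unfolding lev(2) by (rule node_sum_refine[OF lev(1)])
      also have "\<dots> \<le> c1 * (real (8 * lev (Suc i)) * E (Suc i) y)" by (rule lsV)
      finally have "node_sum (lev i) y (\<lambda>x. V i x - V (Suc i) x)
          \<le> c1 * (real (8 * lev i) * E i y) + c1 * (real (8 * lev (Suc i)) * E (Suc i) y)"
        using lsV[of i] by linarith
      also have "\<dots> = real (8 * lev i) * (c1 * (E i y + 2 * E (Suc i) y))"
        by (simp add: lev(2) algebra_simps)
      finally show ?thesis using l0 by (simp add: pos_divide_le_eq mult.commute)
    qed
    have sumD: "(\<Sum>i<J. ennreal (c4 * w i * (node_sum (lev i) y (\<lambda>x. V i x - V (Suc i) x) / real (8 * lev i)))) \<le> ennreal C * G" for J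
    proof -
      have "(\<Sum>i<J. ennreal (c4 * w i * (node_sum (lev i) y (\<lambda>x. V i x - V (Suc i) x) / real (8 * lev i))))
          \<le> (\<Sum>i<J. ennreal (c4 * c1) * (ennreal (w i) * ennreal (E i y) + 2 * (ennreal (w (Suc i)) * ennreal (E (Suc i) y))))"
      proof (rule sum_mono)
        fix i
        have "c4 * w i * (node_sum (lev i) y (\<lambda>x. V i x - V (Suc i) x) / real (8 * lev i))
            \<le> c4 * w i * (c1 * (E i y + 2 * E (Suc i) y))"
          using c4 w1[of i] by (intro mult_left_mono lsD) auto
        also have "\<dots> = c4 * c1 * (w i * E i y + 2 * (w i * E (Suc i) y))" by (simp add: algebra_simps)
        also have "\<dots> \<le> c4 * c1 * (w i * E i y + 2 * (w (Suc i) * E (Suc i) y))"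
          using c4 c1 E0 wmono by (intro mult_left_mono add_left_mono mult_right_mono) auto
        finally have "ennreal (c4 * w i * (node_sum (lev i) y (\<lambda>x. V i x - V (Suc i) x) / real (8 * lev i)))
            \<le> ennreal (c4 * c1 * (w i * E i y + 2 * (w (Suc i) * E (Suc i) y)))"
          by (rule ennreal_leI)
        also have "\<dots> = ennreal (c4 * c1) * (ennreal (w i) * ennreal (E i y) + 2 * (ennreal (w (Suc i)) * ennreal (E (Suc i) y)))"
        proof -
          have ww: "w i \<ge> 0" for i using w1[of i] by linarith
          have "ennreal (2 * (w (Suc i) * E (Suc i) y)) = 2 * (ennreal (w (Suc i)) * ennreal (E (Suc i) y))"
            using ww E0 by (simp add: ennreal_mult)
          then show ?thesis using c4 c1 ww E0 by (simp add: ennreal_mult)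
        qed
        finally show "ennreal (c4 * w i * (node_sum (lev i) y (\<lambda>x. V i x - V (Suc i) x) / real (8 * lev i)))
            \<le> ennreal (c4 * c1) * (ennreal (w i) * ennreal (E i y) + 2 * (ennreal (w (Suc i)) * ennreal (E (Suc i) y)))" .
      qed
      also have "\<dots> = ennreal (c4 * c1) * ((\<Sum>i<J. ennreal (w i) * ennreal (E i y)) + 2 * (\<Sum>i<J. ennreal (w (Suc i)) * ennreal (E (Suc i) y)))"
        by (simp only: sum.distrib sum_distrib_left[symmetric])
      also have "\<dots> \<le> ennreal (c4 * c1) * (A y + 2 * A y)"
      proof (intro mult_left_mono add_mono)
        show "(\<Sum>i<J. ennreal (w i) * ennreal (E i y)) \<le> A y"
          unfolding A_def by (rule sum_le_suminf) auto
        have "(\<Sum>i<J. ennreal (w (Suc i)) * ennreal (E (Suc i) y)) \<le> (\<Sum>i<Suc J. ennreal (w i) * ennreal (E i y))"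
          by (subst sum.lessThan_Suc_shift) simp
        also have "\<dots> \<le> A y" unfolding A_def by (rule sum_le_suminf) auto
        finally show "(\<Sum>i<J. ennreal (w (Suc i)) * ennreal (E (Suc i) y)) \<le> A y" .
      qed auto
      also have "\<dots> = ennreal (c4 * c1) * (3 * A y)"
      proof -
        have "A y + 2 * A y = (1 + 2) * A y" by (simp only: distrib_right mult_1)
        also have "(1 + 2 :: ennreal) = 3" by simp
        finally show ?thesis by (simp only:)
      qed
      also have "\<dots> \<le> ennreal (c4 * c1) * (3 * G)" by (intro mult_left_mono Ay) auto
      also have "\<dots> = ennreal C * G"
      proof -
        have "ennreal C = ennreal (c4 * c1) * ennreal 3"
          using c4 c1 by (subst ennreal_mult[symmetric]) (auto simp: C_def mult.assoc)
        then show ?thesis by (simp add: mult.assoc)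
      qed
      finally show ?thesis .
    qed
    have rest: "pmean p (V J) \<le> R J y + ennreal (sampling_const * c1) * ennreal (E J y)" for J
    proof -
      have l0: "real (8 * lev J) > 0" using lev(1)[of J] by simp
      let ?S = "samp (repro_kernel decay_exp (lev J)) (lev J) y"
      have "?S (\<lambda>x. f x - V J x) x = f x - V J x" for x
        by (rule samp_repro_kernel[OF trig_polys_mono[OF T] lev(1)]) simp
      then have eq: "V J = (\<lambda>x. (f x - ?S f x) + ?S (V J) x)"
        by (simp add: samp_diff fun_eq_iff algebra_simps)
      have SP: "?S g \<in> periodic_borel" for g
        unfolding repro_kernel_def by (rule trig_polys_periodic_borel[OF samp_in_trig_polys[OF kernel_in_trig_polys]])
      have "pmean p (V J) \<le> R J y + pmean p (?S (V J))"
        unfolding R_def using add_le[of "\<lambda>x. f x - ?S f x" "?S (V J)"] f SP eq[symmetric] by simp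
      also have "pmean p (?S (V J)) \<le> ennreal (sampling_const * (node_sum (lev J) y (V J) / real (8 * lev J)))"
        by (rule pmean_samp_repro_kernel[OF lev(1)])
      also have "\<dots> \<le> ennreal (sampling_const * (c1 * E J y))"
      proof (intro ennreal_leI mult_left_mono)
        show "node_sum (lev J) y (V J) / real (8 * lev J) \<le> c1 * E J y"
          using lsV[of J] l0 by (simp add: pos_divide_le_eq mult_ac)
      qed (use sampling_const_pos in simp)
      also have "\<dots> = ennreal (sampling_const * c1) * ennreal (E J y)"
        using c1 sampling_const_pos E0 by (simp add: ennreal_mult mult.assoc)
      finally show ?thesis by (simp add: add_left_mono)
    qed
    have Elim: "(\<lambda>j. ennreal (E j y)) \<longlonglongrightarrow> 0"
    proof (rule tendsto_sandwich[OF _ _ tendsto_const])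
      define \<theta> where "\<theta> = 2 powr - (\<alpha> * p)"
      have \<theta>: "0 < \<theta>" "\<theta> < 1" using \<alpha> p_pos by (auto simp: \<theta>_def powr_less_one)
      have "(\<lambda>j. \<theta> ^ j) \<longlonglongrightarrow> 0" using \<theta> by (intro LIMSEQ_realpow_zero) auto
      then have "(\<lambda>j. ennreal (\<theta> ^ j)) \<longlonglongrightarrow> ennreal 0" by (rule tendsto_ennrealI)
      then show "(\<lambda>j. G * ennreal (\<theta> ^ j)) \<longlonglongrightarrow> 0"
        using ennreal_tendsto_cmult[of G "\<lambda>j. ennreal (\<theta> ^ j)" 0] G by simp
      show "\<forall>\<^sub>F j in sequentially. ennreal (E j y) \<le> G * ennreal (\<theta> ^ j)"
      proof (rule always_eventually, rule allI)
        fix j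
        have "ennreal (w j) * ennreal (E j y) \<le> (\<Sum>i<Suc j. ennreal (w i) * ennreal (E i y))"
          by simp
        also have "\<dots> \<le> A y" unfolding A_def by (rule sum_le_suminf) auto
        finally have *: "ennreal (w j) * ennreal (E j y) \<le> G" using Ay by (rule order_trans)
        have "1 \<le> \<theta> ^ j * w j"
        proof -
          have "\<theta> ^ j = (2 ^ j) powr - (\<alpha> * p)"
            by (simp add: \<theta>_def powr_powr mult.commute flip: powr_realpow)
          then have "\<theta> ^ j * (2 ^ j) powr (\<alpha> * p) = 1" by (simp add: powr_minus)
          moreover have "(2 ^ j) powr (\<alpha> * p) \<le> w j"
            unfolding w_def lev_def using n \<alpha> p_pos by (intro powr_mono2) auto
          ultimately show ?thesis using \<theta> by (metis mult_left_mono zero_le_power less_imp_le)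
        qed
        then have "1 * ennreal (E j y) \<le> ennreal (\<theta> ^ j * w j) * ennreal (E j y)"
          by (intro mult_right_mono) (auto simp flip: ennreal_1)
        also have "\<dots> = ennreal (\<theta> ^ j) * (ennreal (w j) * ennreal (E j y))"
          using \<theta> w1[of j] by (simp add: ennreal_mult mult.assoc)
        also have "\<dots> \<le> ennreal (\<theta> ^ j) * G" by (intro mult_left_mono *) simp
        finally show "ennreal (E j y) \<le> G * ennreal (\<theta> ^ j)" by (simp add: mult.commute)
      qed
    qed auto
    have small: "\<exists>J. R J y + ennreal (sampling_const * c1) * ennreal (E J y) < ennreal \<epsilon>" if "\<epsilon> > 0" for \<epsilon> :: real
    proof -
      have "(\<lambda>j. ennreal (sampling_const * c1) * ennreal (E j y)) \<longlonglongrightarrow> 0"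
        using ennreal_tendsto_cmult[OF _ Elim, of "ennreal (sampling_const * c1)"] by simp
      then have "\<forall>\<^sub>F j in sequentially. ennreal (sampling_const * c1) * ennreal (E j y) < ennreal (\<epsilon> / 2)"
        by (rule order_tendstoD(2)) (use that in simp)
      then obtain N where N: "\<And>j. j \<ge> N \<Longrightarrow> ennreal (sampling_const * c1) * ennreal (E j y) < ennreal (\<epsilon> / 2)"
        by (auto simp: eventually_sequentially)
      have "(INF j\<in>{N..}. R j y) \<le> liminf (\<lambda>j. R j y)"
        unfolding liminf_SUP_INF by (rule SUP_upper) simp
      also have "\<dots> < ennreal (\<epsilon> / 2)" using Ry that by simp
      finally obtain j where j: "j \<ge> N" "R j y < ennreal (\<epsilon> / 2)"
        by (auto simp: INF_less_iff)
      have "R j y + ennreal (sampling_const * c1) * ennreal (E j y) < ennreal (\<epsilon> / 2) + ennreal (\<epsilon> / 2)"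
        by (rule add_strict_mono[OF j(2) N[OF j(1)]])
      also have "\<dots> = ennreal \<epsilon>" using that by (simp flip: ennreal_plus)
      finally show ?thesis by blast
    qed
    have fin_step: "ennreal \<kappa> * pmean p (fdiff j d (V 0)) \<le> ennreal C * G"
      if \<kappa>: "\<kappa> \<ge> 0" and B: "\<And>i. ennreal \<kappa> * pmean p (fdiff j d (\<lambda>x. V i x - V (Suc i) x))
          \<le> ennreal (c4 * w i * (node_sum (lev i) y (\<lambda>x. V i x - V (Suc i) x) / real (8 * lev i)))" for \<kappa> j d
    proof (rule ennreal_le_epsilon)
      fix e :: real assume e: "0 < e"
      define K where "K = \<kappa> * 2 ^ j + 1"
      have K: "K > 0" using \<kappa> by (simp add: K_def add_nonneg_pos)
      obtain J where J: "R J y + ennreal (sampling_const * c1) * ennreal (E J y) < ennreal (e / K)"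
        using small[of "e / K"] e K by auto
      have "ennreal \<kappa> * pmean p (fdiff j d (V 0))
          \<le> ennreal \<kappa> * ((\<Sum>i<J. pmean p (fdiff j d (\<lambda>x. V i x - V (Suc i) x))) + pmean p (fdiff j d (V J)))"
        by (intro mult_left_mono pmean_telescope V) simp
      also have "\<dots> = (\<Sum>i<J. ennreal \<kappa> * pmean p (fdiff j d (\<lambda>x. V i x - V (Suc i) x))) + ennreal \<kappa> * pmean p (fdiff j d (V J))"
        by (simp add: distrib_left sum_distrib_left)
      also have "\<dots> \<le> ennreal C * G + ennreal e"
      proof (rule add_mono)
        show "(\<Sum>i<J. ennreal \<kappa> * pmean p (fdiff j d (\<lambda>x. V i x - V (Suc i) x))) \<le> ennreal C * G"
          using sum_mono[of "{..<J}", OF B] sumD[of J] by (rule order_trans)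
        have "pmean p (fdiff j d (V J)) \<le> 2 ^ j * pmean p (V J)" by (rule fdiff_le[OF V])
        also have "\<dots> \<le> 2 ^ j * ennreal (e / K)"
          using rest[of J] J by (intro mult_left_mono) auto
        finally have "ennreal \<kappa> * pmean p (fdiff j d (V J)) \<le> ennreal \<kappa> * (2 ^ j * ennreal (e / K))"
          by (rule mult_left_mono) simp
        also have "\<dots> = ennreal (\<kappa> * 2 ^ j * (e / K))"
        proof -
          have "(2::ennreal) ^ j = ennreal (2 ^ j)" by (simp flip: ennreal_power)
          then show ?thesis using \<kappa> e K by (simp add: ennreal_mult[symmetric] mult.assoc)
        qed
        also have "\<dots> \<le> ennreal e"
        proof (rule ennreal_leI)
          have "\<kappa> * 2 ^ j * (e / K) \<le> K * (e / K)"
            using e K by (intro mult_right_mono) (auto simp: K_def)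
          then show "\<kappa> * 2 ^ j * (e / K) \<le> e" using K by simp
        qed
        finally show "ennreal \<kappa> * pmean p (fdiff j d (V J)) \<le> ennreal e" .
      qed
      finally show "ennreal \<kappa> * pmean p (fdiff j d (V 0)) \<le> ennreal C * G + ennreal e" .
    qed
    have c4ge: "sampling_const \<le> c4" "(bernstein_const ^ r + 2 ^ r) * sampling_const \<le> c4"
      using sampling_const_pos bernstein_const_pos by (auto simp: c4_def algebra_simps add_increasing add_increasing2)
    show ?thesis
    proof (intro bexI conjI allI impI)
      show T0: "(\<lambda>x. f x - V 0 x) \<in> trig_polys n" using T[of 0] by (simp add: lev_def)
      have "ennreal 1 * pmean p (fdiff 0 0 (V 0)) \<le> ennreal C * G"
      proof (rule fin_step)
        fix i
        let ?D = "\<lambda>x. V i x - V (Suc i) x"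
        have "samp (repro_kernel decay_exp (lev i)) (lev i) y ?D = ?D"
          by (rule ext) (rule samp_repro_kernel[OF D lev(1)])
        then have "pmean p ?D \<le> ennreal (sampling_const * (node_sum (lev i) y ?D / real (8 * lev i)))"
          using pmean_samp_repro_kernel[OF lev(1)[of i], of y ?D] by (simp only:)
        also have "\<dots> \<le> ennreal (c4 * w i * (node_sum (lev i) y ?D / real (8 * lev i)))"
        proof (intro ennreal_leI mult_right_mono)
          have "sampling_const * 1 \<le> c4 * w i" using c4ge w1[of i] c4 sampling_const_pos by (intro mult_mono) auto
          then show "sampling_const \<le> c4 * w i" by simp
        qed simp
        finally show "ennreal 1 * pmean p (fdiff 0 0 ?D) \<le> ennreal (c4 * w i * (node_sum (lev i) y ?D / real (8 * lev i)))"
          by simp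
      qed simp
      then show "pmean p (\<lambda>x. f x - (f x - V 0 x)) \<le> ennreal C * G" by simp
      fix d :: real assume d: "d > 0"
      have "ennreal (d powr - (\<alpha> * p)) * pmean p (fdiff r d (V 0)) \<le> ennreal C * G"
      proof (rule fin_step)
        fix i
        let ?D = "\<lambda>x. V i x - V (Suc i) x"
        have "ennreal (d powr - (\<alpha> * p)) * pmean p (fdiff r d ?D)
            \<le> ennreal ((bernstein_const ^ r + 2 ^ r) * sampling_const * (real (lev i) powr (\<alpha> * p)) * (node_sum (lev i) y ?D / real (8 * lev i)))"
          by (rule bernstein_holder[OF D lev(1) d \<alpha>])
        also have "\<dots> \<le> ennreal (c4 * w i * (node_sum (lev i) y ?D / real (8 * lev i)))"
          unfolding w_def using c4ge by (intro ennreal_leI mult_right_mono) auto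
        finally show "ennreal (d powr - (\<alpha> * p)) * pmean p (fdiff r d ?D)
            \<le> ennreal (c4 * w i * (node_sum (lev i) y ?D / real (8 * lev i)))" .
      qed simp
      then show "ennreal (d powr - (\<alpha> * p)) * pmean p (fdiff r d (\<lambda>x. f x - (f x - V 0 x))) \<le> ennreal C * G" by simp
    qed
  qed
  with C show ?thesis by blast
qed

end


section \<open>The estimate for \<open>0 < p < 1\<close>\<close>

lemma best_approx_quasi:
  fixes p :: ennreal
  assumes p: "0 < p" "p < 1" and k: "k \<ge> 1" and r: "r \<ge> 1" and \<alpha>: "0 < \<alpha>" "\<alpha> \<le> real r"
  shows "\<exists>C>0. \<forall>f\<in>periodic_borel \<inter> H_space p r \<alpha>. \<forall>n\<ge>1.
    best_approx_H n p r \<alpha> f \<le> ennreal C * modulus_integral (r + k) \<alpha> f (1 / real n) p (enn2real p)"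
proof -
  define P where "P = enn2real p"
  have pfin: "p \<noteq> \<infinity>" using p by auto
  have P: "0 < P" "P < 1" using p unfolding P_def
    by (cases p; auto simp: ennreal_less_iff simp flip: ennreal_1)+
  interpret Lp_quasi P by standard (use P in auto)
  define m where "m = r + k"
  have m: "m \<ge> 1" using k by (simp add: m_def)
  have nrm: "Lp_norm p g = ennpowr (pmean P g) (1 / P)" if "g \<in> periodic_borel" for g
    unfolding P_def by (rule Lp_norm_eq_pmean[OF that pfin])
  have pm: "pmean P g = ennpowr (Lp_norm p g) P" if "g \<in> periodic_borel" for g
    using P by (simp add: nrm[OF that] ennpowr_ennpowr)
  obtain C where C: "C > 0" and main: "\<forall>n\<ge>1. \<forall>f\<in>periodic_borel. \<forall>G. pmean P f < \<infinity> \<longrightarrow>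
      (\<lambda>j. osc 1 f (1 / 2 ^ j)) \<longlonglongrightarrow> 0 \<longrightarrow> G < \<infinity> \<longrightarrow>
      (\<Sum>i. ennreal (real (n * 2 ^ i) powr (\<alpha> * P)) * pmean P (fdiff m (mesh (n * 2 ^ i)) f)) \<le> G \<longrightarrow>
      (\<exists>T\<in>trig_polys n. pmean P (\<lambda>x. f x - T x) \<le> ennreal C * G \<and>
        (\<forall>d>0. ennreal (d powr - (\<alpha> * P)) * pmean P (fdiff r d (\<lambda>x. f x - T x)) \<le> ennreal C * G))"
    using multilevel_approximation[OF r m \<alpha>] by (elim exE conjE)
  define C' where "C' = 2 * (C * (2 ^ m * 2)) powr (1 / P)"
  have C': "C' > 0" using C by (simp add: C'_def)
  have "best_approx_H n p r \<alpha> f \<le> ennreal C' * modulus_integral m \<alpha> f (1 / real n) p P"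
    if f: "f \<in> periodic_borel" and H: "f \<in> H_space p r \<alpha>" and n: "n \<ge> 1" for f n
  proof -
    define I where "I = (\<integral>\<^sup>+t\<in>{0<..<1 / real n}. ennpowr (modulus m f t p / ennreal (t powr \<alpha>)) P * ennreal (1 / t) \<partial>lborel)"
    have MI: "modulus_integral m \<alpha> f (1 / real n) p P = ennpowr I (1 / P)"
      by (simp add: modulus_integral_def I_def)
    show ?thesis
    proof (cases "I = \<infinity>")
      case True
      then show ?thesis using C' by (simp add: MI ennreal_mult_top)
    next
      case False
      define G where "G = ennreal (2 ^ m * 2) * I"
      have G: "G < \<infinity>" using False by (simp add: G_def ennreal_mult_less_top less_top)
      have fin: "Lp_norm p f < \<infinity>" "H_seminorm p r \<alpha> f < \<infinity>"
        using H by (auto simp: H_space_def H_norm_def)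
      then have pmfin: "pmean P f < \<infinity>" using pm[OF f] by simp
      \<comment> \<open>A finite Hoelder seminorm of order \<open>r\<close> makes \<open>\<Delta>\<^sub>v\<^sup>r f\<close> tend to \<open>0\<close>; the ladder passes this on to first differences.\<close>
      have van: "(\<lambda>j. osc 1 f (1 / 2 ^ j)) \<longlonglongrightarrow> 0"
      proof (rule osc_1_vanish[OF f pmfin r], rule tendsto_sandwich[OF _ _ tendsto_const])
        define S where "S = ennpowr (H_seminorm p r \<alpha> f) P"
        define \<theta> where "\<theta> = 2 powr - (\<alpha> * P)"
        have \<theta>: "0 < \<theta>" "\<theta> < 1" using \<alpha> P by (auto simp: \<theta>_def powr_less_one)
        have S: "S < \<infinity>" using fin by (simp add: S_def)
        have "(\<lambda>j. \<theta> ^ j) \<longlonglongrightarrow> 0" using \<theta> by (intro LIMSEQ_realpow_zero) auto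
        then have "(\<lambda>j. ennreal (\<theta> ^ j)) \<longlonglongrightarrow> ennreal 0" by (rule tendsto_ennrealI)
        then show "(\<lambda>j. S * ennreal (\<theta> ^ j)) \<longlonglongrightarrow> 0"
          using ennreal_tendsto_cmult[of S "\<lambda>j. ennreal (\<theta> ^ j)" 0] S by simp
        show "\<forall>\<^sub>F j in sequentially. osc r f (1 / 2 ^ j) \<le> S * ennreal (\<theta> ^ j)"
        proof (rule always_eventually, rule allI)
          fix j
          show "osc r f (1 / 2 ^ j) \<le> S * ennreal (\<theta> ^ j)"
            unfolding osc_def
          proof (rule SUP_least)
            fix v :: real assume v: "v \<in> {0<..<1 / 2 ^ j}"
            have "Lp_norm p (fdiff r v f) = ennreal (v powr \<alpha>) * (ennreal (v powr - \<alpha>) * Lp_norm p (fdiff r v f))"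
              using v by (simp add: mult.assoc[symmetric] powr_minus flip: ennreal_mult)
            also have "\<dots> \<le> ennreal (v powr \<alpha>) * H_seminorm p r \<alpha> f"
              unfolding H_seminorm_def using v by (intro mult_left_mono SUP_upper) auto
            finally have "pmean P (fdiff r v f) \<le> ennpowr (ennreal (v powr \<alpha>) * H_seminorm p r \<alpha> f) P"
              using f P by (simp add: pm ennpowr_mono)
            also have "\<dots> = ennreal (v powr (\<alpha> * P)) * S"
              using P by (simp add: ennpowr_mult ennpowr_ennreal powr_powr S_def)
            also have "\<dots> \<le> ennreal (\<theta> ^ j) * S"
            proof (intro mult_right_mono ennreal_leI)
              have "v powr (\<alpha> * P) \<le> (1 / 2 ^ j) powr (\<alpha> * P)"
                using v \<alpha> P by (intro powr_mono2) auto
              also have "\<dots> = \<theta> ^ j"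
                by (simp add: \<theta>_def powr_divide powr_powr powr_minus_divide power_divide mult.commute flip: powr_realpow)
              finally show "v powr (\<alpha> * P) \<le> \<theta> ^ j" .
            qed simp
            finally show "pmean P (fdiff r v f) \<le> S * ennreal (\<theta> ^ j)" by (simp add: mult.commute)
          qed
        qed
      qed auto
      have "(\<Sum>i. ennreal (real (n * 2 ^ i) powr (\<alpha> * P)) * pmean P (fdiff m (mesh (n * 2 ^ i)) f)) \<le> G"
      proof (rule suminf_le_const)
        fix J
        have "(\<Sum>i<J. ennreal (real (n * 2 ^ i) powr (\<alpha> * P)) * pmean P (fdiff m (mesh (n * 2 ^ i)) f))
           \<le> (\<Sum>i<J. ennreal (2 ^ m) * (ennreal ((1 / real n / 2 ^ i) powr (- \<alpha> * P)) *
                ennpowr (modulus m f (1 / real n / 2 ^ Suc i) p) P))"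
        proof (rule sum_mono)
          fix i
          define N where "N = n * 2 ^ i"
          have N: "real N > 0" using n by (simp add: N_def)
          have "pmean P (fdiff m (mesh N) f) \<le> 2 ^ m * pmean P (fdiff m (mesh N / 2) f)"
            using fdiff_double[OF f, of m "mesh N / 2"] by simp
          also have "\<dots> \<le> 2 ^ m * ennpowr (modulus m f (1 / real n / 2 ^ Suc i) p) P"
          proof (rule mult_left_mono)
            \<comment> \<open>\<open>mesh N / 2 = \<pi> / (8 N) < 1 / (2 N)\<close>; the undivided step would be too large for this modulus.\<close>
            have "mesh N / 2 < 1 / real n / 2 ^ Suc i"
              using N pi_less_4 by (simp add: mesh_def N_def field_simps)
            then have "Lp_norm p (fdiff m (mesh N / 2) f) \<le> modulus m f (1 / real n / 2 ^ Suc i) p"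
              unfolding modulus_def using N by (intro SUP_upper) (auto simp: mesh_def)
            then show "pmean P (fdiff m (mesh N / 2) f) \<le> ennpowr (modulus m f (1 / real n / 2 ^ Suc i) p) P"
              using f P by (simp add: pm ennpowr_mono)
          qed simp
          also have "(2::ennreal) ^ m = ennreal (2 ^ m)" by (simp flip: ennreal_power)
          finally have le: "ennreal (real N powr (\<alpha> * P)) * pmean P (fdiff m (mesh N) f)
             \<le> ennreal (real N powr (\<alpha> * P)) * (ennreal (2 ^ m) * ennpowr (modulus m f (1 / real n / 2 ^ Suc i) p) P)"
            by (rule mult_left_mono) simp
          have W: "(1 / real n / 2 ^ i) powr (- \<alpha> * P) = real N powr (\<alpha> * P)"
          proof -
            have "1 / real n / 2 ^ i = inverse (real N)" by (simp add: N_def field_simps)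
            also have "\<dots> = real N powr - 1" using N by (simp add: powr_minus)
            finally have e: "1 / real n / 2 ^ i = real N powr - 1" .
            show ?thesis unfolding e powr_powr by simp
          qed
          show "ennreal (real (n * 2 ^ i) powr (\<alpha> * P)) * pmean P (fdiff m (mesh (n * 2 ^ i)) f)
             \<le> ennreal (2 ^ m) * (ennreal ((1 / real n / 2 ^ i) powr (- \<alpha> * P)) *
                ennpowr (modulus m f (1 / real n / 2 ^ Suc i) p) P)"
            unfolding W N_def[symmetric] using le by (simp only: mult.left_commute[of "ennreal (2 ^ m)"])
        qed
        also have "\<dots> = ennreal (2 ^ m) * (\<Sum>i<J. ennreal ((1 / real n / 2 ^ i) powr (- \<alpha> * P)) *
                ennpowr (modulus m f (1 / real n / 2 ^ Suc i) p) P)"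
          by (rule sum_distrib_left[symmetric])
        also have "\<dots> \<le> ennreal (2 ^ m) * (2 * I)"
          unfolding I_def
        proof (intro mult_left_mono dyadic_sum_le_nn_integral)
          show "modulus m f s p \<le> modulus m f t p" if "s \<le> t" for s t
            unfolding modulus_def using that by (intro SUP_subset_mono) auto
        qed (use n P \<alpha> in auto)
        also have "\<dots> = G"
        proof -
          have "ennreal (2 ^ m * 2) = ennreal (2 ^ m) * ennreal 2" by (rule ennreal_mult) auto
          then show ?thesis by (simp add: G_def mult.assoc)
        qed
        finally show "(\<Sum>i<J. ennreal (real (n * 2 ^ i) powr (\<alpha> * P)) * pmean P (fdiff m (mesh (n * 2 ^ i)) f)) \<le> G" .
      qed simp
      from main[rule_format, OF n f pmfin van G this]
      obtain T where T: "T \<in> trig_polys n" and N: "pmean P (\<lambda>x. f x - T x) \<le> ennreal C * G"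
        and S: "\<And>d. d > 0 \<Longrightarrow> ennreal (d powr - (\<alpha> * P)) * pmean P (fdiff r d (\<lambda>x. f x - T x)) \<le> ennreal C * G"
        by blast
      have fT: "(\<lambda>x. f x - T x) \<in> periodic_borel" using f trig_polys_periodic_borel[OF T] by simp
      have "Lp_norm p (\<lambda>x. f x - T x) \<le> ennpowr (ennreal C * G) (1 / P)"
        unfolding nrm[OF fT] using N P by (intro ennpowr_mono) auto
      moreover have "H_seminorm p r \<alpha> (\<lambda>x. f x - T x) \<le> ennpowr (ennreal C * G) (1 / P)"
        unfolding H_seminorm_def
      proof (rule SUP_least)
        fix h :: real assume h: "h \<in> {0<..}"
        have "ennreal (h powr - \<alpha>) * Lp_norm p (fdiff r h (\<lambda>x. f x - T x))
            = ennpowr (ennreal (h powr - (\<alpha> * P)) * pmean P (fdiff r h (\<lambda>x. f x - T x))) (1 / P)"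
          using P fT by (simp add: nrm ennpowr_mult ennpowr_ennreal powr_powr)
        also have "\<dots> \<le> ennpowr (ennreal C * G) (1 / P)"
          using S[of h] h P by (intro ennpowr_mono) auto
        finally show "ennreal (h powr - \<alpha>) * Lp_norm p (fdiff r h (\<lambda>x. f x - T x)) \<le> ennpowr (ennreal C * G) (1 / P)" .
      qed
      ultimately have "H_norm p r \<alpha> (\<lambda>x. f x - T x) \<le> 2 * ennpowr (ennreal C * G) (1 / P)"
        unfolding H_norm_def mult_2 by (rule add_mono)
      also have "\<dots> = ennreal C' * ennpowr I (1 / P)"
      proof -
        have "ennreal C * G = ennreal (C * (2 ^ m * 2)) * I"
          using C by (simp add: G_def ennreal_mult mult.assoc)
        then have "ennpowr (ennreal C * G) (1 / P) = ennreal ((C * (2 ^ m * 2)) powr (1 / P)) * ennpowr I (1 / P)"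
          using P C by (simp add: ennpowr_mult ennpowr_ennreal)
        moreover have "ennreal C' = ennreal 2 * ennreal ((C * (2 ^ m * 2)) powr (1 / P))"
          unfolding C'_def by (rule ennreal_mult) auto
        ultimately show ?thesis by (simp add: mult.assoc)
      qed
      finally show ?thesis
        unfolding MI best_approx_H_def using T by (meson INF_lower order_trans)
    qed
  qed
  with C' show ?thesis unfolding m_def P_def by blast
qed

section \<open>Borel representatives and the general case\<close>

lemma AE_lborel_shift:
  assumes "AE x in lborel. Q x" shows "AE x in lborel. Q (x + (u::real))"
proof -
  obtain N where N: "N \<in> null_sets lborel" "{x. \<not> Q x} \<subseteq> N"
    using assms by (auto simp: eventually_ae_filter)
  have "{x. x - (- u) \<in> N} \<in> null_sets lborel" by (rule null_sets_translation[OF N(1)])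
  then show ?thesis
    using N(2) by (intro AE_I'[where N = "{x. x - (- u) \<in> N}"]) auto
qed

lemma fdiff_cong_AE:
  assumes "AE x in lborel. f x = g x"
  shows "AE x in lborel. fdiff k u f x = fdiff k u g x"
proof -
  have "AE x in lborel. \<forall>\<nu>\<in>{..k}. f (x + real \<nu> * u) = g (x + real \<nu> * u)"
    by (subst AE_ball_countable) (auto intro: AE_lborel_shift[OF assms])
  then show ?thesis by eventually_elim (simp add: fdiff_def)
qed

lemma Lp_norm_cong_AE:
  assumes "AE x in lborel. f x = g x" and "p \<noteq> \<infinity>"
  shows "Lp_norm p f = Lp_norm p g"
proof -
  have "AE x in lebesgue. f x = g x" using assms(1) by (rule AE_completion)
  then have "(\<integral>\<^sup>+x\<in>{0..<2*pi}. ennreal (norm (f x) powr enn2real p) \<partial>lebesgue)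
      = (\<integral>\<^sup>+x\<in>{0..<2*pi}. ennreal (norm (g x) powr enn2real p) \<partial>lebesgue)"
    by (intro nn_integral_cong_AE) (auto elim!: eventually_mono)
  then show ?thesis using assms(2) by (simp add: Lp_norm_def)
qed

text \<open>Change \<open>f\<close> on a null set of one period and extend periodically.\<close>

lemma exists_borel_representative:
  assumes f: "f \<in> Lp p"
  shows "\<exists>g\<in>periodic_borel. (p = \<infinity> \<longrightarrow> g = f) \<and> (AE x in lborel. f x = g x)"
proof (cases "p = \<infinity>")
  case True
  then have "f \<in> periodic_borel"
    using f by (auto simp: Lp_def periodic_fun_simple_def intro!: periodic_borelI borel_measurable_continuous_onI)
  then show ?thesis by auto
next
  case False
  have per: "f (x + 2 * pi) = f x" for x using f by (simp add: Lp_def periodic_fun_simple_def)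
  have meas: "f \<in> borel_measurable (completion lborel)" using f False by (simp add: Lp_def)
  have RI: "(\<lambda>x. Re (f x)) \<in> borel_measurable (completion lborel)" "(\<lambda>x. Im (f x)) \<in> borel_measurable (completion lborel)"
    using meas by (auto intro: borel_measurable_continuous_on continuous_intros)
  obtain a where a [measurable]: "a \<in> borel_measurable lborel" and ae_a: "AE x in lborel. Re (f x) = a x"
    using completion_ex_borel_measurable_real[OF RI(1)] by blast
  obtain b where b [measurable]: "b \<in> borel_measurable lborel" and ae_b: "AE x in lborel. Im (f x) = b x"
    using completion_ex_borel_measurable_real[OF RI(2)] by blast
  define g where "g x = Complex (a (wrap x)) (b (wrap x))" for x
  have g_eq: "g = (\<lambda>x. of_real (a (wrap x)) + \<i> * of_real (b (wrap x)))"
    by (simp add: g_def fun_eq_iff complex_eq_iff)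
  have "g \<in> periodic_borel"
  proof (rule periodic_borelI)
    show "g \<in> borel_measurable borel" unfolding g_eq using a b by measurable
    show "g (x + 2 * pi) = g x" for x by (simp add: g_def wrap_periodic)
  qed
  moreover have "AE x in lborel. f x = g x"
  proof -
    have "AE x in lborel. f x = Complex (a x) (b x)"
      using ae_a ae_b by eventually_elim (simp add: complex_eq_iff)
    then have "AE x in lborel. \<forall>j\<in>(UNIV :: int set). f (x + 2 * pi * of_int j) = Complex (a (x + 2 * pi * of_int j)) (b (x + 2 * pi * of_int j))"
      by (subst AE_ball_countable) (auto simp del: complex_eq_iff
          intro!: AE_lborel_shift[where Q = "\<lambda>x. f x = Complex (a x) (b x)"])
    then show ?thesis
    proof eventually_elim
      case (elim x)
      have w: "wrap x = x + 2 * pi * of_int (- \<lfloor>(x + pi) / (2 * pi)\<rfloor>)" by (simp add: wrap_def)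
      have "f x = f (wrap x)" by (rule periodic_wrap[of f, OF per, symmetric])
      also have "\<dots> = g x" unfolding g_def w using elim by blast
      finally show "f x = g x" .
    qed
  qed
  ultimately show ?thesis using False by blast
qed

text \<open>All quantities in the theorem depend only on the almost-everywhere class when \<open>p < \<infinity>\<close>.\<close>

lemma cong_AE_transfer:
  assumes fg: "AE x in lborel. f x = g x" and p: "p \<noteq> \<infinity>"
  shows "modulus m f t p = modulus m g t p"
    and "H_norm p r \<alpha> f = H_norm p r \<alpha> g"
    and "psi_modulus k r \<alpha> f d p = psi_modulus k r \<alpha> g d p"
    and "modulus_integral m \<alpha> f b p q = modulus_integral m \<alpha> g b p q"
    and "best_approx_H n p r \<alpha> f = best_approx_H n p r \<alpha> g"
proof -
  have mod: "modulus m f t p = modulus m g t p" if "AE x in lborel. f x = g x" for f g m t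
    unfolding modulus_def by (intro SUP_cong refl Lp_norm_cong_AE fdiff_cong_AE that p)
  have H: "H_norm p r \<alpha> f = H_norm p r \<alpha> g" if "AE x in lborel. f x = g x" for f g
    unfolding H_norm_def H_seminorm_def
    by (intro arg_cong2[where f = "(+)"] SUP_cong refl Lp_norm_cong_AE fdiff_cong_AE that p arg_cong2[where f = "(*)"])
  show "modulus m f t p = modulus m g t p" by (rule mod[OF fg])
  show "H_norm p r \<alpha> f = H_norm p r \<alpha> g" by (rule H[OF fg])
  show "psi_modulus k r \<alpha> f d p = psi_modulus k r \<alpha> g d p"
    unfolding psi_modulus_def
    by (intro SUP_cong refl arg_cong2[where f = "(*)"] mod fdiff_cong_AE fg)
  show "modulus_integral m \<alpha> f b p q = modulus_integral m \<alpha> g b p q"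
    unfolding modulus_integral_def by (simp add: mod[OF fg])
  show "best_approx_H n p r \<alpha> f = best_approx_H n p r \<alpha> g"
    unfolding best_approx_H_def
  proof (intro INF_cong refl H)
    fix T show "AE x in lborel. f x - T x = g x - T x" using fg by eventually_elim simp
  qed
qed

theorem theorem3p4:
  fixes p :: ennreal and k r :: nat and \<alpha> p1 :: real
  assumes "0 < p" and "k \<ge> 1" and "r \<ge> 1" and "0 < \<alpha>" and "\<alpha> \<le> real r"
    and "p1 = enn2real (min p 1)"
  shows "\<exists>C::real. C > 0 \<and>
    (\<forall>f \<in> H_space p r \<alpha>. \<forall>n::nat. n \<ge> 1 \<longrightarrow>
      (1 \<le> p \<longrightarrow>
        best_approx_H n p r \<alpha> f \<le> ennreal C * psi_modulus k r \<alpha> f (1 / real n) p) \<and>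
      (p < 1 \<longrightarrow>
        best_approx_H n p r \<alpha> f
          \<le> ennreal C * modulus_integral (r + k) \<alpha> f (1 / real n) p (enn2real p)) \<and>
      best_approx_H n p r \<alpha> f
        \<le> ennreal C * modulus_integral (r + k) \<alpha> f (1 / real n) p p1)"
proof -
  have "\<exists>C>0. \<forall>f \<in> periodic_borel \<inter> H_space p r \<alpha>. \<forall>n\<ge>1.
      (1 \<le> p \<longrightarrow> best_approx_H n p r \<alpha> f \<le> ennreal C * psi_modulus k r \<alpha> f (1 / real n) p) \<and>
      (p < 1 \<longrightarrow> best_approx_H n p r \<alpha> f
          \<le> ennreal C * modulus_integral (r + k) \<alpha> f (1 / real n) p (enn2real p)) \<and>
      best_approx_H n p r \<alpha> f \<le> ennreal C * modulus_integral (r + k) \<alpha> f (1 / real n) p p1"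
  proof (cases "1 \<le> p")
    case True
    interpret Lp_Banach p by standard (rule True)
    have p1: "p1 = 1" using assms(6) True by (simp add: min_absorb2)
    obtain C1 where C1: "C1 > 0" and psi: "\<And>n f. n \<ge> 1 \<Longrightarrow> f \<in> L1 \<Longrightarrow>
        best_approx_H n p r \<alpha> f \<le> ennreal C1 * psi_modulus k r \<alpha> f (1 / real n) p"
      using best_approx_le_psi[OF assms(2,4), of r] by blast
    obtain C2 where C2: "C2 > 0" and int: "\<And>n f. n \<ge> 1 \<Longrightarrow> f \<in> periodic_borel \<Longrightarrow>
        psi_modulus k r \<alpha> f (1 / real n) p \<le> ennreal C2 * modulus_integral (r + k) \<alpha> f (1 / real n) p 1"
      using psi_le_modulus_integral[OF assms(2,4,5)] by blast
    define C where "C = max C1 (C1 * C2)"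
    have "best_approx_H n p r \<alpha> f \<le> ennreal C * psi_modulus k r \<alpha> f (1 / real n) p \<and>
        best_approx_H n p r \<alpha> f \<le> ennreal C * modulus_integral (r + k) \<alpha> f (1 / real n) p 1"
      if f: "f \<in> periodic_borel" "f \<in> H_space p r \<alpha>" and n: "n \<ge> 1" for f n
    proof
      have "Lp_norm p f < \<infinity>" using f by (auto simp: H_space_def H_norm_def)
      then have fL: "f \<in> L1" by (rule Lp_norm_finite_L1[OF f(1)])
      note psi[OF n fL]
      also have "ennreal C1 * psi_modulus k r \<alpha> f (1 / real n) p \<le> ennreal C * psi_modulus k r \<alpha> f (1 / real n) p"
        by (intro mult_right_mono ennreal_leI) (auto simp: C_def)
      finally show "best_approx_H n p r \<alpha> f \<le> ennreal C * psi_modulus k r \<alpha> f (1 / real n) p" .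
      note psi[OF n fL]
      also have "ennreal C1 * psi_modulus k r \<alpha> f (1 / real n) p
          \<le> ennreal C1 * (ennreal C2 * modulus_integral (r + k) \<alpha> f (1 / real n) p 1)"
        by (intro mult_left_mono int[OF n f(1)]) simp
      also have "\<dots> = ennreal (C1 * C2) * modulus_integral (r + k) \<alpha> f (1 / real n) p 1"
        using C1 C2 by (simp add: ennreal_mult mult.assoc)
      also have "\<dots> \<le> ennreal C * modulus_integral (r + k) \<alpha> f (1 / real n) p 1"
        by (intro mult_right_mono ennreal_leI) (auto simp: C_def)
      finally show "best_approx_H n p r \<alpha> f \<le> ennreal C * modulus_integral (r + k) \<alpha> f (1 / real n) p 1" .
    qed
    moreover have "C > 0" using C1 by (simp add: C_def less_max_iff_disj)
    ultimately show ?thesis using True p1 by (auto simp: not_less[symmetric])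
  next
    case False
    then have p: "p < 1" by simp
    then have "p1 = enn2real p" using assms(6) by (simp add: min_absorb1 less_imp_le)
    then show ?thesis using best_approx_quasi[OF assms(1) p assms(2-5)] False by auto
  qed
  then obtain C where C: "C > 0" and main: "\<And>f n. f \<in> periodic_borel \<Longrightarrow> f \<in> H_space p r \<alpha> \<Longrightarrow> n \<ge> 1 \<Longrightarrow>
      (1 \<le> p \<longrightarrow> best_approx_H n p r \<alpha> f \<le> ennreal C * psi_modulus k r \<alpha> f (1 / real n) p) \<and>
      (p < 1 \<longrightarrow> best_approx_H n p r \<alpha> f
          \<le> ennreal C * modulus_integral (r + k) \<alpha> f (1 / real n) p (enn2real p)) \<and>
      best_approx_H n p r \<alpha> f \<le> ennreal C * modulus_integral (r + k) \<alpha> f (1 / real n) p p1"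
    by blast
  show ?thesis
  proof (intro exI[of _ C] conjI[OF C] ballI allI impI)
    fix f and n :: nat assume f: "f \<in> H_space p r \<alpha>" and n: "n \<ge> 1"
    then have fLp: "f \<in> Lp p" by (simp add: H_space_def)
    obtain g where g: "g \<in> periodic_borel" "p = \<infinity> \<Longrightarrow> g = f" "AE x in lborel. f x = g x"
      using exists_borel_representative[OF fLp] by blast
    show "(1 \<le> p \<longrightarrow>
        best_approx_H n p r \<alpha> f \<le> ennreal C * psi_modulus k r \<alpha> f (1 / real n) p) \<and>
      (p < 1 \<longrightarrow>
        best_approx_H n p r \<alpha> f
          \<le> ennreal C * modulus_integral (r + k) \<alpha> f (1 / real n) p (enn2real p)) \<and>
      best_approx_H n p r \<alpha> f
        \<le> ennreal C * modulus_integral (r + k) \<alpha> f (1 / real n) p p1"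
    proof (cases "p = \<infinity>")
      case True
      then show ?thesis using main[of f n] g f n by simp
    next
      case False
      note tr = cong_AE_transfer[OF g(3) False]
      have "H_norm p r \<alpha> g < \<infinity>" using f tr(2)[of r \<alpha>] by (simp add: H_space_def)
      moreover from this have "Lp_norm p g < \<infinity>" by (simp add: H_norm_def)
      moreover have "g \<in> borel_measurable lebesgue"
        using periodic_borel_measurable[OF g(1)] by (simp add: measurable_completion)
      ultimately have "g \<in> H_space p r \<alpha>"
        using False g(1) by (simp add: H_space_def Lp_def periodic_fun_simple_def periodic_borel_periodic)
      from main[OF g(1) this n] show ?thesis unfolding tr .
    qed
  qed
qed

end
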